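(* Let $\theta\in\mathbb R\setminus\mathbb Q$, let $K\subset\mathbb C$ be a compact connected set with $0\in K$, $K\neq\{0\}$ and $\mathbb C\setminus K$ connected, and let $f$ be holomorphic and one-to-one on an open neighborhood $U$ of $K$, with $f(0)=0$, $f'(0)=e^{2\pi i\theta}$ and $f(K)=K=f^{-1}(K)$ (where $f^{-1}:f(U)\to U$ is the inverse branch). Assume that the external-circle correspondence (described in the context) holds for $(f,K)$ and that the germ of $f$ at $0$ is not holomorphically linearizable. Then for every continuous function $\varphi:K\to\mathbb C$, $$\lim_{N\to\infty}\sup_{z\in K}\left|\frac1N\sum_{j=0}^{N-1}\varphi(f^j(z))-\varphi(0)\right|=0.$$
   Context: External-circle correspondence for $(f,K)$: let $\mathbb D$ be the open unit disk, $\widehat{\mathbb C}$ the Riemann sphere, and let $h:\widehat{\mathbb C}\setminus\overline{\mathbb D}\to\widehat{\mathbb C}\setminus K$, $h(\infty)=\infty$, be the normalized exterior Riemann map (a conformal bijection). The map $h^{-1}\circ f\circ h$, defined on some annulus $\{1<|\zeta|<1+\epsilon\}$, extends analytically across the unit circle and restricts to an orientation-preserving analytic diffeomorphism of the unit circle, whose rotation number is irrational (with a consistently oriented parametrization it agrees with $\theta$ modulo $1$). The germ of $f$ at $0$ is holomorphically linearizable if there is a holomorphic germ $\chi$ at $0$ with $\chi(0)=0$, $\chi'(0)\ne0$ and $\chi^{-1}\circ f\circ\chi(z)=e^{2\pi i\theta}z$ near $0$. *)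

theory Defs
  imports "HOL-Complex_Analysis.Complex_Analysis"
begin

abbreviation unit_circle :: "complex set" where
  "unit_circle \<equiv> sphere 0 1"

abbreviation disk_exterior :: "complex set" where
  "disk_exterior \<equiv> {\<zeta>. 1 < cmod \<zeta>}"

text \<open>A map \<open>h\<close> of a neighbourhood of infinity fixing infinity, read in the chart
  \<open>w = 1 / \<zeta>\<close> on both sides; the point at infinity corresponds to \<open>w = 0\<close>.\<close>

definition chart_at_infinity :: "(complex \<Rightarrow> complex) \<Rightarrow> complex \<Rightarrow> complex" where
  "chart_at_infinity h w = (if w = 0 then 0 else 1 / h (1 / w))"

text \<open>The conformal bijection from the complement of the closed unit disk onto the
  complement of \<open>K\<close>, both in the Riemann sphere, with \<open>h \<infinity> = \<infinity>\<close>. Only the finite part of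
  \<open>h\<close> is a function on the complex numbers; holomorphy at infinity is expressed in the chart
  above. The normalization is the usual one: the derivative at infinity is positive, which
  makes \<open>h\<close> unique.\<close>

definition exterior_riemann_map :: "complex set \<Rightarrow> (complex \<Rightarrow> complex) \<Rightarrow> bool" where
  "exterior_riemann_map K h \<longleftrightarrow>
     h holomorphic_on disk_exterior \<and>
     bij_betw h disk_exterior (- K) \<and>
     chart_at_infinity h analytic_on {0} \<and>
     (\<exists>c::real. 0 < c \<and> deriv (chart_at_infinity h) 0 = of_real c)"

text \<open>Analytic maps of the circle are the restrictions of maps holomorphic near the circle.\<close>

definition analytic_circle_diffeo :: "(complex \<Rightarrow> complex) \<Rightarrow> bool" where
  "analytic_circle_diffeo g \<longleftrightarrow>
     bij_betw g unit_circle unit_circle \<and>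
     (\<exists>G. G analytic_on unit_circle \<and> (\<forall>\<zeta>\<in>unit_circle. G \<zeta> = g \<zeta>)) \<and>
     (\<exists>H. H analytic_on unit_circle \<and>
          (\<forall>\<zeta>\<in>unit_circle. H \<zeta> = inv_into unit_circle g \<zeta>))"

text \<open>Lifts are taken with respect to the counterclockwise parametrization
  \<open>x \<mapsto> exp (2 \<pi> i x)\<close>.\<close>

definition increasing_circle_lift :: "(complex \<Rightarrow> complex) \<Rightarrow> (real \<Rightarrow> real) \<Rightarrow> bool" where
  "increasing_circle_lift g F \<longleftrightarrow>
     continuous_on UNIV F \<and> strict_mono F \<and> (\<forall>x. F (x + 1) = F x + 1) \<and>
     (\<forall>x. g (cis (2 * pi * x)) = cis (2 * pi * F x))"

definition orientation_preserving_on_circle :: "(complex \<Rightarrow> complex) \<Rightarrow> bool" where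
  "orientation_preserving_on_circle g \<longleftrightarrow> (\<exists>F. increasing_circle_lift g F)"

text \<open>The rotation number is defined modulo 1; the predicate holds for each of its real
  representatives, one for each lift.\<close>

definition has_rotation_number :: "(complex \<Rightarrow> complex) \<Rightarrow> real \<Rightarrow> bool" where
  "has_rotation_number g \<rho> \<longleftrightarrow>
     (\<exists>F. increasing_circle_lift g F \<and>
          (\<forall>x. (\<lambda>n. ((F ^^ n) x - x) / real n) \<longlonglongrightarrow> \<rho>))"

text \<open>Here \<open>U\<close> is the domain of \<open>f\<close>, and \<open>g\<close> is the analytic extension of
  \<open>h\<inverse> \<circ> f \<circ> h\<close> across the unit circle.\<close>

definition external_circle_correspondence ::
  "complex set \<Rightarrow> (complex \<Rightarrow> complex) \<Rightarrow> complex set \<Rightarrow> real \<Rightarrow> bool" where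
  "external_circle_correspondence U f K \<theta> \<longleftrightarrow>
     (\<exists>h g \<epsilon>. exterior_riemann_map K h \<and> 0 < \<epsilon> \<and>
        (\<forall>\<zeta>. 1 < cmod \<zeta> \<and> cmod \<zeta> < 1 + \<epsilon> \<longrightarrow>
             h \<zeta> \<in> U \<and> f (h \<zeta>) \<in> - K \<and> g \<zeta> = inv_into disk_exterior h (f (h \<zeta>))) \<and>
        g analytic_on unit_circle \<and>
        analytic_circle_diffeo g \<and>
        orientation_preserving_on_circle g \<and>
        (\<exists>\<rho>. has_rotation_number g \<rho> \<and> \<rho> \<notin> \<rat> \<and> \<rho> - \<theta> \<in> \<int>))"

text \<open>Here \<open>\<eta>\<close> represents the germ at \<open>0\<close> of the inverse of \<open>\<xi>\<close>.\<close>

definition holomorphically_linearizable :: "(complex \<Rightarrow> complex) \<Rightarrow> real \<Rightarrow> bool" where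
  "holomorphically_linearizable f \<theta> \<longleftrightarrow>
     (\<exists>\<xi> \<eta>. \<xi> analytic_on {0} \<and> \<xi> 0 = 0 \<and> deriv \<xi> 0 \<noteq> 0 \<and>
        \<eta> analytic_on {0} \<and> (\<forall>\<^sub>F z in nhds 0. \<eta> (\<xi> z) = z) \<and>
        (\<forall>\<^sub>F z in nhds 0. \<eta> (f (\<xi> z)) = cis (2 * pi * \<theta>) * z))"

end

theory Submission
  imports Defs
begin

text \<open>
  Since \<open>\<complement>K\<close> is connected and \<open>0\<close> lies on the boundary of \<open>K\<close> (otherwise \<open>f\<close> would be
  linearizable), there are functions \<open>G\<close> holomorphic near \<open>K\<close> with \<open>G(0)\<close> close to 1, \<open>\<bar>G\<bar>\<close> at most
  slightly larger than 1 on \<open>K\<close>, and \<open>\<bar>G\<bar>\<close> small on \<open>K\<close> outside a given neighbourhood of \<open>0\<close>. If the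
  Birkhoff averages of every function holomorphic near \<open>K\<close> converge uniformly on \<open>K\<close> to its value at
  \<open>0\<close>, then, applied to \<open>1 - Re G\<close>, this shows that orbits spend almost all their time near \<open>0\<close>.

  The averages of a holomorphic \<open>P\<close> are controlled from outside. By Denjoy's theorem and bounded
  distortion there are curves surrounding \<open>K\<close>, which in the exterior coordinate have height over the
  circle comparable to the displacement \<open>m\<close> of \<open>F\<^sup>q\<close> (\<open>F\<close> the lifted circle map, \<open>q\<close> the denominator of a
  convergent of the rotation number), whose first \<open>N = q + q'\<close> images stay close to \<open>K\<close>, where \<open>q'\<close>
  is the next denominator. Points of a curve whose orbits shadow each other are at bounded
  hyperbolic distance, and by normality a map from a disk into the thin region around \<open>K\<close> is almost
  constant on smaller disks. So the average of length \<open>N\<close> is almost constant on the curve, and by the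
  maximum principle on everything inside it, in particular on \<open>K\<close>.
\<close>

section \<open>Peak functions at boundary points\<close>

text \<open>The set \<open>K\<close> may be very irregular and \<open>h\<close> need not extend to
  the circle, so no boundary values are available: every estimate is made at positive height, and
  the maximum principle carries it to \<open>K\<close>. The height is proportional to
  \<open>gap\<close> because smallness comes from hyperbolic geometry: a box over an arc
  \<open>[u, u + gap u]\<close> has bounded hyperbolic size, and bounded distortion preserves this
  through \<open>q + q'\<close> iterates. That number of iterates answers two needs: the points of
  an orbit segment must begin arcs that cover the circle, and after the segment the orbit must be
  back in the arc where it began, so that sliding the segment along the orbit hardly changes the
  sum. The constant approached by the averages is read off at the fixed point \<open>0\<close>,
  which the curve surrounds. One time \<open>N\<close> for each accuracy is enough, since long
  orbits can be cut into blocks of length \<open>N\<close>.\<close>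

definition slit_sqrt :: "(real \<Rightarrow> complex) \<Rightarrow> complex \<Rightarrow> complex" where
  "slit_sqrt \<gamma> z = exp (of_real pi * \<i> * winding_number \<gamma> z)"

text \<open>With end points \<open>a\<close> and \<open>b\<close>, the exponential of 2 pi i times
  the winding number of an open path is \<open>(b - z) / (a - z)\<close>; half the exponent gives a
  branch of the square root of this quotient off the path.\<close>

lemma slit_sqrt_square:
  assumes "path \<gamma>" "z \<notin> path_image \<gamma>"
  shows "(slit_sqrt \<gamma> z)\<^sup>2 * (pathstart \<gamma> - z) = pathfinish \<gamma> - z"
proof -
  have "(slit_sqrt \<gamma> z)\<^sup>2 = exp (2 * pi * \<i> * winding_number \<gamma> z)"
    by (simp add: slit_sqrt_def mult.assoc flip: exp_double)
  then show ?thesis using winding_number_exp_2pi[OF assms] by simp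
qed

text \<open>The square \<open>k\<close> is holomorphic and the branch is continuous, so the
  difference quotient of the branch is that of \<open>k\<close> divided by the sum of its two
  values, which has a nonzero limit.\<close>

lemma slit_sqrt_holomorphic:
  assumes "path \<gamma>"
  shows "slit_sqrt \<gamma> holomorphic_on - path_image \<gamma>"
proof -
  have "slit_sqrt \<gamma> field_differentiable at z" if z: "z \<in> - path_image \<gamma>" for z
  proof -
    define a b where "a = pathstart \<gamma>" and "b = pathfinish \<gamma>"
    define k where "k = (\<lambda>w. (b - w) / (a - w))"
    have ab: "a \<in> path_image \<gamma>" unfolding a_def by (rule pathstart_in_path_image)
    have sq: "(slit_sqrt \<gamma> w)\<^sup>2 = k w" if "w \<in> - path_image \<gamma>" for w
    proof -
      have "a - w \<noteq> 0" using ab that by auto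
      then show ?thesis
        using slit_sqrt_square[OF assms, of w] that by (simp add: k_def a_def b_def field_simps)
    qed
    have op: "open (- path_image \<gamma>)" using closed_path_image[OF assms] by auto
    have "a \<noteq> z" using ab z by auto
    then have "k field_differentiable at z" unfolding k_def
      by (intro derivative_intros) auto
    then obtain k' where k': "((\<lambda>w. (k w - k z) / (w - z)) \<longlongrightarrow> k') (at z)"
      by (auto simp: field_differentiable_def has_field_derivative_iff)
    have cont: "slit_sqrt \<gamma> \<midarrow>z\<rightarrow> slit_sqrt \<gamma> z"
      unfolding slit_sqrt_def using continuous_at_winding_number[OF assms, of z] z
      by (intro tendsto_intros) (auto simp: continuous_at)
    have nz: "slit_sqrt \<gamma> z \<noteq> 0" by (simp add: slit_sqrt_def)
    have "((\<lambda>w. ((k w - k z) / (w - z)) / (slit_sqrt \<gamma> w + slit_sqrt \<gamma> z)) \<longlongrightarrow>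
        k' / (slit_sqrt \<gamma> z + slit_sqrt \<gamma> z)) (at z)"
      using nz by (intro tendsto_divide k' tendsto_add cont tendsto_const) auto
    moreover have "\<forall>\<^sub>F w in at z. ((k w - k z) / (w - z)) / (slit_sqrt \<gamma> w + slit_sqrt \<gamma> z) =
        (slit_sqrt \<gamma> w - slit_sqrt \<gamma> z) / (w - z)"
    proof -
      have "\<forall>\<^sub>F w in at z. slit_sqrt \<gamma> w + slit_sqrt \<gamma> z \<noteq> 0"
        using nz by (intro tendsto_imp_eventually_ne[OF tendsto_add[OF cont tendsto_const]]) auto
      moreover have "\<forall>\<^sub>F w in at z. w \<in> - path_image \<gamma>"
        using op z by (rule eventually_at_in_open')
      ultimately show ?thesis
      proof eventually_elim
        case (elim w)
        have "k w - k z = (slit_sqrt \<gamma> w - slit_sqrt \<gamma> z) * (slit_sqrt \<gamma> w + slit_sqrt \<gamma> z)"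
          using sq[of w] sq[of z] elim z by (simp add: power2_eq_square algebra_simps)
        then show ?case using elim(1) by simp
      qed
    qed
    ultimately have "((\<lambda>w. (slit_sqrt \<gamma> w - slit_sqrt \<gamma> z) / (w - z)) \<longlongrightarrow>
        k' / (slit_sqrt \<gamma> z + slit_sqrt \<gamma> z)) (at z)"
      by (rule Lim_transform_eventually)
    then show ?thesis by (auto simp: field_differentiable_def has_field_derivative_iff)
  qed
  then show ?thesis
    using field_differentiable_at_within holomorphic_on_def by blast
qed

text \<open>Seen from outside the disk, the path can be replaced by the segment joining its ends,
  because the linear homotopy stays in the convex disk; the integral over the segment is at most
  length over distance.\<close>

lemma winding_number_far:
  assumes "path \<gamma>" "path_image \<gamma> \<subseteq> cball 0 r" "r < cmod z"
  shows "cmod (of_real pi * \<i> * winding_number \<gamma> z) \<le> r / (cmod z - r)"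
proof -
  define a b where "a = pathstart \<gamma>" and "b = pathfinish \<gamma>"
  have ab: "a \<in> cball 0 r" "b \<in> cball 0 r" using assms(2) by (auto simp: a_def b_def)
  have seg: "closed_segment u v \<subseteq> cball 0 r" if "u \<in> cball 0 r" "v \<in> cball 0 r" for u v :: complex
    using that by (simp add: closed_segment_subset)
  have z: "z \<notin> cball 0 r" using assms(3) by simp
  have "winding_number \<gamma> z = winding_number (linepath a b) z"
  proof (rule winding_number_paths_linear_eq[symmetric, of "linepath a b" \<gamma>, symmetric])
    show "z \<notin> closed_segment (linepath a b t) (\<gamma> t)" if "t \<in> {0..1}" for t
    proof -
      have "linepath a b t \<in> cball 0 r" "\<gamma> t \<in> cball 0 r"
        using seg[OF ab] assms(2) that by (auto simp: path_image_def linepath_in_path subset_iff)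
      then show ?thesis using seg z by blast
    qed
  qed (auto simp: assms a_def b_def)
  moreover have "cmod (2 * of_real pi * \<i> * winding_number (linepath a b) z) \<le> 1 / (cmod z - r) * cmod (b - a)"
  proof (rule has_contour_integral_bound_linepath)
    have "z \<notin> path_image (linepath a b)" using seg[OF ab] z by auto
    then show "((\<lambda>w. 1 / (w - z)) has_contour_integral 2 * of_real pi * \<i> * winding_number (linepath a b) z) (linepath a b)"
      using has_contour_integral_winding_number[of "linepath a b" z] by simp
    show "cmod (1 / (x - z)) \<le> 1 / (cmod z - r)" if "x \<in> closed_segment a b" for x
    proof -
      have "cmod x \<le> r" using seg[OF ab] that by auto
      then have "cmod z - r \<le> cmod (x - z)" using norm_triangle_ineq2[of z x] by (simp add: norm_minus_commute)
      then show ?thesis using assms(3) by (simp add: norm_divide frac_le)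
    qed
  qed (use assms(3) in auto)
  moreover have "cmod (b - a) \<le> 2 * r"
    using ab norm_triangle_ineq4[of b a] by simp
  then have "1 / (cmod z - r) * cmod (b - a) \<le> 1 / (cmod z - r) * (2 * r)"
    using assms(3) by (intro mult_left_mono) auto
  moreover have "cmod (2 * of_real pi * \<i> * winding_number \<gamma> z) = 2 * cmod (of_real pi * \<i> * winding_number \<gamma> z)"
    by (simp add: norm_mult)
  ultimately show ?thesis by simp
qed

text \<open>The two branches of the square root never agree, and near infinity the chosen branch is
  close to 1; hence it stays away from \<open>-1\<close> everywhere.\<close>

lemma slit_sqrt_avoids:
  assumes \<gamma>: "path \<gamma>" "path_image \<gamma> \<subseteq> cball 0 r" and z: "z \<notin> path_image \<gamma>"
    and r: "0 < r" "cmod (pathstart \<gamma>) \<le> r / 2" "cmod (pathfinish \<gamma>) = r"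
  shows "1 / 30 \<le> cmod (slit_sqrt \<gamma> z + 1)"
proof (rule ccontr)
  assume *: "\<not> ?thesis"
  define a b s where "a = pathstart \<gamma>" and "b = pathfinish \<gamma>" and "s = slit_sqrt \<gamma> z"
  \<comment> \<open>A value of \<open>s\<close> this close to \<open>-1\<close> has its square close
    to 1, which forces \<open>z\<close> to be far from the slit; there the exponent is small and
    \<open>s\<close> has positive real part.\<close>
  have v: "cmod (s + 1) < 1 / 30" using * by (simp add: s_def)
  have "(a - z) * (s\<^sup>2 - 1) = b - a"
    using slit_sqrt_square[OF \<gamma>(1) z] by (simp add: a_def b_def s_def algebra_simps)
  then have 1: "cmod (a - z) * cmod (s\<^sup>2 - 1) = cmod (b - a)" by (metis norm_mult)
  have "r / 2 \<le> cmod (b - a)" using norm_triangle_ineq2[of b a] r by (simp add: a_def b_def)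
  have "s\<^sup>2 - 1 = (s + 1) * ((s + 1) - 2)" by (simp add: algebra_simps power2_eq_square)
  then have "cmod (s\<^sup>2 - 1) = cmod (s + 1) * cmod ((s + 1) - 2)" by (metis norm_mult)
  also have "\<dots> \<le> 1 / 30 * 3"
    using v norm_triangle_ineq4[of "s + 1" 2] by (intro mult_mono) auto
  finally have "cmod (a - z) * cmod (s\<^sup>2 - 1) \<le> cmod (a - z) * (1 / 10)" by (intro mult_left_mono) auto
  then have "5 * r \<le> cmod (a - z)" using 1 \<open>r / 2 \<le> cmod (b - a)\<close> by simp
  then have far: "4 * r \<le> cmod z" using norm_triangle_ineq4[of a z] r by (simp add: a_def)
  define h where "h = of_real pi * \<i> * winding_number \<gamma> z"
  have "cmod h \<le> r / (cmod z - r)"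
    unfolding h_def using far r by (intro winding_number_far[OF \<gamma>]) auto
  also have "\<dots> \<le> 1 / 3" using far r by (simp add: field_simps)
  finally have "\<bar>Im h\<bar> \<le> 1 / 3"
    using abs_Im_le_cmod order_trans by blast
  then have "cos (Im h) > 0"
    using pi_gt3 by (intro cos_gt_zero_pi) auto
  then have "0 < Re s" unfolding s_def slit_sqrt_def h_def[symmetric] by (simp add: Re_exp)
  then show False using v abs_Re_le_cmod[of "s + 1"] by simp
qed

text \<open>With a slit from a point very close to \<open>0\<close> to a point at distance \<open>r\<close> from it, the branch \<open>s\<close> is large at
  \<open>0\<close> and close to 1 at distances much larger than \<open>r\<close>, and \<open>g = (s - 1) / (s + 1)\<close>.\<close>

lemma peak_aux:
  assumes K: "compact K" "connected (- K)" "0 \<in> K" "0 \<in> closure (- K)" and "0 < \<delta>" "0 < \<epsilon>"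
  shows "\<exists>g V. open V \<and> K \<subseteq> V \<and> g holomorphic_on V \<and> (\<forall>z\<in>K. cmod (g z) \<le> 61) \<and>
    cmod (g 0 - 1) \<le> \<epsilon> \<and> (\<forall>z\<in>K. \<delta> \<le> cmod z \<longrightarrow> cmod (g z) \<le> \<epsilon>)"
proof -
  \<comment> \<open>\<open>R\<close> compares \<delta> with the scale \<open>r\<close> of the slit:
    the 5 makes the exponent \<open>h\<close> at most 1/4 from distance \<delta> on, and the summand
    \<open>4 / \<epsilon>\<close> makes \<open>2 / (R - 1)\<close> at most \<epsilon>.\<close>
  define R where "R = 5 + 4 / \<epsilon>"
  have R: "5 \<le> R" using \<open>0 < \<epsilon>\<close> by (simp add: R_def)
  define r where "r = \<delta> / R"
  have r: "0 < r" "R * r = \<delta>" using R \<open>0 < \<delta>\<close> by (auto simp: r_def)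
  \<comment> \<open>The first bound is required for avoiding \<open>-1\<close>. The second makes the
    square of \<open>s 0\<close>, of modulus \<open>r / cmod a\<close>, so large that
    \<open>2 / (s 0 + 1)\<close> has modulus at most \<epsilon>.\<close>
  define e where "e = min (r / 2) (r / (1 + 2 / \<epsilon>)\<^sup>2)"
  have "0 < e" unfolding e_def using r \<open>0 < \<epsilon>\<close>
    by (smt (verit) divide_pos_pos half_gt_zero min_less_iff_conj zero_less_power)
  then obtain a where a: "a \<in> - K" "cmod a < e"
    using K(4) unfolding closure_approachable by auto
  have a0: "a \<noteq> 0" using a K by auto
  obtain M where M: "\<And>z. z \<in> K \<Longrightarrow> cmod z < M"
    using compact_imp_bounded[OF K(1)] by (metis bounded_pos_less)
  define c where "c = complex_of_real (\<bar>M\<bar> + r + 1)"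
  have cnorm: "cmod c = \<bar>M\<bar> + r + 1" using r by (simp add: c_def del: of_real_add)
  then have c: "c \<in> - K" "c \<notin> ball 0 r" using M[of c] r by auto
  have "path_connected (- K)"
    using K connected_open_path_connected compact_imp_closed by blast
  then obtain \<gamma>0 where \<gamma>0: "path \<gamma>0" "path_image \<gamma>0 \<subseteq> - K" "pathstart \<gamma>0 = a" "pathfinish \<gamma>0 = c"
    using a c unfolding path_connected_def by blast
  \<comment> \<open>The path is cut at its first exit from the disk of radius \<open>r\<close>, so
    that the slit is short and still avoids \<open>K\<close>.\<close>
  have "pathstart \<gamma>0 \<in> closure (ball 0 r)" "pathfinish \<gamma>0 \<notin> ball 0 r"
    using a c r \<gamma>0 by (auto simp: e_def)
  from exists_path_subpath_to_frontier[OF \<gamma>0(1) this] obtain \<gamma> where \<gamma>: "path \<gamma>"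
    "pathstart \<gamma> = pathstart \<gamma>0" "path_image \<gamma> \<subseteq> path_image \<gamma>0"
    "path_image \<gamma> - {pathfinish \<gamma>} \<subseteq> interior (ball 0 r)" "pathfinish \<gamma> \<in> frontier (ball 0 r)" by metis
  have im: "path_image \<gamma> \<subseteq> cball 0 r" "path_image \<gamma> \<inter> K = {}"
    using \<gamma>(3-5) r \<gamma>0(2) by (auto simp: subset_iff)
  have b: "cmod (pathfinish \<gamma>) = r" using \<gamma>(5) r by simp
  have ar: "cmod (pathstart \<gamma>) \<le> r / 2" using a by (simp add: \<gamma> \<gamma>0 e_def)
  note avoid = slit_sqrt_avoids[OF \<gamma>(1) im(1) _ r(1) ar b]
  define s where "s = slit_sqrt \<gamma>"
  \<comment> \<open>Since \<open>s z + 1\<close> has modulus at least 1/30, the bound on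
    \<open>g\<close> is 61 = 1 + 2 * 30.\<close>
  define g where "g = (\<lambda>z. 1 - 2 / (s z + 1))"
  have nz: "s z + 1 \<noteq> 0" if "z \<notin> path_image \<gamma>" for z
    using avoid[OF that] by (auto simp: s_def)
  show ?thesis
  proof (intro exI conjI ballI impI)
    show "open (- path_image \<gamma>)" using closed_path_image[OF \<gamma>(1)] by auto
    show "K \<subseteq> - path_image \<gamma>" using im by auto
    show "g holomorphic_on - path_image \<gamma>"
      unfolding g_def s_def using nz
      by (intro holomorphic_intros slit_sqrt_holomorphic \<gamma>) (auto simp: s_def)
    show "cmod (g z) \<le> 61" if "z \<in> K" for z
    proof -
      have "1 / 30 \<le> cmod (s z + 1)" using avoid[of z] im that by (auto simp: s_def)
      then have "cmod (2 / (s z + 1)) \<le> 60" by (simp add: norm_divide divide_le_eq)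
      then show ?thesis using norm_triangle_ineq4[of 1 "2 / (s z + 1)"] by (simp add: g_def)
    qed
    show "cmod (g 0 - 1) \<le> \<epsilon>"
    proof -
      have "(s 0)\<^sup>2 * a = pathfinish \<gamma>"
        using slit_sqrt_square[OF \<gamma>(1), of 0] im K(3) by (auto simp: s_def \<gamma> \<gamma>0)
      then have "(cmod (s 0))\<^sup>2 * cmod a = r" using b by (metis norm_mult norm_power)
      moreover have "(1 + 2 / \<epsilon>)\<^sup>2 * cmod a \<le> r"
      proof -
        have "cmod a \<le> r / (1 + 2 / \<epsilon>)\<^sup>2" using a by (simp add: e_def)
        moreover have "0 < 1 + 2 / \<epsilon>" using \<open>0 < \<epsilon>\<close> by (simp add: add_pos_pos)
        then have "(1 + 2 / \<epsilon>)\<^sup>2 > 0" by (rule zero_less_power)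
        ultimately show ?thesis by (simp add: pos_le_divide_eq mult.commute)
      qed
      ultimately have "(1 + 2 / \<epsilon>)\<^sup>2 \<le> (cmod (s 0))\<^sup>2"
        using a0 by (metis mult_le_cancel_right norm_ge_zero norm_le_zero_iff not_le)
      then have "1 + 2 / \<epsilon> \<le> cmod (s 0)" by (rule power2_le_imp_le) simp
      then have "2 / \<epsilon> \<le> cmod (s 0 + 1)" using norm_diff_ineq[of "s 0" 1] by simp
      moreover have "0 < 2 / \<epsilon>" using \<open>0 < \<epsilon>\<close> by simp
      ultimately have "2 / cmod (s 0 + 1) \<le> 2 / (2 / \<epsilon>)" by (intro frac_le) auto
      then show ?thesis by (simp add: g_def norm_divide)
    qed
    show "cmod (g z) \<le> \<epsilon>" if z: "z \<in> K" "\<delta> \<le> cmod z" for z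
    proof -
      define h where "h = of_real pi * \<i> * winding_number \<gamma> z"
      have far: "R * r \<le> cmod z" using z r by simp
      moreover have "5 * r \<le> R * r" using R r(1) by (intro mult_right_mono) auto
      ultimately have "r < cmod z" using r by linarith
      from winding_number_far[OF \<gamma>(1) im(1) this] have "cmod h \<le> r / (cmod z - r)" by (simp add: h_def)
      also have "\<dots> \<le> r / ((R - 1) * r)"
      proof (rule frac_le)
        show "(R - 1) * r \<le> cmod z - r" using far by (simp add: algebra_simps)
      qed (use R r in auto)
      also have "\<dots> = 1 / (R - 1)" using r by simp
      finally have h: "cmod h \<le> 1 / (R - 1)" .
      also have "\<dots> \<le> 1 / 4" using R by (simp add: field_simps)
      finally have h4: "cmod h \<le> 1 / 4" .
      have "cos (Im h) > 0"
        using pi_gt3 h4 abs_Im_le_cmod[of h] by (intro cos_gt_zero_pi) auto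
      then have "0 < Re (s z)" by (simp add: s_def slit_sqrt_def Re_exp h_def)
      then have s1: "1 \<le> cmod (s z + 1)" using abs_Re_le_cmod[of "s z + 1"] by simp
      have "cmod (exp h - 1) \<le> exp \<bar>Re h\<bar> * cmod h" using Taylor_exp[of h 0] by simp
      also have "\<dots> \<le> 2 * (1 / (R - 1))"
      proof (intro mult_mono h)
        have "exp \<bar>Re h\<bar> \<le> exp (1 / 2 :: real)" using h4 abs_Re_le_cmod[of h] by simp
        also have "\<dots> \<le> 1 + 2 * (1 / 2)" using exp_bound_lemma[of "1 / 2 :: real"] by simp
        finally show "exp \<bar>Re h\<bar> \<le> 2" by simp
      qed auto
      also have "\<dots> \<le> \<epsilon>" using \<open>0 < \<epsilon>\<close> R by (simp add: R_def field_simps)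
      finally have "cmod (s z - 1) \<le> \<epsilon>" by (simp add: s_def slit_sqrt_def h_def)
      moreover have "s z + 1 \<noteq> 0" using s1 by auto
      then have "g z = (s z - 1) / (s z + 1)" by (simp add: g_def field_simps)
      moreover have "cmod (s z - 1) / cmod (s z + 1) \<le> cmod (s z - 1) / 1"
        using s1 by (intro frac_le) auto
      ultimately show ?thesis by (simp add: norm_divide)
    qed
  qed
qed

text \<open>Summing such functions over a rapidly decreasing sequence of scales: at every point at most
  one summand is neither close to 0 nor close to 1.\<close>

lemma peak_sum:
  assumes K: "compact K" "connected (- K)" "0 \<in> K" "0 \<in> closure (- K)" and "0 < \<delta>" "0 < \<epsilon>"
  shows "\<exists>g V. open V \<and> K \<subseteq> V \<and> g holomorphic_on V \<and> (\<forall>z\<in>K. cmod (g z) \<le> real n * (1 + \<epsilon>) + 61) \<and>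
    cmod (g 0 - of_nat n) \<le> real n * \<epsilon> \<and> (\<forall>z\<in>K. \<delta> \<le> cmod z \<longrightarrow> cmod (g z) \<le> real n * \<epsilon>)"
proof (induction n)
  case 0
  show ?case by (intro exI[of _ "\<lambda>_. 0"] exI[of _ UNIV]) auto
next
  case (Suc n)
  then obtain g V where g: "open V" "K \<subseteq> V" "g holomorphic_on V"
    "\<And>z. z \<in> K \<Longrightarrow> cmod (g z) \<le> real n * (1 + \<epsilon>) + 61" "cmod (g 0 - of_nat n) \<le> real n * \<epsilon>"
    "\<And>z. z \<in> K \<Longrightarrow> \<delta> \<le> cmod z \<Longrightarrow> cmod (g z) \<le> real n * \<epsilon>" by blast
  have "isCont g 0"
    using g K(3) by (meson holomorphic_on_imp_continuous_on continuous_on_eq_continuous_at subsetD)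
  then obtain d where d: "0 < d" "\<And>z. cmod z < d \<Longrightarrow> cmod (g z - g 0) < \<epsilon>"
    using \<open>0 < \<epsilon>\<close> unfolding continuous_at_eps_delta by (auto simp: dist_norm)
  \<comment> \<open>Inside the new scale the old sum stays within \<epsilon> of \<open>g 0\<close>,
    so the 61 is spent only on the new summand; outside it the new summand adds at most
    \<epsilon>.\<close>
  define \<delta>' where "\<delta>' = min \<delta> d"
  have "0 < \<delta>'" using d \<open>0 < \<delta>\<close> by (simp add: \<delta>'_def)
  from peak_aux[OF K this \<open>0 < \<epsilon>\<close>] obtain k W where k: "open W" "K \<subseteq> W" "k holomorphic_on W"
    "\<And>z. z \<in> K \<Longrightarrow> cmod (k z) \<le> 61" "cmod (k 0 - 1) \<le> \<epsilon>"
    "\<And>z. z \<in> K \<Longrightarrow> \<delta>' \<le> cmod z \<Longrightarrow> cmod (k z) \<le> \<epsilon>" by blast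
  show ?case
  proof (intro exI conjI ballI impI)
    show "open (V \<inter> W)" "K \<subseteq> V \<inter> W" using g k by auto
    show "(\<lambda>z. g z + k z) holomorphic_on V \<inter> W"
      by (intro holomorphic_intros holomorphic_on_subset[OF g(3)] holomorphic_on_subset[OF k(3)]) auto
    show "cmod (g z + k z) \<le> real (Suc n) * (1 + \<epsilon>) + 61" if z: "z \<in> K" for z
    proof (cases "\<delta>' \<le> cmod z")
      case True
      then show ?thesis
        using g(4)[OF z] k(6)[OF z] norm_triangle_ineq[of "g z" "k z"] by (simp add: algebra_simps)
    next
      case False
      then have "cmod z < \<delta>'" by simp
      then have "cmod z < d" by (simp add: \<delta>'_def)
      have "g z = (g z - g 0) + (g 0 - of_nat n) + of_nat n" by simp
      then have "cmod (g z) \<le> cmod (g z - g 0) + cmod (g 0 - of_nat n) + real n"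
        by (metis norm_of_nat norm_triangle_le norm_triangle_mono order_refl)
      also have "\<dots> \<le> \<epsilon> + real n * \<epsilon> + real n"
        using d(2)[OF \<open>cmod z < d\<close>] g(5) by simp
      finally show ?thesis
        using k(4)[OF z] norm_triangle_ineq[of "g z" "k z"] by (simp add: algebra_simps)
    qed
    have "g 0 + k 0 - of_nat (Suc n) = (g 0 - of_nat n) + (k 0 - 1)" by simp
    then show "cmod (g 0 + k 0 - of_nat (Suc n)) \<le> real (Suc n) * \<epsilon>"
      using norm_triangle_ineq[of "g 0 - of_nat n" "k 0 - 1"] g(5) k(5) by (simp add: algebra_simps)
    show "cmod (g z + k z) \<le> real (Suc n) * \<epsilon>" if z: "z \<in> K" "\<delta> \<le> cmod z" for z
    proof -
      have "\<delta>' \<le> cmod z" using z by (simp add: \<delta>'_def min.coboundedI1)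
      then show ?thesis
        using g(6)[OF z] k(6)[OF z(1)] norm_triangle_ineq[of "g z" "k z"] by (simp add: algebra_simps)
    qed
  qed
qed

text \<open>Division by \<open>n\<close> makes the excess 61 caused by the one uncontrolled summand
  negligible: \<open>122 / \<epsilon> < n\<close> brings it below \<epsilon> / 2.\<close>

lemma peak_function:
  assumes K: "compact K" "connected (- K)" "0 \<in> K" "0 \<in> closure (- K)" and "0 < \<delta>" "0 < \<epsilon>"
  shows "\<exists>g V. open V \<and> K \<subseteq> V \<and> g holomorphic_on V \<and> (\<forall>z\<in>K. cmod (g z) \<le> 1 + \<epsilon>) \<and>
    cmod (g 0 - 1) \<le> \<epsilon> \<and> (\<forall>z\<in>K. \<delta> \<le> cmod z \<longrightarrow> cmod (g z) \<le> \<epsilon>)"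
proof -
  obtain n :: nat where n: "122 / \<epsilon> < real n" using reals_Archimedean2 by blast
  then have n0: "0 < real n" using \<open>0 < \<epsilon>\<close> by (meson divide_pos_pos less_trans zero_less_numeral)
  have "0 < \<epsilon> / 2" using \<open>0 < \<epsilon>\<close> by simp
  from peak_sum[OF K \<open>0 < \<delta>\<close> this, of n] obtain g V where g: "open V" "K \<subseteq> V" "g holomorphic_on V"
    "\<And>z. z \<in> K \<Longrightarrow> cmod (g z) \<le> real n * (1 + \<epsilon> / 2) + 61" "cmod (g 0 - of_nat n) \<le> real n * (\<epsilon> / 2)"
    "\<And>z. z \<in> K \<Longrightarrow> \<delta> \<le> cmod z \<Longrightarrow> cmod (g z) \<le> real n * (\<epsilon> / 2)" by blast
  have n1: "122 < real n * \<epsilon>" using n \<open>0 < \<epsilon>\<close> by (simp add: divide_less_eq)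
  show ?thesis
  proof (intro exI conjI ballI impI)
    show "(\<lambda>z. g z / of_nat n) holomorphic_on V" using n0 by (intro holomorphic_intros g) auto
    show "cmod (g z / of_nat n) \<le> 1 + \<epsilon>" if "z \<in> K" for z
      using g(4)[OF that] n0 n1 by (simp add: norm_divide divide_le_eq algebra_simps)
    have "g 0 / of_nat n - 1 = (g 0 - of_nat n) / of_nat n" using n0 by (simp add: field_simps)
    then show "cmod (g 0 / of_nat n - 1) \<le> \<epsilon>"
      using g(5) n0 n1 by (simp add: norm_divide divide_le_eq algebra_simps)
    show "cmod (g z / of_nat n) \<le> \<epsilon>" if "z \<in> K" "\<delta> \<le> cmod z" for z
      using g(6)[OF that] n0 n1 by (simp add: norm_divide divide_le_eq algebra_simps)
  qed (use g in auto)
qed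

section \<open>Holomorphic disks in thin regions\<close>

text \<open>Rescaled to the unit disk, maps violating the bound would converge to an open map into \<open>K\<close>,
  although their values at \<open>0\<close> lie outside \<open>K\<close>.\<close>

lemma small_derivative:
  fixes S :: "nat \<Rightarrow> complex set"
  assumes bounded: "bounded (S 0)" and decr: "\<And>m n. m \<le> n \<Longrightarrow> S n \<subseteq> S m"
    and disj: "\<And>n. S n \<inter> K = {}"
    and limit: "\<And>x z. (\<And>n. x n \<in> S n) \<Longrightarrow> x \<longlonglongrightarrow> z \<Longrightarrow> z \<in> K"
    and "0 < \<epsilon>"
  shows "\<exists>n. \<forall>\<psi> w r. 0 < r \<longrightarrow> \<psi> holomorphic_on ball w r \<longrightarrow> \<psi> ` ball w r \<subseteq> S n \<longrightarrow>
    cmod (deriv \<psi> w) * r \<le> \<epsilon>"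
proof (rule ccontr)
  assume "\<not> ?thesis"
  then have "\<forall>n. \<exists>\<psi> w r. 0 < r \<and> \<psi> holomorphic_on ball w r \<and> \<psi> ` ball w r \<subseteq> S n \<and>
    \<epsilon> < cmod (deriv \<psi> w) * r" unfolding not_ex not_all not_imp not_le conj_assoc .
  from choice[OF this] obtain \<psi> where "\<forall>n. \<exists>w r. 0 < r \<and> \<psi> n holomorphic_on ball w r \<and>
    \<psi> n ` ball w r \<subseteq> S n \<and> \<epsilon> < cmod (deriv (\<psi> n) w) * r" ..
  from choice[OF this] obtain w where "\<forall>n. \<exists>r. 0 < r \<and> \<psi> n holomorphic_on ball (w n) r \<and>
    \<psi> n ` ball (w n) r \<subseteq> S n \<and> \<epsilon> < cmod (deriv (\<psi> n) (w n)) * r" ..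
  from choice[OF this] obtain r where "\<forall>n. 0 < r n \<and> \<psi> n holomorphic_on ball (w n) (r n) \<and>
    \<psi> n ` ball (w n) (r n) \<subseteq> S n \<and> \<epsilon> < cmod (deriv (\<psi> n) (w n)) * r n" ..
  then have h: "\<And>n. 0 < r n" "\<And>n. \<psi> n holomorphic_on ball (w n) (r n)"
    "\<And>n. \<psi> n ` ball (w n) (r n) \<subseteq> S n" "\<And>n. \<epsilon> < cmod (deriv (\<psi> n) (w n)) * r n" by blast+
  define f where "f = (\<lambda>n z. \<psi> n (w n + of_real (r n) * z))"
  have in_ball: "w n + of_real (r n) * z \<in> ball (w n) (r n)" if "z \<in> ball 0 1" for n z
    using that h(1)[of n] by (simp add: dist_norm norm_mult abs_of_pos)
  have hol: "f n holomorphic_on ball 0 1" for n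
  proof -
    have "(\<psi> n \<circ> (\<lambda>z. w n + of_real (r n) * z)) holomorphic_on ball 0 1"
      by (rule holomorphic_on_compose_gen[OF _ h(2)[of n]])
        (use in_ball in \<open>auto intro!: holomorphic_intros\<close>)
    then show ?thesis by (simp add: f_def o_def)
  qed
  have im: "f n ` ball 0 1 \<subseteq> S n" for n
    using in_ball h(3)[of n] by (auto simp: f_def)
  have der: "deriv (f n) 0 = deriv (\<psi> n) (w n) * of_real (r n)" for n
  proof (rule DERIV_imp_deriv)
    have "(\<psi> n has_field_derivative deriv (\<psi> n) (w n)) (at (w n))"
      using h(1,2)[of n] by (intro holomorphic_derivI[where S = "ball (w n) (r n)"]) auto
    then have "(\<psi> n has_field_derivative deriv (\<psi> n) (w n)) (at (w n + of_real (r n) * 0))" by simp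
    moreover have "((\<lambda>z. w n + of_real (r n) * z) has_field_derivative of_real (r n)) (at 0)"
      by (auto intro!: derivative_eq_intros)
    ultimately show "(f n has_field_derivative deriv (\<psi> n) (w n) * of_real (r n)) (at 0)"
      unfolding f_def by (rule DERIV_chain2)
  qed
  obtain M where M: "\<And>z. z \<in> S 0 \<Longrightarrow> cmod z \<le> M" using bounded by (auto simp: bounded_iff)
  obtain g \<sigma> where g: "g holomorphic_on ball 0 1" "strict_mono (\<sigma> :: nat \<Rightarrow> nat)"
    "\<And>x. x \<in> ball 0 1 \<Longrightarrow> (\<lambda>n. f (\<sigma> n) x) \<longlonglongrightarrow> g x"
    "\<And>C. compact C \<Longrightarrow> C \<subseteq> ball 0 1 \<Longrightarrow> uniform_limit C (f \<circ> \<sigma>) g sequentially"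
  proof (rule Montel[of "ball 0 1" "{f. f holomorphic_on ball 0 1 \<and> f ` ball 0 1 \<subseteq> S 0}" f])
    show "range f \<subseteq> {f. f holomorphic_on ball 0 1 \<and> f ` ball 0 1 \<subseteq> S 0}"
      using hol im decr[of 0] by blast
    show "\<exists>B. \<forall>h\<in>{f. f holomorphic_on ball 0 1 \<and> f ` ball 0 1 \<subseteq> S 0}. \<forall>z\<in>C. norm (h z) \<le> B"
      if "compact C" "C \<subseteq> ball 0 1" for C using that M by (intro exI[of _ M]) blast
  qed auto
  have "\<exists>g'. \<forall>x\<in>ball 0 1. (g has_field_derivative g' x) (at x) \<and> (\<lambda>n. deriv (f (\<sigma> n)) x) \<longlonglongrightarrow> g' x"
  proof (rule has_complex_derivative_uniform_sequence)
    show "(f (\<sigma> n) has_field_derivative deriv (f (\<sigma> n)) x) (at x)" if "x \<in> ball 0 1" for n x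
      using hol that by (intro holomorphic_derivI[where S = "ball 0 1"]) auto
    show "\<exists>d>0. cball x d \<subseteq> ball 0 1 \<and> uniform_limit (cball x d) (\<lambda>n. f (\<sigma> n)) g sequentially"
      if x: "x \<in> ball 0 1" for x
    proof -
      obtain d where "0 < d" "cball x d \<subseteq> ball 0 1"
        using open_contains_cball[THEN iffD1, OF open_ball, THEN bspec, OF x] by blast
      then show ?thesis using g(4)[of "cball x d"] by (auto simp: o_def)
    qed
  qed auto
  then obtain d where d: "(g has_field_derivative d) (at 0)" "(\<lambda>n. deriv (f (\<sigma> n)) 0) \<longlonglongrightarrow> d"
    by (metis centre_in_ball zero_less_one)
  have "\<epsilon> \<le> cmod (deriv (f n) 0)" for n
    using h(4)[of n] h(1)[of n] by (simp add: der norm_mult)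
  then have "\<epsilon> \<le> cmod d"
    by (intro LIMSEQ_le_const[OF tendsto_norm[OF d(2)]]) auto
  then have d0: "d \<noteq> 0" using \<open>0 < \<epsilon>\<close> by auto
  have "\<not> g constant_on ball 0 1"
  proof
    assume "g constant_on ball 0 1"
    then obtain c where c: "\<And>z. z \<in> ball 0 1 \<Longrightarrow> g z = c" by (auto simp: constant_on_def)
    have "((\<lambda>_. c) has_field_derivative d) (at 0)"
      by (rule has_field_derivative_transform_within_open[OF d(1), of "ball 0 1"]) (use c in auto)
    then show False using d0 DERIV_const DERIV_unique by blast
  qed
  then have "open (g ` ball 0 1)"
    by (intro open_mapping_thm[OF g(1)]) auto
  moreover have "g 0 \<in> g ` ball 0 1" by simp
  ultimately have "\<forall>\<^sub>F n in sequentially. f (\<sigma> n) 0 \<in> g ` ball 0 1"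
    using g(3)[of 0] by (intro topological_tendstoD) auto
  moreover have "g ` ball 0 1 \<subseteq> K"
  proof
    fix z assume "z \<in> g ` ball 0 1"
    then obtain x where x: "x \<in> ball 0 1" "z = g x" by auto
    have "f (\<sigma> n) x \<in> S n" for n
      using im[of "\<sigma> n"] x decr[OF seq_suble[OF g(2), of n]] by blast
    then show "z \<in> K" using limit[of "\<lambda>n. f (\<sigma> n) x" z] g(3)[OF x(1)] x(2) by simp
  qed
  moreover have "f (\<sigma> n) 0 \<notin> K" for n
    using im[of "\<sigma> n"] disj[of "\<sigma> n"] by (metis centre_in_ball disjoint_iff image_subset_iff zero_less_one)
  ultimately show False
    using eventually_happens'[OF sequentially_bot] by blast
qed

text \<open>Turns derivative bounds at the centres of disks, the form in which
  \<open>small_derivative\<close> supplies them, into a bound on the oscillation over a whole convex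
  set of centres.\<close>

lemma cmod_diff_le_of_balls:
  assumes "convex C" "0 < r"
    and hol: "\<And>z. z \<in> C \<Longrightarrow> \<psi> holomorphic_on ball z r"
    and bound: "\<And>z. z \<in> C \<Longrightarrow> cmod (deriv \<psi> z) * r \<le> \<epsilon>" and "w \<in> C" "w' \<in> C"
  shows "cmod (\<psi> w - \<psi> w') \<le> \<epsilon> / r * cmod (w - w')"
proof (rule field_differentiable_bound[OF assms(1) _ _ assms(5,6)])
  show "(\<psi> has_field_derivative deriv \<psi> z) (at z within C)" if "z \<in> C" for z
    by (rule has_field_derivative_at_within, rule holomorphic_derivI[OF hol[OF that]])
      (use \<open>0 < r\<close> in auto)
  show "cmod (deriv \<psi> z) \<le> \<epsilon> / r" if "z \<in> C" for z
    using bound[OF that] \<open>0 < r\<close> by (simp add: pos_le_divide_eq)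
qed

section \<open>Linearization at interior points\<close>

text \<open>At an interior point of \<open>K\<close> the iterates of \<open>f\<close> form a normal family, and any limit of the
  means of \<open>\<lambda>\<^sup>-\<^sup>j f\<^sup>j\<close> conjugates \<open>f\<close> to its linear part.\<close>

lemma linearizable_if_interior:
  assumes K: "compact K" "0 \<in> interior K" and U: "open U" "K \<subseteq> U" "f holomorphic_on U"
    and f: "f 0 = 0" "deriv f 0 = cis (2 * pi * \<theta>)" "f ` K \<subseteq> K"
  shows "holomorphically_linearizable f \<theta>"
proof -
  define l where "l = cis (2 * pi * \<theta>)"
  have l: "cmod l = 1" "l \<noteq> 0" by (simp_all add: l_def)
  obtain r where r: "0 < r" "ball 0 r \<subseteq> K" using K(2) by (meson mem_interior)
  define B where "B = ball (0::complex) r"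
  have B: "open B" "0 \<in> B" "B \<subseteq> K" using r by (auto simp: B_def)
  have iter: "(f ^^ j) holomorphic_on interior K \<and> (f ^^ j) ` K \<subseteq> K" for j
  proof (induction j)
    case (Suc j)
    have "(f \<circ> (f ^^ j)) holomorphic_on interior K"
      using Suc interior_subset[of K] U by (intro holomorphic_on_compose_gen[of _ _ f U]) auto
    moreover have "(f ^^ Suc j) ` K \<subseteq> K" using Suc f(3) by auto
    ultimately show ?case by (simp add: o_def)
  qed (auto simp: id_def[symmetric] intro: holomorphic_on_ident[unfolded id_def[symmetric]])
  have iter_B: "(f ^^ j) holomorphic_on B" for j
    using iter[of j] B by (meson holomorphic_on_subset interior_maximal)
  have df0: "(f has_field_derivative l) (at 0)"
    using holomorphic_derivI[OF U(3,1), of 0] K U f interior_subset[of K] by (auto simp: l_def)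
  have fix0: "(f ^^ j) 0 = 0" for j by (induction j) (simp_all add: f)
  have diter: "((f ^^ j) has_field_derivative l ^ j) (at 0)" for j
  proof (induction j)
    case (Suc j)
    have "(f has_field_derivative l) (at ((f ^^ j) 0))" using df0 by (simp add: fix0)
    from DERIV_chain[OF this Suc] show ?case by (simp add: o_def)
  qed (auto intro!: derivative_eq_intros simp: id_def)
  \<comment> \<open>Every mean has derivative 1 at \<open>0\<close>, which passes to the limit and
    makes it locally invertible. The denominator \<open>Suc N\<close> avoids an empty mean.\<close>
  define A where "A = (\<lambda>N z. (\<Sum>j<Suc N. (f ^^ j) z / l ^ j) / of_nat (Suc N))"
  have A_hol: "A N holomorphic_on B" for N
    unfolding A_def using l by (intro holomorphic_intros iter_B) (auto simp del: of_nat_Suc)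
  obtain M where M: "\<And>z. z \<in> K \<Longrightarrow> cmod z \<le> M"
    using compact_imp_bounded[OF K(1)] by (auto simp: bounded_iff)
  have fM: "cmod ((f ^^ j) z / l ^ j) \<le> M" if "z \<in> K" for z j
    using iter[of j] that M l by (auto simp: norm_divide norm_power)
  have A_bound: "cmod (A N z) \<le> M" if "z \<in> K" for N z
  proof -
    have "cmod (\<Sum>j<Suc N. (f ^^ j) z / l ^ j) \<le> (\<Sum>j<Suc N. M)"
      using fM[OF that] by (rule sum_norm_le)
    then have "cmod (\<Sum>j<Suc N. (f ^^ j) z / l ^ j) \<le> M * real (Suc N)" by (simp add: mult.commute)
    then show ?thesis
      unfolding A_def norm_divide norm_of_nat by (subst pos_divide_le_eq) auto
  qed
  have A0: "(A N has_field_derivative 1) (at 0)" for N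
  proof -
    have "((\<lambda>z. (f ^^ j) z / l ^ j) has_field_derivative l ^ j / l ^ j) (at 0)" for j
      by (rule DERIV_cdivide[OF diter])
    then have "((\<lambda>z. (f ^^ j) z / l ^ j) has_field_derivative 1) (at 0)" for j using l by simp
    then have "((\<lambda>z. \<Sum>j<Suc N. (f ^^ j) z / l ^ j) has_field_derivative (\<Sum>j<Suc N. 1)) (at 0)"
      by (intro DERIV_sum)
    from DERIV_cdivide[OF this, of "of_nat (Suc N)"] show ?thesis unfolding A_def by (simp del: of_nat_Suc)
  qed
  \<comment> \<open>Evaluation at \<open>f z\<close> shifts the summation index by one, so only the
    two end terms survive and the conjugacy error is of order \<open>1 / N\<close>.\<close>
  have A_f: "cmod (A N (f z) - l * A N z) \<le> 2 * M / real (Suc N)" if "z \<in> K" for N z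
  proof -
    define a where "a = (\<lambda>j. (f ^^ j) z / l ^ j)"
    have "(\<Sum>j<Suc N. (f ^^ j) (f z) / l ^ j) = (\<Sum>j<Suc N. l * a (Suc j))"
      using l by (intro sum.cong) (auto simp: a_def funpow_swap1)
    also have "\<dots> = l * (\<Sum>j<Suc N. a (Suc j))" by (rule sum_distrib_left[symmetric])
    also have "(\<Sum>j<Suc N. a (Suc j)) = (\<Sum>j<Suc N. a j) + (a (Suc N) - a 0)"
      using sum_lessThan_telescope[of a "Suc N"] by (simp add: sum_subtractf algebra_simps)
    finally have eq: "(\<Sum>j<Suc N. (f ^^ j) (f z) / l ^ j) = l * ((\<Sum>j<Suc N. a j) + (a (Suc N) - a 0))" .
    have "A N (f z) - l * A N z =
      ((\<Sum>j<Suc N. (f ^^ j) (f z) / l ^ j) - l * (\<Sum>j<Suc N. a j)) / of_nat (Suc N)"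
      by (simp only: A_def a_def diff_divide_distrib times_divide_eq_right)
    also have "\<dots> = l * (a (Suc N) - a 0) / of_nat (Suc N)"
      unfolding eq by (simp only: distrib_left add_diff_cancel_left')
    finally have "A N (f z) - l * A N z = l * (a (Suc N) - a 0) / of_nat (Suc N)" .
    then have "cmod (A N (f z) - l * A N z) = cmod (a (Suc N) - a 0) / real (Suc N)"
      using l by (simp add: norm_divide norm_mult del: of_nat_Suc)
    also have "cmod (a (Suc N) - a 0) \<le> M + M"
      using norm_triangle_ineq4[of "a (Suc N)" "a 0"] fM[OF that, of "Suc N"] fM[OF that, of 0]
      unfolding a_def by linarith
    finally show ?thesis by (simp add: divide_right_mono)
  qed
  obtain \<eta> \<sigma> where \<eta>: "\<eta> holomorphic_on B" "strict_mono (\<sigma> :: nat \<Rightarrow> nat)"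
    "\<And>x. x \<in> B \<Longrightarrow> (\<lambda>n. A (\<sigma> n) x) \<longlonglongrightarrow> \<eta> x"
    "\<And>C. compact C \<Longrightarrow> C \<subseteq> B \<Longrightarrow> uniform_limit C (A \<circ> \<sigma>) \<eta> sequentially"
  proof (rule Montel[of B "{f. f holomorphic_on B \<and> (\<forall>z\<in>B. cmod (f z) \<le> M)}" A])
    show "range A \<subseteq> {f. f holomorphic_on B \<and> (\<forall>z\<in>B. cmod (f z) \<le> M)}"
      using A_hol A_bound B by blast
    show "\<exists>b. \<forall>h\<in>{f. f holomorphic_on B \<and> (\<forall>z\<in>B. cmod (f z) \<le> M)}. \<forall>z\<in>C. norm (h z) \<le> b"
      if "compact C" "C \<subseteq> B" for C using that by (intro exI[of _ M]) blast
  qed (use B in auto)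
  have "\<exists>g'. \<forall>x\<in>B. (\<eta> has_field_derivative g' x) (at x) \<and> (\<lambda>n. deriv (A (\<sigma> n)) x) \<longlonglongrightarrow> g' x"
  proof (rule has_complex_derivative_uniform_sequence[OF B(1)])
    show "(A (\<sigma> n) has_field_derivative deriv (A (\<sigma> n)) x) (at x)" if "x \<in> B" for n x
      by (rule holomorphic_derivI[OF A_hol B(1) that])
    show "\<exists>d>0. cball x d \<subseteq> B \<and> uniform_limit (cball x d) (\<lambda>n. A (\<sigma> n)) \<eta> sequentially"
      if x: "x \<in> B" for x
    proof -
      obtain d where "0 < d" "cball x d \<subseteq> B"
        using open_contains_cball[THEN iffD1, OF B(1), THEN bspec, OF x] by blast
      then show ?thesis using \<eta>(4)[of "cball x d"] by (auto simp: o_def)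
    qed
  qed
  then obtain d where d: "(\<eta> has_field_derivative d) (at 0)" "(\<lambda>n. deriv (A (\<sigma> n)) 0) \<longlonglongrightarrow> d"
    using B(2) by blast
  have "deriv (A N) 0 = 1" for N using A0 DERIV_imp_deriv by blast
  then have "d = 1" using d(2) by (simp add: LIMSEQ_const_iff)
  have d\<eta>: "deriv \<eta> 0 = 1" using d(1) \<open>d = 1\<close> DERIV_imp_deriv by blast
  have "A N 0 = 0" for N by (simp add: A_def fix0)
  then have \<eta>0: "\<eta> 0 = 0" using \<eta>(3)[OF B(2)] by (simp add: LIMSEQ_const_iff)
  have conj: "\<eta> (f z) = l * \<eta> z" if "z \<in> B" "f z \<in> B" for z
  proof -
    have 1: "(\<lambda>n. A (\<sigma> n) (f z) - l * A (\<sigma> n) z) \<longlonglongrightarrow> \<eta> (f z) - l * \<eta> z"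
      using \<eta>(3) that by (intro tendsto_intros) auto
    have "(\<lambda>n. 2 * M / real (Suc n)) \<longlonglongrightarrow> 0"
      by (rule LIMSEQ_Suc[of "\<lambda>n. 2 * M / real n"], rule lim_const_over_n)
    from LIMSEQ_subseq_LIMSEQ[OF this \<eta>(2)]
    have "(\<lambda>n. A (\<sigma> n) (f z) - l * A (\<sigma> n) z) \<longlonglongrightarrow> 0"
      by (rule Lim_null_comparison[rotated])
        (use A_f that B in \<open>auto intro!: always_eventually simp: o_def simp del: of_nat_Suc\<close>)
    with 1 show ?thesis using LIMSEQ_unique by fastforce
  qed
  obtain s where s: "0 < s" "ball 0 s \<subseteq> B" "inj_on \<eta> (ball 0 s)"
    using has_complex_derivative_locally_injective[OF \<eta>(1) B(2,1)] d\<eta> by auto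
  have hol: "\<eta> holomorphic_on ball 0 s" using \<eta>(1) s(2) holomorphic_on_subset by blast
  obtain \<xi> where \<xi>: "\<xi> holomorphic_on \<eta> ` ball 0 s"
    "\<And>z. z \<in> ball 0 s \<Longrightarrow> deriv \<eta> z * deriv \<xi> (\<eta> z) = 1" "\<And>z. z \<in> ball 0 s \<Longrightarrow> \<xi> (\<eta> z) = z"
    using holomorphic_has_inverse[OF hol open_ball s(3)] by blast
  define W where "W = \<eta> ` ball 0 s"
  have W: "open W" unfolding W_def by (rule open_mapping_thm3[OF hol open_ball s(3)])
  have W0: "0 \<in> W" using s(1) \<eta>0 by (force simp: W_def)
  have \<xi>W: "\<xi> z \<in> B" "\<eta> (\<xi> z) = z" if "z \<in> W" for z
    using that \<xi>(3) s(2) by (auto simp: W_def)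
  have \<xi>0: "\<xi> 0 = 0" using \<xi>(3)[of 0] s(1) by (simp add: \<eta>0)
  have ev: "\<forall>\<^sub>F z in nhds 0. z \<in> W" using W W0 by (rule eventually_nhds_in_open)
  have \<xi>_an: "\<xi> analytic_on {0}"
    unfolding analytic_on_holomorphic using W W0 \<xi>(1) by (intro exI[of _ W]) (auto simp: W_def)
  have cont: "isCont (\<lambda>z. f (\<xi> z)) 0"
  proof (rule isCont_o2[where f = \<xi> and g = f])
    show "isCont \<xi> 0" using \<xi>_an by (auto intro: analytic_at_imp_isCont)
    show "isCont f (\<xi> 0)" using df0 DERIV_isCont by (simp add: \<xi>0)
  qed
  have "f (\<xi> 0) \<in> B" by (simp add: \<xi>0 f B)
  then have ev2: "\<forall>\<^sub>F z in nhds 0. f (\<xi> z) \<in> B"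
    using topological_tendstoD[OF cont[unfolded continuous_at] B(1)]
    by (simp add: eventually_nhds_conv_at)
  have "\<eta> analytic_on {0}"
    unfolding analytic_on_holomorphic using B \<eta>(1) by (intro exI[of _ B]) auto
  moreover have "deriv \<xi> 0 \<noteq> 0" using \<xi>(2)[of 0] s(1) \<eta>0 by auto
  moreover have "\<forall>\<^sub>F z in nhds 0. \<eta> (\<xi> z) = z"
    using ev by eventually_elim (rule \<xi>W)
  moreover have "\<forall>\<^sub>F z in nhds 0. \<eta> (f (\<xi> z)) = l * z"
    using ev ev2 by eventually_elim (simp add: conj \<xi>W)
  ultimately show ?thesis
    unfolding holomorphically_linearizable_def using \<xi>_an \<xi>0 unfolding l_def by blast
qed

section \<open>Circle maps with irrational rotation number\<close>

lemma sum_shift: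
  fixes h :: "nat \<Rightarrow> 'a::ab_group_add"
  shows "(\<Sum>i<n. h (i + k)) = (\<Sum>i<n + k. h i) - (\<Sum>i<k. h i)"
  by (induction n) auto

lemma step1_add_int:
  fixes F :: "'a::ring_1 \<Rightarrow> 'a"
  assumes "\<And>x. F (x + 1) = F x + 1"
  shows "F (x + of_int k) = F x + of_int k"
proof -
  have *: "F (x + of_nat n) = F x + of_nat n" for x n
  proof (induction n)
    case (Suc n)
    have "F (x + of_nat (Suc n)) = F ((x + of_nat n) + 1)" by (simp add: algebra_simps)
    then show ?case unfolding assms using Suc by simp
  qed simp
  show ?thesis
  proof (cases "k \<ge> 0")
    case True
    then show ?thesis using *[of x "nat k"] by simp
  next
    case False
    then show ?thesis using *[of "x + of_int k" "nat (- k)"] by simp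
  qed
qed

text \<open>The Lipschitz bound on \<open>ln D\<close> is the smoothness behind all distortion
  estimates: by the chain rule, the logarithm of the derivative of an iterate changes between two
  points by at most \<open>B\<close> times the total length of the arcs joining their
  orbits.\<close>

locale circle_lift =
  fixes F D :: "real \<Rightarrow> real" and \<rho> B :: real
  assumes smono: "strict_mono F"
    and step1: "F (x + 1) = F x + 1"
    and rotation: "(\<lambda>n. ((F ^^ n) x - x) / real n) \<longlonglongrightarrow> \<rho>"
    and irrational: "\<rho> \<notin> \<rat>"
    and deriv_F: "(F has_real_derivative D x) (at x)"
    and D_pos: "D x > 0"
    and ln_D_lipschitz: "\<bar>ln (D x) - ln (D y)\<bar> \<le> B * \<bar>x - y\<bar>"
    and B_pos: "0 < B"
begin

lemma F_less_iff [simp]: "F x < F y \<longleftrightarrow> x < y"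
  using smono by (simp add: strict_mono_less)

lemma F_le_iff [simp]: "F x \<le> F y \<longleftrightarrow> x \<le> y"
  using smono by (simp add: strict_mono_less_eq)

lemma iter_less_iff [simp]: "(F ^^ n) x < (F ^^ n) y \<longleftrightarrow> x < y"
  by (induction n) auto

lemma iter_le_iff [simp]: "(F ^^ n) x \<le> (F ^^ n) y \<longleftrightarrow> x \<le> y"
  by (induction n) auto

lemma F_add_int: "F (x + of_int k) = F x + of_int k"
  by (rule step1_add_int[of F, OF step1])

lemma iter_add_int: "(F ^^ n) (x + of_int k) = (F ^^ n) x + of_int k"
  by (induction n) (simp_all add: F_add_int)

lemma iter_diff_int: "(F ^^ n) (x - of_int k) = (F ^^ n) x - of_int k"
  using iter_add_int[of n x "- k"] by simp

lemma isCont_F: "isCont F x"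
  using deriv_F DERIV_isCont by blast

lemma isCont_iter: "isCont (F ^^ n) x"
  by (induction n) (auto intro!: isCont_o2[OF _ isCont_F] simp: o_def id_def)

definition D_iter :: "nat \<Rightarrow> real \<Rightarrow> real" where
  "D_iter n x = (\<Prod>j<n. D ((F ^^ j) x))"

lemma D_iter_pos: "D_iter n x > 0"
  unfolding D_iter_def by (intro prod_pos) (auto simp: D_pos)

lemma deriv_iter: "((F ^^ n) has_real_derivative D_iter n x) (at x)"
proof (induction n)
  case 0
  show ?case by (simp add: D_iter_def id_def)
next
  case (Suc n)
  show ?case
    using DERIV_chain[OF deriv_F Suc.IH] by (simp add: D_iter_def mult.commute o_def)
qed

lemma ln_D_iter: "ln (D_iter n x) = (\<Sum>j<n. ln (D ((F ^^ j) x)))"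
  unfolding D_iter_def using D_pos by (intro ln_prod) (auto simp: less_imp_neq[symmetric])

lemma ln_D_iter_diff:
  "\<bar>ln (D_iter n x) - ln (D_iter n y)\<bar> \<le> B * (\<Sum>j<n. \<bar>(F ^^ j) x - (F ^^ j) y\<bar>)"
proof -
  have "\<bar>ln (D_iter n x) - ln (D_iter n y)\<bar> = \<bar>\<Sum>j<n. ln (D ((F ^^ j) x)) - ln (D ((F ^^ j) y))\<bar>"
    by (simp add: ln_D_iter sum_subtractf)
  also have "\<dots> \<le> (\<Sum>j<n. \<bar>ln (D ((F ^^ j) x)) - ln (D ((F ^^ j) y))\<bar>)"
    by (rule sum_abs)
  also have "\<dots> \<le> (\<Sum>j<n. B * \<bar>(F ^^ j) x - (F ^^ j) y\<bar>)"
    by (intro sum_mono ln_D_lipschitz)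
  finally show ?thesis by (simp add: sum_distrib_left)
qed

lemma iter_mvt:
  assumes "x < y"
  obtains t where "x < t" "t < y" "(F ^^ n) y - (F ^^ n) x = (y - x) * D_iter n t"
  using MVT2[OF assms, of "F ^^ n" "D_iter n"] deriv_iter by blast

lemma iter_iter_mono:
  assumes "(F ^^ q) x \<le> x + of_int p"
  shows "(F ^^ (q * n)) x \<le> x + of_int (p * int n)"
proof (induction n)
  case 0
  show ?case by simp
next
  case (Suc n)
  have "(F ^^ (q * Suc n)) x = (F ^^ q) ((F ^^ (q * n)) x)"
    by (simp add: funpow_add)
  also have "\<dots> \<le> (F ^^ q) (x + of_int (p * int n))"
    using Suc by simp
  also have "\<dots> \<le> x + of_int (p * int (Suc n))"
    using assms iter_add_int[of q x "p * int n"] by (simp add: distrib_left)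
  finally show ?case .
qed

lemma iter_iter_mono_ge:
  assumes "(F ^^ q) x \<ge> x + of_int p"
  shows "(F ^^ (q * n)) x \<ge> x + of_int (p * int n)"
proof (induction n)
  case 0
  show ?case by simp
next
  case (Suc n)
  have "(F ^^ (q * Suc n)) x = (F ^^ q) ((F ^^ (q * n)) x)"
    by (simp add: funpow_add)
  also have "\<dots> \<ge> (F ^^ q) (x + of_int (p * int n))"
    using Suc by simp
  moreover have "(F ^^ q) (x + of_int (p * int n)) \<ge> x + of_int (p * int (Suc n))"
    using assms iter_add_int[of q x "p * int n"] by (simp add: distrib_left)
  ultimately show ?case by linarith
qed

lemma rotation_subseq:
  assumes "q > 0"
  shows "(\<lambda>n. ((F ^^ (q * Suc n)) x - x) / real (q * Suc n)) \<longlonglongrightarrow> \<rho>"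
proof -
  have "strict_mono (\<lambda>n. q * Suc n)"
    using assms by (auto simp: strict_mono_def)
  from LIMSEQ_subseq_LIMSEQ[OF rotation this] show ?thesis by (simp add: o_def)
qed

text \<open>If some point advanced by at most \<open>p\<close> in \<open>q\<close> steps,
  monotonicity would repeat this along all multiples of \<open>q\<close>, and the rotation number
  would be at most \<open>p / q\<close>.\<close>

lemma iter_gt:
  assumes "real q * \<rho> > of_int p" "q > 0"
  shows "(F ^^ q) x - of_int p > x"
proof (rule ccontr)
  assume "\<not> ?thesis"
  then have *: "(F ^^ q) x \<le> x + of_int p" by simp
  have "((F ^^ (q * Suc n)) x - x) / real (q * Suc n) \<le> of_int p / real q" for n
  proof -
    have "((F ^^ (q * Suc n)) x - x) / real (q * Suc n) \<le> of_int (p * int (Suc n)) / real (q * Suc n)"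
      using iter_iter_mono[OF *, of "Suc n"] by (intro divide_right_mono) auto
    also have "\<dots> = of_int p / real q"
      by (simp only: of_int_mult of_nat_mult of_int_of_nat_eq) (rule mult_divide_mult_cancel_right, simp)
    finally show ?thesis .
  qed
  then have "\<rho> \<le> of_int p / real q"
    by (intro LIMSEQ_le_const2[OF rotation_subseq[OF assms(2)]]) auto
  then show False using assms by (simp add: field_simps)
qed

lemma iter_lt:
  assumes "real q * \<rho> < of_int p" "q > 0"
  shows "(F ^^ q) x - of_int p < x"
proof (rule ccontr)
  assume "\<not> ?thesis"
  then have *: "(F ^^ q) x \<ge> x + of_int p" by simp
  have "((F ^^ (q * Suc n)) x - x) / real (q * Suc n) \<ge> of_int p / real q" for n
  proof -
    have "of_int p / real q = of_int (p * int (Suc n)) / real (q * Suc n)"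
      by (simp only: of_int_mult of_nat_mult of_int_of_nat_eq)
        (rule mult_divide_mult_cancel_right[symmetric], simp)
    also have "\<dots> \<le> ((F ^^ (q * Suc n)) x - x) / real (q * Suc n)"
      using iter_iter_mono_ge[OF *, of "Suc n"] by (intro divide_right_mono) auto
    finally show ?thesis .
  qed
  then have "\<rho> \<ge> of_int p / real q"
    by (intro LIMSEQ_le_const[OF rotation_subseq[OF assms(2)]]) auto
  then show False using assms by (simp add: field_simps)
qed

section \<open>Consecutive convergents and the arcs cut out by an orbit\<close>

definition gap :: "nat \<Rightarrow> int \<Rightarrow> real \<Rightarrow> real" where
  "gap q p x = (F ^^ q) x - of_int p - x"

text \<open>\<open>p / q\<close> and \<open>p' / q'\<close> are consecutive convergents of \<open>\<rho>\<close>, below and above it; every other pair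
  of consecutive convergents is of this kind.\<close>

definition good :: "nat \<Rightarrow> int \<Rightarrow> nat \<Rightarrow> int \<Rightarrow> bool" where
  "good q p q' p' \<longleftrightarrow> 1 \<le> q \<and> q \<le> q' \<and> int q * p' - int q' * p = 1 \<and>
     0 < of_int p' - real q' * \<rho> \<and> of_int p' - real q' * \<rho> < real q * \<rho> - of_int p"

lemma irrational_mult: "real n * \<rho> \<noteq> of_int k" if "n > 0"
proof
  assume "real n * \<rho> = of_int k"
  then have "\<rho> = of_int k / of_int (int n)" using that by (simp add: field_simps)
  then show False using irrational by (metis Rats_divide Rats_of_int)
qed

lemma floor_div_bounds:
  fixes a b :: real
  assumes "0 < a" "a < b"
  defines "l \<equiv> nat \<lfloor>b / a\<rfloor>"
  shows "1 \<le> l" "0 \<le> b - real l * a" "b - real l * a < a"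
proof -
  have 1: "1 \<le> b / a" using assms by simp
  then have fl: "1 \<le> \<lfloor>b / a\<rfloor>" by simp
  then have l: "real l = of_int \<lfloor>b / a\<rfloor>" by (simp add: l_def)
  show "1 \<le> l" using fl by (simp add: l_def le_nat_iff)
  have "real l \<le> b / a" "b / a < real l + 1" unfolding l by linarith+
  then show "0 \<le> b - real l * a" "b - real l * a < a"
    using assms(1) by (simp_all add: field_simps)
qed

text \<open>A step of the continued fraction algorithm: adding \<open>(q, p)\<close> to
  \<open>(q', p')\<close> as often as possible without crossing \<rho> brings the upper error below
  the lower one and keeps the determinant. Irrationality excludes error zero.\<close>

lemma good_extend:
  assumes "1 \<le> q" "int q * p' - int q' * p = 1"
    and "0 < real q * \<rho> - of_int p" "real q * \<rho> - of_int p < of_int p' - real q' * \<rho>"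
  shows "\<exists>Q' P'. good q p Q' P'"
proof -
  define a where "a = real q * \<rho> - of_int p"
  define b where "b = of_int p' - real q' * \<rho>"
  define l where "l = nat \<lfloor>b / a\<rfloor>"
  have l: "1 \<le> l" "0 \<le> b - real l * a" "b - real l * a < a"
    using floor_div_bounds[of a b] assms unfolding a_def b_def l_def by auto
  define Q' P' where "Q' = q' + l * q" and "P' = p' + int l * p"
  have eq: "b - real l * a = of_int P' - real Q' * \<rho>"
    by (simp add: a_def b_def Q'_def P'_def algebra_simps)
  have "q \<le> Q'" using l(1) by (simp add: Q'_def) (metis One_nat_def le_add2 le_trans mult_le_mono1 nat_mult_1)
  then have "Q' > 0" using assms(1) by simp
  from irrational_mult[OF this, of P'] have "b - real l * a \<noteq> 0" using eq by simp
  then have "good q p Q' P'"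
    unfolding good_def using l eq assms(1,2) \<open>q \<le> Q'\<close>
    by (auto simp: a_def Q'_def P'_def algebra_simps)
  then show ?thesis by blast
qed

lemma good_exists: "\<exists>q p q' p'. good q p q' p'"
proof -
  have "\<rho> \<noteq> of_int \<lfloor>\<rho>\<rfloor>" using irrational by (metis Rats_of_int)
  then have "0 < real 1 * \<rho> - of_int \<lfloor>\<rho>\<rfloor>" "real 1 * \<rho> - of_int \<lfloor>\<rho>\<rfloor> < 1"
    by simp_all linarith+
  \<comment> \<open>The algorithm starts with the floor of \<rho> over 1 and the formal fraction 1 /
    0, whose error is 1.\<close>
  then show ?thesis using good_extend[of 1 1 0 "\<lfloor>\<rho>\<rfloor>"] by auto
qed

context
  fixes q q' :: nat and p p' :: int
  assumes good: "good q p q' p'"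
begin

lemma good_facts:
  "1 \<le> q" "q \<le> q'" "int q * p' - int q' * p = 1"
  "real q * \<rho> > of_int p" "real q' * \<rho> < of_int p'"
  "real (q + q') * \<rho> > of_int (p + p')"
  using good unfolding good_def by (auto simp: algebra_simps)

lemma gap_pos: "gap q p x > 0"
  using iter_gt[of p q x] good_facts by (simp add: gap_def)

lemma back_lt: "(F ^^ q') x - of_int p' < x"
  using iter_lt[of q' p' x] good_facts by simp

lemma sum_gt: "(F ^^ (q + q')) x - of_int (p + p') > x"
  using iter_gt[of "p + p'" "q + q'" x] good_facts by simp

lemma gap_add_int [simp]: "gap q p (x + of_int k) = gap q p x"
  by (simp add: gap_def iter_add_int)

text \<open>As \<open>F ^^ j\<close> commutes with \<open>F ^^ q\<close>, it maps the arc from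
  \<open>x\<close> to its displaced point onto the corresponding arc at the image. Sums of gaps
  along an orbit are therefore sums of lengths of images of one arc.\<close>

lemma gap_iter: "gap q p ((F ^^ j) x) = (F ^^ j) (x + gap q p x) - (F ^^ j) x"
proof -
  have "(F ^^ j) (x + gap q p x) = (F ^^ j) ((F ^^ q) x) - of_int p"
    by (simp add: gap_def iter_diff_int)
  also have "(F ^^ j) ((F ^^ q) x) = (F ^^ q) ((F ^^ j) x)"
    by (metis add.commute comp_apply funpow_add)
  finally show ?thesis by (simp add: gap_def)
qed

text \<open>The arcs cut out by the points \<open>F\<^sup>i x\<close> with \<open>i < q + q'\<close> are of two types, with clockwise end
  \<open>F\<^sup>i x\<close>, \<open>i < q'\<close>, or with counterclockwise end \<open>F\<^sup>k x\<close>, \<open>k < q\<close>.\<close>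

lemma tile_sum:
  "(\<Sum>i<q'. gap q p ((F ^^ i) x)) + (\<Sum>k<q. (F ^^ k) x - ((F ^^ q') ((F ^^ k) x) - of_int p')) = 1"
proof -
  let ?h = "\<lambda>i. (F ^^ i) x"
  have 1: "(\<Sum>i<q'. gap q p (?h i)) = (\<Sum>i<q'. ?h (i + q)) - real q' * of_int p - (\<Sum>i<q'. ?h i)"
    by (simp add: gap_def sum_subtractf funpow_add add.commute[of _ q])
  have 2: "(\<Sum>k<q. ?h k - ((F ^^ q') (?h k) - of_int p')) =
      (\<Sum>k<q. ?h k) - ((\<Sum>k<q. ?h (k + q')) - real q * of_int p')"
    by (simp add: sum_subtractf funpow_add add.commute[of _ q'])
  \<comment> \<open>The orbit points cancel between the two sums, and only the determinant of the
    two convergents remains.\<close>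
  have "real_of_int (int q * p' - int q' * p) = 1" using good_facts by simp
  then have 3: "real q * of_int p' - real q' * of_int p = 1" by simp
  show ?thesis unfolding 1 2 sum_shift[of ?h q q'] sum_shift[of ?h q' q] using 3 by (simp add: add.commute[of q q'])
qed

lemma tile_sum_le: "(\<Sum>i<q'. gap q p ((F ^^ i) x)) \<le> 1"
proof -
  have "(\<Sum>k<q. (F ^^ k) x - ((F ^^ q') ((F ^^ k) x) - of_int p')) \<ge> 0"
    by (intro sum_nonneg) (use back_lt less_imp_le in \<open>simp add: less_imp_le\<close>)
  then show ?thesis using tile_sum[of x] by linarith
qed

lemma tile_sum_le_1: "n \<le> q' \<Longrightarrow> (\<Sum>i<n. gap q p ((F ^^ i) x)) \<le> 1"
  by (rule order_trans[OF sum_mono2 tile_sum_le]) (auto simp: gap_pos less_imp_le)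

lemma tile_sum_le_2:
  assumes "n \<le> q + q'"
  shows "(\<Sum>i<n. gap q p ((F ^^ i) x)) \<le> 2"
proof -
  have "(\<Sum>i<n. gap q p ((F ^^ i) x)) \<le> (\<Sum>i<q' + q'. gap q p ((F ^^ i) x))"
    using assms good_facts(2) by (intro sum_mono2) (auto simp: gap_pos less_imp_le)
  also have "\<dots> = (\<Sum>i<q'. gap q p ((F ^^ i) x)) + (\<Sum>i<q'. gap q p ((F ^^ i) ((F ^^ q') x)))"
    using sum_shift[of "\<lambda>i. gap q p ((F ^^ i) x)" q' q'] by (simp add: funpow_add)
  also have "\<dots> \<le> 2" using tile_sum_le[of x] tile_sum_le[of "(F ^^ q') x"] by linarith
  finally show ?thesis .
qed

text \<open>Let \<open>u\<close> be the largest lifted orbit point not above \<open>y\<close>. If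
  \<open>y\<close> lay beyond the arc of \<open>u\<close>, a larger orbit point would fit below
  \<open>y\<close>: the end \<open>u + gap q p u\<close> of the arc if \<open>i < q'\<close>, and
  otherwise the point \<open>t\<close> that \<open>F ^^ q'\<close> moves back to
  \<open>u\<close>.\<close>

lemma arc_cover:
  "\<exists>i k. i < q + q' \<and> (F ^^ i) x + of_int k \<le> y \<and>
     y \<le> (F ^^ i) x + of_int k + gap q p ((F ^^ i) x + of_int k)"
proof -
  define S where "S = (\<lambda>i. (F ^^ i) x + of_int \<lfloor>y - (F ^^ i) x\<rfloor>) ` {..<q + q'}"
  have fin: "finite S" "S \<noteq> {}" using good_facts(1) by (auto simp: S_def)
  then have "Max S \<in> S" by (rule Max_in)
  then obtain i where i: "i < q + q'" "Max S = (F ^^ i) x + of_int \<lfloor>y - (F ^^ i) x\<rfloor>"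
    by (auto simp: S_def)
  define k u where "k = \<lfloor>y - (F ^^ i) x\<rfloor>" and "u = (F ^^ i) x + of_int k"
  have max: "(F ^^ j) x + of_int l \<le> u" if "j < q + q'" "(F ^^ j) x + of_int l \<le> y" for j l
  proof -
    have "l \<le> \<lfloor>y - (F ^^ j) x\<rfloor>" using that(2) by linarith
    then have "(F ^^ j) x + of_int l \<le> (F ^^ j) x + of_int \<lfloor>y - (F ^^ j) x\<rfloor>" by simp
    also have "\<dots> \<le> Max S" using fin that(1) by (intro Max_ge) (auto simp: S_def)
    finally show ?thesis using i by (simp add: u_def k_def)
  qed
  have "u \<le> y" unfolding u_def k_def by linarith
  moreover have "y \<le> u + gap q p u"
  proof (rule ccontr)
    assume *: "\<not> y \<le> u + gap q p u"
    show False
    proof (cases "i < q'")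
      case True
      have "u + gap q p u = (F ^^ (q + i)) x + of_int (k - p)"
        by (simp add: u_def gap_def iter_add_int funpow_add)
      then have "u + gap q p u \<le> u" using max[of "q + i" "k - p"] * True by simp
      then show False using gap_pos[of u] by simp
    next
      case False
      define t where "t = (F ^^ (i - q')) x + of_int (k + p')"
      have t: "(F ^^ q') t - of_int p' = u"
      proof -
        have "(F ^^ q') ((F ^^ (i - q')) x) = (F ^^ i) x"
          using False funpow_add[of q' "i - q'" F] by simp
        then show ?thesis unfolding t_def u_def iter_add_int by simp
      qed
      then have "u < t" using back_lt[of t] by simp
      moreover have "u + gap q p u = (F ^^ (q + q')) t - of_int (p + p')"
        by (simp add: gap_def funpow_add iter_diff_int flip: t)
      then have "t < u + gap q p u" using sum_gt[of t] by simp
      then have "t \<le> u" using max[of "i - q'" "k + p'"] * i(1) by (simp add: t_def)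
      ultimately show False by simp
    qed
  qed
  ultimately show ?thesis using i(1) unfolding u_def by blast
qed

text \<open>The complementary step of the algorithm improves the lower convergent by adding
  \<open>(q', p')\<close> as often as possible, and \<open>good_extend\<close> renews the upper one.
  Gaps shrink since the added iterates move points backwards.\<close>

lemma good_next:
  "\<exists>Q P Q' P'. good Q P Q' P' \<and> q < Q \<and> (\<forall>x. gap Q P x \<le> gap q p x)"
proof -
  define a where "a = real q * \<rho> - of_int p"
  define b where "b = of_int p' - real q' * \<rho>"
  define l where "l = nat \<lfloor>a / b\<rfloor>"
  have ab: "0 < b" "b < a" using good by (auto simp: good_def a_def b_def)
  have l: "1 \<le> l" "0 \<le> a - real l * b" "a - real l * b < b"
    using floor_div_bounds[OF ab] unfolding l_def by auto
  define Q P where "Q = q + l * q'" and "P = p + int l * p'"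
  have eq: "a - real l * b = real Q * \<rho> - of_int P"
    by (simp add: a_def b_def Q_def P_def algebra_simps)
  have Q: "q < Q" using l(1) good_facts(1,2) by (simp add: Q_def)
  have "a - real l * b \<noteq> 0" using irrational_mult[of Q P] eq Q by simp
  then have "0 < real Q * \<rho> - of_int P" "real Q * \<rho> - of_int P < of_int p' - real q' * \<rho>"
    using l eq by (auto simp: b_def)
  moreover have "int Q * p' - int q' * P = 1"
    using good_facts(3) by (simp add: Q_def P_def algebra_simps)
  ultimately obtain Q' P' where "good Q P Q' P'" using good_extend[of Q p' q' P] Q good_facts(1) by auto
  moreover have "gap Q P x \<le> gap q p x" for x
  proof -
    have "(F ^^ (l * q')) x - of_int (int l * p') < x"
      using l(1) good_facts by (intro iter_lt) (auto simp: mult.assoc)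
    then have "(F ^^ q) ((F ^^ (l * q')) x - of_int (int l * p')) < (F ^^ q) x" by (simp only: iter_less_iff)
    then show ?thesis unfolding iter_diff_int by (simp add: gap_def Q_def P_def funpow_add)
  qed
  ultimately show ?thesis using Q by blast
qed

section \<open>Bounded distortion of the iterate of order \<open>q\<close>\<close>

lemma tile_sum_interval:
  assumes "u \<le> v" "v \<le> u + gap q p u" "n \<le> q + q'"
  shows "(\<Sum>j<n. \<bar>(F ^^ j) v - (F ^^ j) u\<bar>) \<le> 2"
    and "n \<le> q' \<Longrightarrow> (\<Sum>j<n. \<bar>(F ^^ j) v - (F ^^ j) u\<bar>) \<le> 1"
proof -
  have "\<bar>(F ^^ j) v - (F ^^ j) u\<bar> \<le> gap q p ((F ^^ j) u)" for j
    using assms(1,2) by (simp add: gap_iter abs_if not_less)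
  then have *: "(\<Sum>j<n. \<bar>(F ^^ j) v - (F ^^ j) u\<bar>) \<le> (\<Sum>j<n. gap q p ((F ^^ j) u))"
    by (rule sum_mono)
  show "(\<Sum>j<n. \<bar>(F ^^ j) v - (F ^^ j) u\<bar>) \<le> 2"
    using * tile_sum_le_2[OF assms(3), of u] by linarith
  show "(\<Sum>j<n. \<bar>(F ^^ j) v - (F ^^ j) u\<bar>) \<le> 1" if "n \<le> q'"
    using * tile_sum_le_1[OF that, of u] by linarith
qed

text \<open>Comparing \<open>D_iter q\<close> at \<open>F x\<close> and at \<open>x\<close> telescopes; the sum of the errors along the
  orbit is controlled by the arcs.\<close>

lemma ln_D_iter_orbit:
  assumes "i \<le> q + q'"
  shows "\<bar>ln (D_iter q ((F ^^ i) x)) - ln (D_iter q x)\<bar> \<le> B * 2"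
proof -
  have step: "ln (D_iter q ((F ^^ Suc i) x)) - ln (D_iter q ((F ^^ i) x)) =
      ln (D ((F ^^ q) ((F ^^ i) x))) - ln (D ((F ^^ i) x))" for i
  proof -
    have "(\<Sum>j<q. ln (D ((F ^^ j) ((F ^^ Suc i) x)))) = (\<Sum>j<q. ln (D ((F ^^ (j + 1)) ((F ^^ i) x))))"
      by (simp add: funpow_swap1)
    then show ?thesis
      using sum_shift[of "\<lambda>j. ln (D ((F ^^ j) ((F ^^ i) x)))" 1 q] by (simp add: ln_D_iter)
  qed
  have D_int: "D (y - of_int p) = D y" for y
  proof -
    have "((\<lambda>z. F (z - of_int p)) has_real_derivative D (y - of_int p)) (at y)"
      by (rule DERIV_chain2[OF deriv_F, THEN DERIV_cong]) (auto intro!: derivative_eq_intros)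
    moreover have "(\<lambda>z. F (z - of_int p)) = (\<lambda>z. F z - of_int p)"
      using F_add_int[of _ "- p"] by auto
    moreover have "((\<lambda>z. F z - of_int p) has_real_derivative D y) (at y)"
      by (auto intro!: derivative_eq_intros deriv_F)
    ultimately show ?thesis using DERIV_unique by metis
  qed
  have "\<bar>ln (D_iter q ((F ^^ i) x)) - ln (D_iter q x)\<bar> \<le> B * (\<Sum>j<i. gap q p ((F ^^ j) x))" for i
  proof (induction i)
    case 0
    show ?case by simp
  next
    case (Suc i)
    have "\<bar>ln (D ((F ^^ q) ((F ^^ i) x) - of_int p)) - ln (D ((F ^^ i) x))\<bar> \<le>
        B * \<bar>(F ^^ q) ((F ^^ i) x) - of_int p - (F ^^ i) x\<bar>"
      by (rule ln_D_lipschitz)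
    also have "\<dots> = B * gap q p ((F ^^ i) x)"
      using gap_pos[of "(F ^^ i) x"] by (simp add: gap_def)
    finally show ?case using Suc step[of i] by (simp add: D_int distrib_left)
  qed
  also have "B * (\<Sum>j<i. gap q p ((F ^^ j) x)) \<le> B * 2"
    using tile_sum_le_2[OF assms] B_pos by simp
  finally show ?thesis .
qed

text \<open>At cost \<open>2 * B\<close> one passes from \<open>x\<close> to the orbit point whose
  arc contains \<open>y\<close>; moving inside that arc costs another \<open>B\<close>, since by
  \<open>q \<le> q'\<close> its first \<open>q\<close> images have total length at most 1.\<close>

lemma ln_D_iter_bound: "\<bar>ln (D_iter q y) - ln (D_iter q x)\<bar> \<le> B * 3"
proof -
  obtain i k where i: "i < q + q'" and y: "(F ^^ i) x + of_int k \<le> y"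
     "y \<le> (F ^^ i) x + of_int k + gap q p ((F ^^ i) x + of_int k)"
    using arc_cover by blast
  define u where "u = (F ^^ i) (x + of_int k)"
  have u: "u = (F ^^ i) x + of_int k" by (simp add: u_def iter_add_int)
  have D_int: "D_iter q (x + of_int k) = D_iter q x" for x
  proof -
    have "((\<lambda>z. (F ^^ q) (z + of_int k)) has_real_derivative D_iter q (x + of_int k)) (at x)"
      by (rule DERIV_chain2[OF deriv_iter, THEN DERIV_cong]) (auto intro!: derivative_eq_intros)
    moreover have "((\<lambda>z. (F ^^ q) z + of_int k) has_real_derivative D_iter q x) (at x)"
      by (auto intro!: derivative_eq_intros deriv_iter)
    ultimately show ?thesis unfolding iter_add_int using DERIV_unique by metis
  qed
  have "\<bar>ln (D_iter q y) - ln (D_iter q u)\<bar> \<le> B * (\<Sum>j<q. \<bar>(F ^^ j) y - (F ^^ j) u\<bar>)"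
    by (rule ln_D_iter_diff)
  also have "\<dots> \<le> B * 1"
    using B_pos tile_sum_interval(2)[of u y q] y good_facts(2) by (intro mult_left_mono) (auto simp: u)
  finally show ?thesis
    using ln_D_iter_orbit[of i x] i by (simp add: u D_int)
qed

text \<open>An iterate of the lift maps an interval of length 1 onto one of length 1, so its
  derivative is 1 somewhere, and bounded distortion compares every other point with that
  one.\<close>

lemma D_iter_bounds: "exp (- (3 * B)) \<le> D_iter q x" "D_iter q x \<le> exp (3 * B)"
proof -
  obtain t where "(F ^^ q) (0 + of_int 1) - (F ^^ q) 0 = (0 + of_int 1 - 0) * D_iter q t"
    using iter_mvt[of 0 "0 + of_int 1" q] by auto
  then have "D_iter q t = 1" by (subst (asm) iter_add_int) simp
  then have "\<bar>ln (D_iter q x)\<bar> \<le> 3 * B" using ln_D_iter_bound[of x t] by simp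
  then have "exp (- (3 * B)) \<le> exp (ln (D_iter q x))" "exp (ln (D_iter q x)) \<le> exp (3 * B)"
    unfolding exp_le_cancel_iff by linarith+
  then show "exp (- (3 * B)) \<le> D_iter q x" "D_iter q x \<le> exp (3 * B)"
    using D_iter_pos[of q x] by simp_all
qed

lemma gap_lipschitz_aux:
  assumes "x < y"
  shows "\<bar>gap q p y - gap q p x\<bar> \<le> exp (3 * B) * (y - x)"
proof -
  obtain t where "(F ^^ q) y - (F ^^ q) x = (y - x) * D_iter q t" using iter_mvt[OF assms] by blast
  then have "gap q p y - gap q p x = (y - x) * (D_iter q t - 1)" by (simp add: gap_def algebra_simps)
  then have "\<bar>gap q p y - gap q p x\<bar> = (y - x) * \<bar>D_iter q t - 1\<bar>" using assms by (simp add: abs_mult)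
  moreover have "1 \<le> exp (3 * B)" using B_pos by simp
  then have "\<bar>D_iter q t - 1\<bar> \<le> exp (3 * B)"
    using D_iter_bounds[of t] D_iter_pos[of q t] by linarith
  ultimately show ?thesis using assms by (simp add: mult.commute mult_left_mono)
qed

lemma gap_lipschitz: "\<bar>gap q p y - gap q p x\<bar> \<le> exp (3 * B) * \<bar>y - x\<bar>"
  using gap_lipschitz_aux[of x y] gap_lipschitz_aux[of y x] by (cases x y rule: linorder_cases) auto

text \<open>The arc at \<open>y\<close> consists of the rest of the arc at \<open>x\<close> and of
  the image under \<open>F ^^ q\<close> of the part already passed; the latter shrinks at most by
  the factor \<open>exp (- (3 * B))\<close>.\<close>

lemma gap_ge:
  assumes "x \<le> y" "y \<le> x + gap q p x"
  shows "exp (- (3 * B)) * gap q p x \<le> gap q p y"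
proof (cases "x = y")
  case True
  then show ?thesis using gap_pos[of x] B_pos by simp
next
  case False
  then obtain t where "(F ^^ q) y - (F ^^ q) x = (y - x) * D_iter q t"
    using iter_mvt[of x y q] assms by auto
  then have eq: "gap q p y = (x + gap q p x - y) + (y - x) * D_iter q t"
    by (simp add: gap_def algebra_simps)
  have "exp (- (3 * B)) * (x + gap q p x - y) \<le> 1 * (x + gap q p x - y)"
    using assms B_pos by (intro mult_right_mono) auto
  moreover have "exp (- (3 * B)) * (y - x) \<le> (y - x) * D_iter q t"
    using assms D_iter_bounds(1)[of t] by (simp add: mult.commute mult_left_mono)
  ultimately show ?thesis unfolding eq by (simp add: algebra_simps)
qed

lemma gap_F:
  shows "gap q p (F x) \<le> D x * gap q p x * exp (B * gap q p x)"
    and "D x * gap q p x * exp (- (B * gap q p x)) \<le> gap q p (F x)"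
proof -
  obtain t where t: "x < t" "t < x + gap q p x" "gap q p (F x) = gap q p x * D t"
    using iter_mvt[of x "x + gap q p x" 1] gap_pos[of x] gap_iter[of 1 x] by (auto simp: D_iter_def)
  have "\<bar>ln (D t) - ln (D x)\<bar> \<le> B * gap q p x"
    using ln_D_lipschitz[of t x] t B_pos by (smt (verit) mult_less_cancel_left)
  then have "ln (D t) \<le> ln (D x) + B * gap q p x" "ln (D x) - B * gap q p x \<le> ln (D t)" by linarith+
  then have "exp (ln (D t)) \<le> exp (ln (D x) + B * gap q p x)"
    "exp (ln (D x) - B * gap q p x) \<le> exp (ln (D t))" by (simp_all only: exp_le_cancel_iff)
  then have "D t \<le> D x * exp (B * gap q p x)" "D x * exp (- (B * gap q p x)) \<le> D t"
    using D_pos by (simp_all add: exp_add exp_diff exp_minus divide_inverse)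
  then show "gap q p (F x) \<le> D x * gap q p x * exp (B * gap q p x)"
    "D x * gap q p x * exp (- (B * gap q p x)) \<le> gap q p (F x)"
    unfolding t(3) using mult_left_mono gap_pos[of x, THEN less_imp_le] by (fastforce simp: mult_ac)+
qed

end

lemma good_sequence:
  obtains q q' :: "nat \<Rightarrow> nat" and p p' where "\<And>n. good (q n) (p n) (q' n) (p' n)" "strict_mono q"
    "\<And>m n x. m \<le> n \<Longrightarrow> gap (q n) (p n) x \<le> gap (q m) (p m) x"
proof -
  define good4 where "good4 = (\<lambda>(q, p, q', p'). good q p q' p')"
  have ex: "\<exists>x. good4 x" using good_exists by (auto simp: good4_def)
  have nxt: "\<exists>t. good4 t \<and> (fst s < fst t \<and>
      (\<forall>x. gap (fst t) (fst (snd t)) x \<le> gap (fst s) (fst (snd s)) x))" if "good4 s" for s and n :: nat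
  proof -
    obtain q p q' p' where s: "s = (q, p, q', p')" by (cases s)
    then obtain Q P Q' P' where "good Q P Q' P'" "q < Q" "\<forall>x. gap Q P x \<le> gap q p x"
      using good_next[of q p q' p'] \<open>good4 s\<close> by (auto simp: good4_def)
    then show ?thesis unfolding s good4_def by (intro exI[of _ "(Q, P, Q', P')"]) simp
  qed
  have "\<exists>s. \<forall>n. good4 (s n) \<and> (fst (s n) < fst (s (Suc n)) \<and>
      (\<forall>x. gap (fst (s (Suc n))) (fst (snd (s (Suc n)))) x \<le> gap (fst (s n)) (fst (snd (s n))) x))"
    by (rule dependent_nat_choice[OF ex nxt])
  then obtain s where s: "\<And>n. good4 (s n)"
    "\<And>n. fst (s n) < fst (s (Suc n)) \<and>
      (\<forall>x. gap (fst (s (Suc n))) (fst (snd (s (Suc n)))) x \<le> gap (fst (s n)) (fst (snd (s n))) x)"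
    by blast
  show ?thesis
  proof
    show "good (fst (s n)) (fst (snd (s n))) (fst (snd (snd (s n)))) (snd (snd (snd (s n))))" for n
      using s(1)[of n] by (simp add: good4_def split: prod.splits)
    show "strict_mono (\<lambda>n. fst (s n))" using s(2) by (simp add: strict_mono_Suc_iff)
    show "gap (fst (s n)) (fst (snd (s n))) x \<le> gap (fst (s m)) (fst (snd (s m))) x" if "m \<le> n" for m n x
      using that by (induction rule: dec_induct) (use s(2) order_trans in blast)+
  qed
qed

section \<open>Denjoy's theorem in the form of uniformly small gaps\<close>

lemma F_surj: "\<exists>y. F y = x"
proof -
  define k where "k = \<lfloor>x - F 0\<rfloor>"
  have "F (0 + of_int k) \<le> x" "x \<le> F (0 + of_int (k + 1))"
    unfolding F_add_int k_def by linarith+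
  then show ?thesis
    using IVT[of F "0 + of_int k" x "0 + of_int (k + 1)"] isCont_F by auto
qed

text \<open>Denjoy's theorem: an arc that survives in all \<open>[x, x + gap x]\<close> has disjoint images, whose
  lengths tend to zero in both directions, whereas bounded distortion keeps the product of the
  lengths of the images under \<open>F\<^sup>q\<close> and \<open>F\<^sup>-\<^sup>q\<close> away from zero.\<close>

lemma no_wandering:
  fixes q :: "nat \<Rightarrow> nat"
  assumes good: "\<And>n. good (q n) (p n) (q' n) (p' n)" and q: "strict_mono q"
    and "\<delta> > 0" and le: "\<And>n. \<delta> \<le> gap (q n) (p n) x"
  shows False
proof -
  define Fi where "Fi = inv F"
  have F_Fi: "F (Fi y) = y" for y
    unfolding Fi_def using F_surj by (intro f_inv_into_f) (metis rangeI)
  have iter_Fi: "(F ^^ n) ((Fi ^^ n) y) = y" for n y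
    by (induction n arbitrary: y) (simp_all add: F_Fi funpow_swap1)
  have iter_Fi_add: "(F ^^ i) ((Fi ^^ (i + j)) y) = (Fi ^^ j) y" for i j y
    using iter_Fi[of i "(Fi ^^ j) y"] by (simp add: funpow_add)
  define a b where "a = (\<lambda>j. (F ^^ j) (x + \<delta>) - (F ^^ j) x)"
    and "b = (\<lambda>j. (Fi ^^ j) (x + \<delta>) - (Fi ^^ j) x)"
  have a0: "a j > 0" for j using \<open>\<delta> > 0\<close> by (simp add: a_def)
  have Fi_less: "(Fi ^^ j) y < (Fi ^^ j) z" if "y < z" for j y z
    using that iter_less_iff[of j "(Fi ^^ j) y" "(Fi ^^ j) z"] by (simp add: iter_Fi)
  then have b0: "b j > 0" for j using \<open>\<delta> > 0\<close> by (simp add: b_def)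
  have qn: "n \<le> q n" "n \<le> q' n" for n :: nat
    using seq_suble[OF q, of n] good[of n] by (auto simp: good_def)
  \<comment> \<open>At each stage the first \<open>q'\<close> images of
    \<open>[x, x + \<delta>]\<close> lie in tiles of total length at most 1, and \<open>q'\<close>
    grows with the stage.\<close>
  have "summable a"
  proof (rule bounded_imp_summable)
    fix n
    have "sum a {..n} \<le> sum a {..<q' (Suc n)}"
      using qn[of "Suc n"] a0 by (intro sum_mono2) (auto simp: less_imp_le)
    also have "\<dots> \<le> (\<Sum>i<q' (Suc n). gap (q (Suc n)) (p (Suc n)) ((F ^^ i) x))"
      using le by (intro sum_mono) (simp add: a_def gap_iter[OF good])
    also have "\<dots> \<le> 1" by (rule tile_sum_le[OF good])
    finally show "sum a {..n} \<le> 1" .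
  qed (use a0 less_imp_le in blast)
  then have a_lim: "(\<lambda>n. a (q n)) \<longlonglongrightarrow> 0"
    using summable_LIMSEQ_zero LIMSEQ_subseq_LIMSEQ[OF _ q] by (fastforce simp: o_def)
  have "summable b"
  proof (rule bounded_imp_summable)
    fix n
    let ?m = "Suc n"
    \<comment> \<open>With \<open>Q\<close> one less than \<open>q'\<close>, the tiles of the orbit
      that starts at \<open>(Fi ^^ Q) x\<close> end with the one at \<open>x\<close>; the backward
      images of the arc lie in them in reverse order.\<close>
    define Q where "Q = q' ?m - 1"
    have Q: "q' ?m = Suc Q" using qn(2)[of ?m] by (simp add: Q_def)
    have eq: "(Fi ^^ i) y = (F ^^ (Q - i)) ((Fi ^^ Q) y)" if "i \<le> Q" for i y
      using iter_Fi_add[of "Q - i" i y] that by simp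
    have "sum b {..n} \<le> sum b {..<Suc Q}"
      using qn(2)[of ?m] b0 by (intro sum_mono2) (auto simp: less_imp_le Q)
    also have "\<dots> \<le> (\<Sum>i<Suc Q. gap (q ?m) (p ?m) ((F ^^ (Q - i)) ((Fi ^^ Q) x)))"
    proof (rule sum_mono)
      fix i assume "i \<in> {..<Suc Q}"
      then have i: "i \<le> Q" by auto
      have "x + \<delta> \<le> x + gap (q ?m) (p ?m) x" using le[of ?m] by simp
      also have "\<dots> = (F ^^ Q) ((Fi ^^ Q) x + gap (q ?m) (p ?m) ((Fi ^^ Q) x))"
        using gap_iter[OF good, of ?m Q "(Fi ^^ Q) x"] by (simp add: iter_Fi)
      finally have "(Fi ^^ Q) (x + \<delta>) \<le> (Fi ^^ Q) x + gap (q ?m) (p ?m) ((Fi ^^ Q) x)"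
        using iter_le_iff[of Q "(Fi ^^ Q) (x + \<delta>)"] by (simp add: iter_Fi)
      then show "b i \<le> gap (q ?m) (p ?m) ((F ^^ (Q - i)) ((Fi ^^ Q) x))"
        unfolding b_def eq[OF i] by (simp add: gap_iter[OF good])
    qed
    also have "\<dots> = (\<Sum>i<Suc Q. gap (q ?m) (p ?m) ((F ^^ i) ((Fi ^^ Q) x)))"
      using sum.nat_diff_reindex[of "\<lambda>i. gap (q ?m) (p ?m) ((F ^^ i) ((Fi ^^ Q) x))" "Suc Q"] by simp
    also have "\<dots> \<le> 1" using tile_sum_le[OF good, of ?m] by (simp only: Q)
    finally show "sum b {..n} \<le> 1" .
  qed (use b0 less_imp_le in blast)
  then have b_lim: "(\<lambda>n. b (q n)) \<longlonglongrightarrow> 0"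
    using summable_LIMSEQ_zero LIMSEQ_subseq_LIMSEQ[OF _ q] by (fastforce simp: o_def)
  have "\<delta>\<^sup>2 * exp (- (2 * B)) \<le> a (q n) * b (q n)" for n
  proof -
    \<comment> \<open>The backward image of the arc is translated by \<open>p n\<close> so that the
      gap at \<open>y\<close> ends at \<open>x\<close>. The arcs \<open>[y, x]\<close> and
      \<open>[x, x + \<delta>]\<close> are then adjacent, and each contributes \<open>B\<close> to
      the distortion between \<open>t\<close> and \<open>s\<close>.\<close>
    define y where "y = (Fi ^^ q n) x + of_int (p n)"
    define y' where "y' = (Fi ^^ q n) (x + \<delta>) + of_int (p n)"
    have y: "(F ^^ q n) y = x + of_int (p n)" "(F ^^ q n) y' = x + \<delta> + of_int (p n)"
      by (simp_all add: y_def y'_def iter_add_int iter_Fi)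
    have yx: "y + gap (q n) (p n) y = x" by (simp add: gap_def y)
    have "(F ^^ q n) x \<ge> (F ^^ q n) y'" using le[of n] by (simp add: y gap_def)
    then have "y' \<le> x" by simp
    have "y < y'" using Fi_less \<open>\<delta> > 0\<close> by (simp add: y_def y'_def)
    have "x < x + \<delta>" using \<open>\<delta> > 0\<close> by simp
    from iter_mvt[OF this, of "q n"] obtain s where s: "x < s" "s < x + \<delta>" "a (q n) = \<delta> * D_iter (q n) s"
      by (metis a_def add_diff_cancel_left')
    have yy: "(F ^^ q n) y' - (F ^^ q n) y = \<delta>" "y' - y = b (q n)"
      by (simp_all only: y) (simp_all add: b_def y_def y'_def)
    obtain t where t: "y < t" "t < y'" "\<delta> = b (q n) * D_iter (q n) t"
      using iter_mvt[OF \<open>y < y'\<close>, of "q n"] unfolding yy by blast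
    have "\<bar>ln (D_iter (q n) t) - ln (D_iter (q n) s)\<bar> \<le> B * (\<Sum>j<q n. \<bar>(F ^^ j) t - (F ^^ j) s\<bar>)"
      by (rule ln_D_iter_diff)
    also have "\<dots> \<le> B * (1 + 1)"
    proof -
      have "(\<Sum>j<q n. \<bar>(F ^^ j) t - (F ^^ j) s\<bar>) \<le>
         (\<Sum>j<q n. \<bar>(F ^^ j) x - (F ^^ j) y\<bar> + \<bar>(F ^^ j) s - (F ^^ j) x\<bar>)"
      proof (rule sum_mono)
        fix j
        have "(F ^^ j) y \<le> (F ^^ j) t" "(F ^^ j) t \<le> (F ^^ j) x" "(F ^^ j) x \<le> (F ^^ j) s"
          using s t \<open>y' \<le> x\<close> by auto
        then show "\<bar>(F ^^ j) t - (F ^^ j) s\<bar> \<le> \<bar>(F ^^ j) x - (F ^^ j) y\<bar> + \<bar>(F ^^ j) s - (F ^^ j) x\<bar>"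
          by linarith
      qed
      also have "\<dots> \<le> 1 + 1"
        unfolding sum.distrib using s(1,2) le[of n] gap_pos[OF good, of n y] yx good_facts(2)[OF good, of n]
        by (intro add_mono tile_sum_interval(2)[OF good]) auto
      finally show ?thesis using B_pos by simp
    qed
    also have "\<dots> = 2 * B" by simp
    finally have "ln (D_iter (q n) t) - 2 * B \<le> ln (D_iter (q n) s)" by linarith
    then have "exp (ln (D_iter (q n) t) - 2 * B) \<le> exp (ln (D_iter (q n) s))" by simp
    then have "D_iter (q n) t * exp (- (2 * B)) \<le> D_iter (q n) s"
      using D_iter_pos by (simp add: exp_diff exp_minus divide_inverse)
    then have "(\<delta> * b (q n)) * (D_iter (q n) t * exp (- (2 * B))) \<le> (\<delta> * b (q n)) * D_iter (q n) s"
      using \<open>\<delta> > 0\<close> b0 by (intro mult_left_mono) (auto simp: less_imp_le)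
    also have "\<dots> = a (q n) * b (q n)" by (simp add: s(3))
    also have "(\<delta> * b (q n)) * (D_iter (q n) t * exp (- (2 * B))) =
        \<delta> * (b (q n) * D_iter (q n) t) * exp (- (2 * B))" by (simp add: mult_ac)
    also have "\<dots> = \<delta>\<^sup>2 * exp (- (2 * B))" using t(3) by (simp add: power2_eq_square)
    finally show ?thesis .
  qed
  then have "\<delta>\<^sup>2 * exp (- (2 * B)) \<le> 0 * 0"
    using tendsto_mult[OF a_lim b_lim] by (intro LIMSEQ_le_const) auto
  then show False using \<open>\<delta> > 0\<close> by (simp add: mult_le_0_iff)
qed

text \<open>Otherwise the sets of points of \<open>{0..1}\<close> where the gap is at least \<delta>
  are nonempty, compact and nested, and a common point would carry an arc excluded by
  \<open>no_wandering\<close>.\<close>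

lemma denjoy:
  assumes "\<delta> > 0"
  shows "\<exists>q p q' p'. good q p q' p' \<and> (\<forall>x. gap q p x < \<delta>)"
proof (rule ccontr)
  assume neg: "\<not> ?thesis"
  obtain q q' :: "nat \<Rightarrow> nat" and p p' where good: "\<And>n. good (q n) (p n) (q' n) (p' n)" and q: "strict_mono q"
    and dec: "\<And>m n x. m \<le> n \<Longrightarrow> gap (q n) (p n) x \<le> gap (q m) (p m) x"
    by (rule good_sequence, rule that)
  define S where "S = (\<lambda>n. {x\<in>{0..1}. \<delta> \<le> gap (q n) (p n) x})"
  have cont: "continuous_on {0..1} (gap (q n) (p n))" for n
    unfolding gap_def
    by (intro continuous_intros continuous_at_imp_continuous_on ballI isCont_iter)
  have 1: "closed (S n)" for n
    using continuous_closed_preimage[OF cont[of n], of "{\<delta>..}"] by (simp add: S_def Int_def vimage_def)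
  have 2: "S n \<noteq> {}" for n
  proof -
    obtain x where x: "gap (q n) (p n) x \<ge> \<delta>" using neg good[of n] by (meson not_le)
    have "gap (q n) (p n) (x + of_int (- \<lfloor>x\<rfloor>)) \<ge> \<delta>"
      using x by (simp only: gap_add_int[OF good])
    moreover have "x + of_int (- \<lfloor>x\<rfloor>) \<in> {0..1}" by simp linarith
    ultimately show ?thesis unfolding S_def by blast
  qed
  have 3: "S n \<subseteq> S m" if "m \<le> n" for m n
    unfolding S_def using dec[OF that] order_trans by blast
  have 4: "bounded (S 0)" by (rule bounded_subset[of "{0..1}"]) (auto simp: S_def)
  obtain x where "\<And>n. x \<in> S n"
    using bounded_closed_nest[of S, OF 1 2 3 4] by metis
  then have "\<delta> \<le> gap (q n) (p n) x" for n unfolding S_def by blast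
  from no_wandering[OF good q assms this] show False .
qed

end

section \<open>Complex orbits near the circle\<close>

text \<open>In the coordinate \<open>\<zeta> = exp (2 \<pi> i w)\<close> the exterior of the circle is the lower half-plane, so the
  height of \<open>w\<close> above the circle is \<open>- Im w\<close>.\<close>

locale analytic_lift = circle_lift +
  fixes \<Phi> :: "complex \<Rightarrow> complex" and \<eta> :: real
  assumes \<eta>_pos: "0 < \<eta>" and B_\<eta>: "B * \<eta> \<le> 1 / 2"
    and \<Phi>_step1: "\<Phi> (w + 1) = \<Phi> w + 1"
    and \<Phi>_dist: "cmod (w - of_real x) \<le> \<eta> \<Longrightarrow>
      cmod (\<Phi> w - of_real (F x)) \<le> D x * cmod (w - of_real x) * (1 + B * cmod (w - of_real x))"
    and \<Phi>_height: "0 < y \<Longrightarrow> y \<le> \<eta> \<Longrightarrow> D x * y * (1 - B * y) \<le> - Im (\<Phi> (Complex x (- y)))"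
begin

lemma \<Phi>_add_int: "\<Phi> (w + of_int k) = \<Phi> w + of_int k"
  by (rule step1_add_int[of \<Phi>, OF \<Phi>_step1])

lemma \<Phi>_iter_add_int: "(\<Phi> ^^ n) (w + of_int k) = (\<Phi> ^^ n) w + of_int k"
  by (induction n) (simp_all add: \<Phi>_add_int)

context
  fixes q q' :: nat and p p' :: int
  assumes good: "good q p q' p'" and small: "\<And>x. gap q p x \<le> \<eta>"
begin

text \<open>In one step the distance relative to the gap grows at most by
  \<open>exp (2 * B * m)\<close>: one factor \<open>exp (B * m)\<close> for the nonlinearity of
  \<Phi>, one for comparing \<open>D\<close> times the gap with the next gap. The gaps sum to at
  most 2, so the bound on \<open>t\<close> keeps the distance below the gap, where
  \<open>\<Phi>_dist\<close> applies.\<close>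

lemma orbit_dist_aux:
  assumes "cmod (w - of_real x) \<le> t * gap q p x" "0 \<le> t" "t \<le> exp (- (4 * B))" "j \<le> q + q'"
  shows "cmod ((\<Phi> ^^ j) w - of_real ((F ^^ j) x)) \<le>
    t * exp (2 * B * (\<Sum>i<j. gap q p ((F ^^ i) x))) * gap q p ((F ^^ j) x)"
  using assms(4)
proof (induction j)
  case 0
  then show ?case using assms by simp
next
  case (Suc j)
  define d where "d = cmod ((\<Phi> ^^ j) w - of_real ((F ^^ j) x))"
  define m where "m = gap q p ((F ^^ j) x)"
  define T where "T = t * exp (2 * B * (\<Sum>i<j. gap q p ((F ^^ i) x)))"
  have d: "d \<le> T * m" using Suc by (simp add: d_def T_def m_def)
  have m: "0 < m" "m \<le> \<eta>" using gap_pos[OF good] small by (auto simp: m_def)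
  have "T \<le> exp (- (4 * B)) * exp (2 * B * 2)"
    unfolding T_def using assms(2,3) Suc.prems tile_sum_le_2[OF good, of j x] B_pos
    by (intro mult_mono) auto
  then have T: "T \<le> 1" by (simp flip: exp_add)
  have "d \<le> 1 * m" using d T m by (meson mult_right_mono less_imp_le order_trans)
  then have dm: "d \<le> m" by simp
  have d0: "0 \<le> d" by (simp add: d_def)
  have "cmod ((\<Phi> ^^ Suc j) w - of_real ((F ^^ Suc j) x)) \<le> D ((F ^^ j) x) * d * (1 + B * d)"
    using \<Phi>_dist[of "(\<Phi> ^^ j) w" "(F ^^ j) x"] dm m by (simp add: d_def)
  also have "\<dots> \<le> D ((F ^^ j) x) * (T * m) * exp (B * m)"
  proof (intro mult_mono d)
    have "1 + B * d \<le> 1 + B * m" using dm B_pos by simp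
    also have "\<dots> \<le> exp (B * m)" by (rule exp_ge_add_one_self)
    finally show "1 + B * d \<le> exp (B * m)" .
  qed (use d0 m D_pos B_pos assms(2) in \<open>auto simp: less_imp_le T_def\<close>)
  also have "\<dots> = T * exp (2 * B * m) * (D ((F ^^ j) x) * m * exp (- (B * m)))"
    by (simp add: mult_ac flip: exp_add)
  also have "\<dots> \<le> T * exp (2 * B * m) * gap q p (F ((F ^^ j) x))"
    using gap_F(2)[OF good, of "(F ^^ j) x"] assms(2)
    by (intro mult_left_mono) (auto simp: m_def T_def)
  also have "T * exp (2 * B * m) = t * exp (2 * B * (\<Sum>i<Suc j. gap q p ((F ^^ i) x)))"
    by (simp add: T_def m_def distrib_left exp_add)
  finally show ?case by simp
qed

lemma orbit_dist:
  assumes "cmod (w - of_real x) \<le> t * gap q p x" "0 \<le> t" "t \<le> exp (- (4 * B))" "j \<le> q + q'"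
  shows "cmod ((\<Phi> ^^ j) w - of_real ((F ^^ j) x)) \<le> t * exp (4 * B) * gap q p ((F ^^ j) x)"
proof -
  have "exp (2 * B * (\<Sum>i<j. gap q p ((F ^^ i) x))) \<le> exp (4 * B)"
    using tile_sum_le_2[OF good assms(4), of x] B_pos by simp
  then have "t * exp (2 * B * (\<Sum>i<j. gap q p ((F ^^ i) x))) * gap q p ((F ^^ j) x) \<le>
      t * exp (4 * B) * gap q p ((F ^^ j) x)"
    using assms(2) gap_pos[OF good, of "(F ^^ j) x"] by (intro mult_right_mono mult_left_mono) auto
  with orbit_dist_aux[OF assms] show ?thesis by linarith
qed

lemma orbit_dist_le:
  assumes "cmod (w - of_real x) \<le> exp (- (4 * B)) * gap q p x" "j \<le> q + q'"
  shows "cmod ((\<Phi> ^^ j) w - of_real ((F ^^ j) x)) \<le> gap q p ((F ^^ j) x)"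
  using orbit_dist[OF assms(1) _ _ assms(2)] by (simp flip: exp_add)

text \<open>One step loses at most \<open>exp (- (4 * B * m))\<close> of the relative height: one
  unit of the exponent for evaluating \<open>D\<close> at the real part \<open>u\<close>, one for
  the next gap, and two for the factor \<open>1 - B * y\<close>.\<close>

lemma orbit_height_aux:
  assumes w: "cmod (w - of_real x) \<le> exp (- (4 * B)) * gap q p x"
    and s: "s * gap q p x \<le> - Im w" "0 < s" and "j \<le> q + q'"
  shows "s * exp (- (4 * B * (\<Sum>i<j. gap q p ((F ^^ i) x)))) * gap q p ((F ^^ j) x) \<le> - Im ((\<Phi> ^^ j) w)"
  using assms(4)
proof (induction j)
  case 0
  then show ?case using assms by simp
next
  case (Suc j)
  define m where "m = gap q p ((F ^^ j) x)"
  define S where "S = s * exp (- (4 * B * (\<Sum>i<j. gap q p ((F ^^ i) x))))"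
  define y u where "y = - Im ((\<Phi> ^^ j) w)" and "u = Re ((\<Phi> ^^ j) w)"
  have dm: "cmod ((\<Phi> ^^ j) w - of_real ((F ^^ j) x)) \<le> m"
    using orbit_dist_le[OF w, of j] Suc.prems by (simp add: m_def)
  have m: "0 < m" "m \<le> \<eta>" using gap_pos[OF good] small by (auto simp: m_def)
  have S: "0 < S" using s by (simp add: S_def)
  have y: "S * m \<le> y" using Suc by (simp add: S_def m_def y_def)
  then have y0: "0 < y" using S m by (meson less_le_trans mult_pos_pos)
  have ym: "y \<le> m" using abs_Im_le_cmod[of "(\<Phi> ^^ j) w - of_real ((F ^^ j) x)"] dm by (simp add: y_def)
  have um: "\<bar>u - (F ^^ j) x\<bar> \<le> m"
    using abs_Re_le_cmod[of "(\<Phi> ^^ j) w - of_real ((F ^^ j) x)"] dm by (simp add: u_def)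
  have "ln (D ((F ^^ j) x)) - B * m \<le> ln (D u)"
    using ln_D_lipschitz[of u "(F ^^ j) x"] um B_pos by (smt (verit) mult_left_mono)
  then have "exp (ln (D ((F ^^ j) x)) - B * m) \<le> exp (ln (D u))" by simp
  then have Du: "D ((F ^^ j) x) * exp (- (B * m)) \<le> D u"
    using D_pos by (simp add: exp_diff exp_minus divide_inverse)
  have "B * y \<le> 1 / 2"
    using B_\<eta> ym m B_pos by (smt (verit) mult_left_mono)
  have "exp (- (2 * B * m)) \<le> exp (- (2 * B * y))" using ym B_pos by simp
  also have "\<dots> \<le> 1 - B * y"
  proof -
    have "0 \<le> (B * y) * (1 - 2 * (B * y))"
      using \<open>B * y \<le> 1 / 2\<close> y0 B_pos by (intro mult_nonneg_nonneg) auto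
    then have "1 \<le> (1 - B * y) * (1 + 2 * (B * y))" by (simp add: algebra_simps)
    also have "\<dots> \<le> (1 - B * y) * exp (2 * (B * y))"
      using \<open>B * y \<le> 1 / 2\<close> by (intro mult_left_mono exp_ge_add_one_self) auto
    finally show ?thesis by (simp add: exp_minus field_simps)
  qed
  finally have By: "exp (- (2 * B * m)) \<le> 1 - B * y" .
  have "S * exp (- (4 * B * m)) * gap q p (F ((F ^^ j) x)) \<le>
      S * exp (- (4 * B * m)) * (D ((F ^^ j) x) * m * exp (B * m))"
    using gap_F(1)[OF good, of "(F ^^ j) x"] S by (intro mult_left_mono) (auto simp: m_def)
  also have "\<dots> = (D ((F ^^ j) x) * exp (- (B * m))) * (S * m) * exp (- (2 * B * m))"
    by (simp add: mult_ac flip: exp_add)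
  also have "\<dots> \<le> D u * y * (1 - B * y)"
    using Du y By D_pos S m y0 by (intro mult_mono) (auto simp: less_imp_le)
  also have "\<dots> \<le> - Im (\<Phi> (Complex u (- y)))"
    using y0 ym m by (intro \<Phi>_height) auto
  also have "Complex u (- y) = (\<Phi> ^^ j) w" by (simp add: u_def y_def)
  also have "S * exp (- (4 * B * m)) = s * exp (- (4 * B * (\<Sum>i<Suc j. gap q p ((F ^^ i) x))))"
    by (simp add: S_def m_def distrib_left exp_add exp_diff exp_minus divide_inverse)
  finally show ?case by simp
qed

lemma orbit_height:
  assumes w: "cmod (w - of_real x) \<le> exp (- (4 * B)) * gap q p x"
    and s: "s * gap q p x \<le> - Im w" "0 < s" and "j \<le> q + q'"
  shows "s * exp (- (8 * B)) * gap q p ((F ^^ j) x) \<le> - Im ((\<Phi> ^^ j) w)"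
proof -
  have "exp (- (8 * B)) \<le> exp (- (4 * B * (\<Sum>i<j. gap q p ((F ^^ i) x))))"
    using tile_sum_le_2[OF good assms(4), of x] B_pos by simp
  then have "s * exp (- (8 * B)) * gap q p ((F ^^ j) x) \<le>
      s * exp (- (4 * B * (\<Sum>i<j. gap q p ((F ^^ i) x)))) * gap q p ((F ^^ j) x)"
    using s gap_pos[OF good, of "(F ^^ j) x"] by (intro mult_right_mono mult_left_mono) auto
  with orbit_height_aux[OF assms] show ?thesis by linarith
qed

text \<open>From relative heights up to \<open>exp (- (4 * B))\<close>, the possible growth by
  \<open>exp (4 * B)\<close> still leaves the first \<open>q + q'\<close> images within one gap of
  the circle orbit.\<close>

definition region :: "complex set" where
  "region = {w. 0 < - Im w \<and> - Im w \<le> exp (- (4 * B)) * gap q p (Re w)}"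

lemma region_orbit:
  assumes "w \<in> region" "j \<le> q + q'"
  shows "0 < - Im ((\<Phi> ^^ j) w)" "- Im ((\<Phi> ^^ j) w) \<le> gap q p ((F ^^ j) (Re w))"
proof -
  have eq: "w - of_real (Re w) = Complex 0 (Im w)" by (simp add: complex_eq_iff)
  have w: "cmod (w - of_real (Re w)) \<le> exp (- (4 * B)) * gap q p (Re w)"
    using assms unfolding eq by (simp add: region_def complex_norm)
  define s where "s = - Im w / gap q p (Re w)"
  have s: "0 < s" "s * gap q p (Re w) \<le> - Im w"
    using assms gap_pos[OF good, of "Re w"] by (simp_all add: s_def region_def divide_neg_pos)
  have "0 < s * exp (- (8 * B)) * gap q p ((F ^^ j) (Re w))"
    using s gap_pos[OF good] by simp
  also have "\<dots> \<le> - Im ((\<Phi> ^^ j) w)" by (rule orbit_height[OF w s(2,1) assms(2)])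
  finally show "0 < - Im ((\<Phi> ^^ j) w)" .
  show "- Im ((\<Phi> ^^ j) w) \<le> gap q p ((F ^^ j) (Re w))"
    using orbit_dist_le[OF w assms(2)] abs_Im_le_cmod[of "(\<Phi> ^^ j) w - of_real ((F ^^ j) (Re w))"] by simp
qed

text \<open>A Whitney box over the arc \<open>[u, u + gap u]\<close>: its size and its height are comparable to \<open>gap u\<close>.
  The exponents are chosen so that the box contains the curve over this arc and all orbits shadowing
  it, each distorted by at most \<open>exp (8 * B)\<close>, and lies well inside the region.\<close>

definition orbit_box :: "real \<Rightarrow> complex set" where
  "orbit_box u = {w. u - exp (- (7 * B)) / 4 * gap q p u \<le> Re w \<and>
     Re w \<le> u + gap q p u + exp (- (7 * B)) / 4 * gap q p u \<and>
     exp (- (25 * B)) / 8 * gap q p u \<le> - Im w \<and> - Im w \<le> exp (- (7 * B)) / 4 * gap q p u}"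

text \<open>The factor fits the box: up to the growth \<open>exp (4 * B)\<close> and the gap ratio
  \<open>2 * exp (3 * B)\<close> it gives the upper bound \<open>exp (- (7 * B)) / 4\<close>, and
  with the losses \<open>exp (- (8 * B))\<close> and \<open>exp (- (3 * B))\<close> the lower bound
  \<open>exp (- (25 * B)) / 8\<close>.\<close>

definition curve :: "real \<Rightarrow> complex" where
  "curve x = Complex x (- (exp (- (14 * B)) / 8 * gap q p x))"

lemma orbit_box_convex: "convex (orbit_box u)"
proof -
  let ?a = "u - exp (- (7 * B)) / 4 * gap q p u"
    and ?b = "u + gap q p u + exp (- (7 * B)) / 4 * gap q p u"
    and ?c = "- (exp (- (7 * B)) / 4 * gap q p u)" and ?d = "- (exp (- (25 * B)) / 8 * gap q p u)"
  have "orbit_box u = cbox (Complex ?a ?c) (Complex ?b ?d)"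
    by (auto simp: orbit_box_def in_cbox_complex_iff)
  then show ?thesis by (metis convex_box(1))
qed

lemma gap_le: "y \<in> {x..x + gap q p x} \<Longrightarrow> gap q p y \<le> 2 * exp (3 * B) * gap q p x"
proof -
  assume y: "y \<in> {x..x + gap q p x}"
  have "gap q p y \<le> gap q p x + exp (3 * B) * \<bar>y - x\<bar>" using gap_lipschitz[OF good, of y x] by linarith
  also have "\<dots> \<le> exp (3 * B) * gap q p x + exp (3 * B) * gap q p x"
    using y gap_pos[OF good, of x] B_pos by (intro add_mono mult_left_mono) auto
  finally show ?thesis by (simp add: mult_ac)
qed

text \<open>At the nearest point \<open>z\<close> of the arc the gap is at least
  \<open>exp (- (3 * B))\<close> times that of \<open>u\<close>; the margin
  \<open>exp (- (6 * B)) / 2\<close> is such that the Lipschitz bound loses at most half of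
  this.\<close>

lemma orbit_box_gap:
  assumes "u - exp (- (6 * B)) / 2 * gap q p u \<le> y" "y \<le> u + gap q p u + exp (- (6 * B)) / 2 * gap q p u"
  shows "exp (- (3 * B)) / 2 * gap q p u \<le> gap q p y"
proof -
  define z where "z = max u (min y (u + gap q p u))"
  have m: "0 < gap q p u" by (rule gap_pos[OF good])
  have z: "u \<le> z" "z \<le> u + gap q p u" using m by (auto simp: z_def)
  have "\<bar>y - z\<bar> \<le> exp (- (6 * B)) / 2 * gap q p u"
    using assms m by (auto simp: z_def max_def min_def)
  then have "exp (3 * B) * \<bar>y - z\<bar> \<le> exp (3 * B) * (exp (- (6 * B)) / 2 * gap q p u)" by simp
  also have "\<dots> = exp (- (3 * B)) / 2 * gap q p u" by (simp flip: exp_add)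
  finally show ?thesis
    using gap_ge[OF good z] gap_lipschitz[OF good, of y z] by linarith
qed

text \<open>The radius is the least height in the box, so the disk stays in the lower half-plane;
  its heights stay below \<open>exp (- (7 * B)) / 2 * gap q p u\<close>, which the preceding lower
  bound for nearby gaps allows.\<close>

lemma orbit_box_ball:
  assumes "w \<in> orbit_box u"
  shows "ball w (exp (- (25 * B)) / 8 * gap q p u) \<subseteq> region"
proof
  fix v assume "v \<in> ball w (exp (- (25 * B)) / 8 * gap q p u)"
  then have "cmod (v - w) < exp (- (25 * B)) / 8 * gap q p u"
    by (simp add: dist_norm norm_minus_commute)
  then have d: "\<bar>Re v - Re w\<bar> < exp (- (25 * B)) / 8 * gap q p u"
     "\<bar>Im v - Im w\<bar> < exp (- (25 * B)) / 8 * gap q p u"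
    using abs_Re_le_cmod[of "v - w"] abs_Im_le_cmod[of "v - w"] by auto
  have m: "0 < gap q p u" by (rule gap_pos[OF good])
  have le: "exp (- (7 * B)) / 4 * gap q p u \<le> exp (- (6 * B)) / 4 * gap q p u"
      "exp (- (25 * B)) / 8 * gap q p u \<le> exp (- (6 * B)) / 4 * gap q p u"
      "exp (- (25 * B)) / 8 * gap q p u \<le> exp (- (7 * B)) / 4 * gap q p u"
    using m B_pos by (intro mult_right_mono frac_le; simp)+
  have "exp (- (3 * B)) / 2 * gap q p u \<le> gap q p (Re v)"
    using assms d le unfolding orbit_box_def mem_Collect_eq by (intro orbit_box_gap) linarith+
  then have "exp (- (4 * B)) * (exp (- (3 * B)) / 2 * gap q p u) \<le> exp (- (4 * B)) * gap q p (Re v)"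
    by simp
  also have "exp (- (4 * B)) * (exp (- (3 * B)) / 2 * gap q p u) = exp (- (7 * B)) / 2 * gap q p u"
    by (simp flip: exp_add)
  finally show "v \<in> region"
    using assms d le(3) unfolding orbit_box_def region_def mem_Collect_eq by linarith
qed

lemma curve_in_box:
  assumes "y \<in> {u..u + gap q p u}"
  shows "curve y \<in> orbit_box u"
proof -
  have m: "0 < gap q p u" by (rule gap_pos[OF good])
  have 1: "exp (- (25 * B)) / 8 * gap q p u \<le> exp (- (14 * B)) / 8 * gap q p y"
  proof -
    have "exp (- (25 * B)) / 8 * gap q p u \<le> exp (- (14 * B)) / 8 * (exp (- (3 * B)) * gap q p u)"
      using m B_pos by (simp flip: exp_add)
    also have "\<dots> \<le> exp (- (14 * B)) / 8 * gap q p y"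
      using gap_ge[OF good, of u y] assms by (intro mult_left_mono) auto
    finally show ?thesis .
  qed
  have 2: "exp (- (14 * B)) / 8 * gap q p y \<le> exp (- (7 * B)) / 4 * gap q p u"
  proof -
    have "exp (- (14 * B)) / 8 * gap q p y \<le> exp (- (14 * B)) / 8 * (2 * exp (3 * B) * gap q p u)"
      using gap_le[OF assms] by (intro mult_left_mono) auto
    also have "\<dots> = exp (- (11 * B)) / 4 * gap q p u" by (simp flip: exp_add)
    also have "\<dots> \<le> exp (- (7 * B)) / 4 * gap q p u"
      using m B_pos by (intro mult_right_mono) auto
    finally show ?thesis .
  qed
  have 3: "0 < exp (- (7 * B)) / 4 * gap q p u" using m by simp
  show ?thesis using 1 2 3 assms by (auto simp: orbit_box_def curve_def)
qed

lemma curve_dist: "cmod (curve x - of_real x) = exp (- (14 * B)) / 8 * gap q p x"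
proof -
  have "curve x - of_real x = Complex 0 (- (exp (- (14 * B)) / 8 * gap q p x))"
    by (simp add: curve_def complex_eq_iff)
  then show ?thesis using gap_pos[OF good, of x] by (simp add: complex_norm)
qed

lemma orbit_in_box:
  assumes "j \<le> q + q'" "(F ^^ j) x + of_int k \<in> {u..u + gap q p u}"
  shows "(\<Phi> ^^ j) (curve x) + of_int k \<in> orbit_box u"
proof -
  define z where "z = (F ^^ j) x + of_int k"
  define w where "w = (\<Phi> ^^ j) (curve x) + of_int k"
  have m: "0 < gap q p u" by (rule gap_pos[OF good])
  have gz: "gap q p ((F ^^ j) x) = gap q p z" by (simp add: z_def gap_add_int[OF good])
  have e: "exp (- (14 * B)) / 8 \<le> exp (- (4 * B))"
    by (rule order_trans[of _ "exp (- (14 * B))"]) (use B_pos in auto)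
  have c: "cmod (curve x - of_real x) \<le> exp (- (4 * B)) * gap q p x"
    unfolding curve_dist using e gap_pos[OF good, of x] by (intro mult_right_mono) auto
  have "cmod (w - of_real z) \<le> exp (- (14 * B)) / 8 * exp (4 * B) * gap q p z"
    using orbit_dist[OF eq_refl[OF curve_dist] _ _ assms(1), of x] e
    by (simp add: gz w_def z_def)
  also have "\<dots> \<le> exp (- (14 * B)) / 8 * exp (4 * B) * (2 * exp (3 * B) * gap q p u)"
    using gap_le[of z u] assms(2) by (intro mult_left_mono) (auto simp: z_def)
  also have "\<dots> = exp (- (7 * B)) / 4 * gap q p u" by (simp flip: exp_add)
  finally have d: "\<bar>Re w - z\<bar> \<le> exp (- (7 * B)) / 4 * gap q p u" "\<bar>Im w\<bar> \<le> exp (- (7 * B)) / 4 * gap q p u"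
    using abs_Re_le_cmod[of "w - of_real z"] abs_Im_le_cmod[of "w - of_real z"] by auto
  have "exp (- (25 * B)) / 8 * gap q p u = exp (- (14 * B)) / 8 * exp (- (8 * B)) * (exp (- (3 * B)) * gap q p u)"
    by (simp flip: exp_add)
  also have "\<dots> \<le> exp (- (14 * B)) / 8 * exp (- (8 * B)) * gap q p z"
    using gap_ge[OF good, of u z] assms(2) by (intro mult_left_mono) (auto simp: z_def)
  also have "\<dots> \<le> - Im w"
    using orbit_height[OF c _ _ assms(1), of "exp (- (14 * B)) / 8"] by (simp add: gz w_def curve_def)
  finally have h: "exp (- (25 * B)) / 8 * gap q p u \<le> - Im w" .
  have "u \<le> z" "z \<le> u + gap q p u" using assms(2) by (simp_all add: z_def)
  then have "w \<in> orbit_box u" using d h unfolding orbit_box_def mem_Collect_eq by (intro conjI) linarith+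
  then show ?thesis by (simp only: w_def)
qed

text \<open>Replacing the starting point by its image changes an orbit sum only by comparing the two
  ends of the orbit, and \<open>F\<^bsup>q + q'\<^esup>\<close> returns to the box it started from.\<close>

lemma orbit_sums_close:
  fixes \<Psi> :: "complex \<Rightarrow> complex"
  assumes per: "\<And>w k. \<Psi> (w + of_int k) = \<Psi> w"
    and osc: "\<And>u w w' j. w \<in> orbit_box u \<Longrightarrow> w' \<in> orbit_box u \<Longrightarrow> j < q + q' \<Longrightarrow>
      cmod (\<Psi> ((\<Phi> ^^ j) w) - \<Psi> ((\<Phi> ^^ j) w')) \<le> \<epsilon>"
  shows "cmod ((\<Sum>j<q + q'. \<Psi> ((\<Phi> ^^ j) (curve y))) - (\<Sum>j<q + q'. \<Psi> ((\<Phi> ^^ j) (curve x)))) \<le>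
    2 * \<epsilon> * real (q + q')"
proof -
  define N where "N = q + q'"
  define S where "S = (\<lambda>w. \<Sum>j<N. \<Psi> ((\<Phi> ^^ j) w))"
  have "curve 0 \<in> orbit_box 0" using gap_pos[OF good, of 0] by (intro curve_in_box) auto
  then have \<epsilon>: "0 \<le> \<epsilon>" using osc[of _ 0 _ 0] good_facts(1)[OF good] norm_ge_zero order_trans
    by (metis add_gr_0 less_le_trans zero_less_one)
  have x_in_box: "curve x \<in> orbit_box x" using gap_pos[OF good, of x] by (intro curve_in_box) auto
  \<comment> \<open>After \<open>q + q'\<close> steps the orbit is back in the arc of
    \<open>x\<close>: the mediant of the convergents is still below \<rho>, and the
    \<open>q'\<close> steps move backwards.\<close>
  have "x < (F ^^ N) x - of_int (p + p')" unfolding N_def by (rule sum_gt[OF good])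
  moreover have "(F ^^ N) x - of_int (p + p') \<le> x + gap q p x"
  proof -
    have "(F ^^ q) ((F ^^ q') x - of_int p') < (F ^^ q) x" using back_lt[OF good, of x] by simp
    then show ?thesis by (simp add: N_def funpow_add iter_diff_int gap_def)
  qed
  ultimately have ret: "(\<Phi> ^^ N) (curve x) + of_int (- (p + p')) \<in> orbit_box x"
    by (intro orbit_in_box) (auto simp: N_def)
  have step: "cmod (S ((\<Phi> ^^ Suc i) (curve x)) - S ((\<Phi> ^^ i) (curve x))) \<le> \<epsilon>" if "i < N" for i
  proof -
    define w where "w = (\<Phi> ^^ i) (curve x)"
    have "S (\<Phi> w) = (\<Sum>j<N. \<Psi> ((\<Phi> ^^ (j + 1)) w))" unfolding S_def by (simp add: funpow_swap1)
    also have "\<dots> = S w + \<Psi> ((\<Phi> ^^ N) w) - \<Psi> w"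
      using sum_shift[of "\<lambda>j. \<Psi> ((\<Phi> ^^ j) w)" 1 N] by (simp add: S_def)
    finally have "S (\<Phi> w) - S w = \<Psi> ((\<Phi> ^^ N) w) - \<Psi> w" by simp
    also have "(\<Phi> ^^ N) w = (\<Phi> ^^ i) ((\<Phi> ^^ N) (curve x))"
      unfolding w_def by (metis add.commute comp_apply funpow_add)
    also have "\<Psi> \<dots> = \<Psi> ((\<Phi> ^^ i) ((\<Phi> ^^ N) (curve x) + of_int (- (p + p'))))"
      by (simp only: \<Phi>_iter_add_int per)
    finally show ?thesis using osc[OF ret x_in_box, of i] that by (simp add: w_def N_def)
  qed
  have shift: "cmod (S ((\<Phi> ^^ i) (curve x)) - S (curve x)) \<le> of_nat i * \<epsilon>" if "i \<le> N" for i
    using that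
  proof (induction i)
    case (Suc i)
    have "S ((\<Phi> ^^ Suc i) (curve x)) - S (curve x) =
      (S ((\<Phi> ^^ Suc i) (curve x)) - S ((\<Phi> ^^ i) (curve x))) + (S ((\<Phi> ^^ i) (curve x)) - S (curve x))" by simp
    then have "cmod (S ((\<Phi> ^^ Suc i) (curve x)) - S (curve x)) \<le>
       cmod (S ((\<Phi> ^^ Suc i) (curve x)) - S ((\<Phi> ^^ i) (curve x))) + cmod (S ((\<Phi> ^^ i) (curve x)) - S (curve x))"
      by (metis norm_triangle_ineq)
    also have "\<dots> \<le> \<epsilon> + of_nat i * \<epsilon>" using Suc step[of i] by (intro add_mono) auto
    finally show ?case by (simp add: algebra_simps)
  qed simp
  \<comment> \<open>The segment is slid along the orbit of \<open>curve x\<close> until it starts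
    over the arc containing \<open>y\<close>, at cost \<epsilon> per step; the comparison with the
    orbit of \<open>curve y\<close> then costs \<epsilon> per term.\<close>
  obtain i k where ik: "i < N" "(F ^^ i) x + of_int k \<le> y"
      "y \<le> (F ^^ i) x + of_int k + gap q p ((F ^^ i) x + of_int k)"
    using arc_cover[OF good] unfolding N_def by blast
  define u where "u = (F ^^ i) x + of_int k"
  have 1: "curve y \<in> orbit_box u" using ik by (intro curve_in_box) (auto simp: u_def)
  have 2: "(\<Phi> ^^ i) (curve x) + of_int k \<in> orbit_box u"
    using ik gap_pos[OF good, of u] by (intro orbit_in_box) (auto simp: u_def N_def)
  have "S (curve y) - S ((\<Phi> ^^ i) (curve x)) =
     (\<Sum>j<N. \<Psi> ((\<Phi> ^^ j) (curve y)) - \<Psi> ((\<Phi> ^^ j) ((\<Phi> ^^ i) (curve x) + of_int k)))"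
    by (simp add: S_def \<Phi>_iter_add_int per sum_subtractf)
  also have "cmod \<dots> \<le> (\<Sum>j<N. \<epsilon>)" by (intro sum_norm_le osc[OF 1 2]) (auto simp: N_def)
  finally have "cmod (S (curve y) - S ((\<Phi> ^^ i) (curve x))) \<le> of_nat N * \<epsilon>" by simp
  moreover have "cmod (S ((\<Phi> ^^ i) (curve x)) - S (curve x)) \<le> of_nat N * \<epsilon>"
    using shift[of i] ik(1) \<epsilon> by (meson less_imp_le mult_right_mono of_nat_le_iff order_trans)
  ultimately have "cmod (S (curve y) - S (curve x)) \<le> of_nat N * \<epsilon> + of_nat N * \<epsilon>"
    by (rule norm_diff_triangle_le)
  then show ?thesis by (simp add: S_def N_def algebra_simps)
qed

end

end

section \<open>Analytic circle maps and their lifts\<close>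

definition circle_exp :: "complex \<Rightarrow> complex" where
  "circle_exp w = exp (2 * of_real pi * \<i> * w)"

lemma cmod_circle_exp: "cmod (circle_exp w) = exp (- (2 * pi * Im w))"
  by (simp add: circle_exp_def)

lemma circle_exp_of_real: "circle_exp (of_real x) = cis (2 * pi * x)"
  by (simp add: circle_exp_def cis_conv_exp mult_ac)

lemma circle_exp_eq_iff: "circle_exp w = circle_exp z \<longleftrightarrow> (\<exists>k::int. w = z + of_int k)"
proof -
  have "circle_exp w = circle_exp z \<longleftrightarrow>
      (\<exists>k::int. 2 * of_real pi * \<i> * w = 2 * of_real pi * \<i> * z + of_int (2 * k) * pi * \<i>)"
    by (simp add: circle_exp_def exp_eq)
  also have "\<dots> \<longleftrightarrow> (\<exists>k::int. 2 * of_real pi * \<i> * w = 2 * of_real pi * \<i> * (z + of_int k))"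
    by (simp add: algebra_simps)
  also have "\<dots> \<longleftrightarrow> (\<exists>k::int. w = z + of_int k)" by simp
  finally show ?thesis .
qed

lemma circle_exp_add_int [simp]: "circle_exp (w + of_int k) = circle_exp w"
  using circle_exp_eq_iff by blast

lemma circle_exp_holomorphic [holomorphic_intros]:
  "f holomorphic_on A \<Longrightarrow> (\<lambda>w. circle_exp (f w)) holomorphic_on A"
  unfolding circle_exp_def by (intro holomorphic_intros)

lemma circle_exp_deriv:
  "(circle_exp has_field_derivative 2 * of_real pi * \<i> * circle_exp w) (at w)"
  unfolding circle_exp_def by (auto intro!: derivative_eq_intros)

lemma continuous_integer_valued_constant:
  fixes f :: "'a::topological_space \<Rightarrow> complex"
  assumes "connected S" "continuous_on S f" "\<And>x. x \<in> S \<Longrightarrow> \<exists>k::int. f x = of_int k" "a \<in> S" "x \<in> S"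
  shows "f x = f a"
proof -
  have "f constant_on S"
  proof (rule continuous_discrete_range_constant[OF assms(1,2)])
    fix x assume x: "x \<in> S"
    have "1 \<le> cmod (f y - f x)" if y: "y \<in> S" "f y \<noteq> f x" for y
    proof -
      obtain k l :: int where "f x = of_int k" "f y = of_int l" using assms(3)[OF x] assms(3)[OF y(1)] by blast
      then have eq: "f y - f x = of_int (l - k)" "l - k \<noteq> 0" using y by auto
      have "1 \<le> \<bar>l - k\<bar>" using eq(2) by linarith
      then show ?thesis unfolding eq(1) norm_of_int by linarith
    qed
    then show "\<exists>e>0. \<forall>y. y \<in> S \<and> f y \<noteq> f x \<longrightarrow> e \<le> cmod (f y - f x)"
      by (intro exI[of _ 1]) auto
  qed
  then show ?thesis using assms(4,5) by (metis constant_on_def)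
qed

text \<open>The strip is convex and \<open>g\<close> has no zeros near the circle, so a logarithm
  exists; its ambiguity is an integer, constant by continuity, and is removed by comparison with
  \<open>F\<close> on the real axis.\<close>

lemma holomorphic_circle_lift:
  assumes "g analytic_on unit_circle" and lift: "increasing_circle_lift g F"
  obtains \<Phi> \<eta> where "0 < \<eta>" "\<Phi> holomorphic_on {w. \<bar>Im w\<bar> < \<eta>}"
    "\<And>w. \<bar>Im w\<bar> < \<eta> \<Longrightarrow> circle_exp (\<Phi> w) = g (circle_exp w)"
    "\<And>w. \<Phi> (w + 1) = \<Phi> w + 1" "\<And>x. \<Phi> (of_real x) = of_real (F x)"
proof -
  obtain V where V: "open V" "unit_circle \<subseteq> V" "g holomorphic_on V"
    using assms(1) analytic_on_holomorphic by metis
  have F: "continuous_on UNIV F" "\<And>x. F (x + 1) = F x + 1" "\<And>x. g (cis (2 * pi * x)) = cis (2 * pi * F x)"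
    using lift by (auto simp: increasing_circle_lift_def)
  have circ: "circle_exp (of_real x) \<in> unit_circle" for x by (simp add: circle_exp_of_real)
  have g_circ: "g \<zeta> \<noteq> 0" if "\<zeta> \<in> unit_circle" for \<zeta>
  proof -
    have "cis (Arg2pi \<zeta>) = \<zeta>"
      using complex_norm_eq_1_exp[of \<zeta>] that by (simp add: cis_conv_exp)
    then have "g \<zeta> = cis (2 * pi * F (Arg2pi \<zeta> / (2 * pi)))"
      using F(3)[of "Arg2pi \<zeta> / (2 * pi)"] by simp
    then show ?thesis by simp
  qed
  define V' where "V' = V \<inter> g -` (- {0})"
  have "open V'" unfolding V'_def
    using V holomorphic_on_imp_continuous_on by (intro continuous_open_preimage) auto
  moreover have "unit_circle \<subseteq> V'" using V g_circ by (auto simp: V'_def)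
  ultimately obtain d where d: "0 < d" "(\<Union>x\<in>unit_circle. ball x d) \<subseteq> V'"
    using compact_subset_open_imp_ball_epsilon_subset[of unit_circle V'] by auto
  have "isCont (\<lambda>t. exp (- (2 * pi * t))) (0::real)" by (intro continuous_intros)
  then obtain \<eta> where \<eta>: "0 < \<eta>" "\<And>t. \<bar>t\<bar> < \<eta> \<Longrightarrow> \<bar>exp (- (2 * pi * t)) - 1\<bar> < d"
    using d(1) unfolding continuous_at_eps_delta by (auto simp: dist_real_def)
  define S where "S = {w. \<bar>Im w\<bar> < \<eta>}"
  have S_eq: "S = {w. Im w < \<eta>} \<inter> {w. - \<eta> < Im w}" by (auto simp: S_def)
  have S: "open S" "convex S"
    unfolding S_eq by (auto intro!: open_Int convex_Int open_halfspace_Im_lt open_halfspace_Im_gt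
        convex_halfspace_Im_lt convex_halfspace_Im_gt)
  have S_real: "of_real x \<in> S" for x using \<eta> by (simp add: S_def)
  have in_V: "circle_exp w \<in> V'" if "w \<in> S" for w
  proof -
    have w: "w = of_real (Re w) + \<i> * of_real (Im w)" by (rule complex_eq)
    have "2 * of_real pi * \<i> * w = 2 * of_real pi * \<i> * of_real (Re w) + of_real (- (2 * pi * Im w))"
      by (subst w) (simp add: algebra_simps)
    then have "circle_exp w = circle_exp (of_real (Re w)) * of_real (exp (- (2 * pi * Im w)))"
      by (simp only: circle_exp_def exp_add) (simp only: exp_of_real)
    then have "circle_exp w - circle_exp (of_real (Re w)) =
        circle_exp (of_real (Re w)) * of_real (exp (- (2 * pi * Im w)) - 1)" by (simp add: algebra_simps)
    then have "cmod (circle_exp w - circle_exp (of_real (Re w))) = \<bar>exp (- (2 * pi * Im w)) - 1\<bar>"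
      by (simp only: norm_mult norm_of_real) (simp add: cmod_circle_exp)
    also have "\<dots> < d" using \<eta>(2) that by (simp add: S_def)
    finally have "circle_exp w \<in> ball (circle_exp (of_real (Re w))) d"
      by (simp add: dist_norm norm_minus_commute)
    then show ?thesis using d(2) circ by blast
  qed
  have "(\<lambda>w. g (circle_exp w)) holomorphic_on S"
    by (rule holomorphic_on_compose_gen[of circle_exp S g V, unfolded o_def])
      (use in_V V in \<open>auto intro!: holomorphic_intros simp: V'_def\<close>)
  moreover have "g (circle_exp w) \<noteq> 0" if "w \<in> S" for w using in_V[OF that] by (auto simp: V'_def)
  ultimately obtain L where L: "L holomorphic_on S" "\<And>w. w \<in> S \<Longrightarrow> g (circle_exp w) = exp (L w)"
    using contractible_imp_holomorphic_log[of "\<lambda>w. g (circle_exp w)" S] convex_imp_contractible[OF S(2)] by metis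
  define L' where "L' = (\<lambda>w. L w / (2 * of_real pi * \<i>))"
  have L': "L' holomorphic_on S" "\<And>w. w \<in> S \<Longrightarrow> circle_exp (L' w) = g (circle_exp w)"
    unfolding L'_def by (intro holomorphic_intros L, simp) (simp add: circle_exp_def[of "_ / _"] L)
  have L'_cont: "continuous_on S L'" using L' holomorphic_on_imp_continuous_on by blast
  define c where "c = L' 0 - of_real (F 0)"
  have Lr: "circle_exp (L' (of_real x)) = circle_exp (of_real (F x))" for x
    using L'(2)[OF S_real] F(3) by (simp add: circle_exp_of_real)
  have c: "L' (of_real x) - of_real (F x) = c" for x
  proof -
    have "(\<lambda>x. L' (of_real x) - of_real (F x)) x = (\<lambda>x. L' (of_real x) - of_real (F x)) 0"
    proof (rule continuous_integer_valued_constant[where f = "\<lambda>x. L' (of_real x) - of_real (F x)"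
          and S = UNIV and a = 0 and x = x])
      show "continuous_on UNIV (\<lambda>x. L' (of_real x) - of_real (F x))"
        by (intro continuous_intros continuous_on_compose2[OF L'_cont] F(1)) (use S_real in auto)
      show "\<exists>k::int. L' (of_real x) - of_real (F x) = of_int k" for x
        using Lr[of x] unfolding circle_exp_eq_iff by (metis add_diff_cancel_left')
    qed auto
    then show ?thesis by (simp add: c_def)
  qed
  obtain m :: int where m: "c = of_int m"
    using Lr[of 0] unfolding circle_exp_eq_iff by (metis add_diff_cancel_left' c)
  \<comment> \<open>Outside the strip the identity serves as default value, so that commutation with
    the unit translation holds everywhere.\<close>
  define \<Phi> where "\<Phi> = (\<lambda>w. if w \<in> S then L' w - c else w)"
  have S1: "w + 1 \<in> S \<longleftrightarrow> w \<in> S" for w by (simp add: S_def)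
  have per: "L' (w + 1) = L' w + 1" if "w \<in> S" for w
  proof -
    have "(\<lambda>w. L' (w + 1) - L' w) w = (\<lambda>w. L' (w + 1) - L' w) 0"
    proof (rule continuous_integer_valued_constant[where f = "\<lambda>w. L' (w + 1) - L' w"
          and S = S and a = 0 and x = w])
      show "continuous_on S (\<lambda>w. L' (w + 1) - L' w)"
        by (intro continuous_intros continuous_on_compose2[OF L'_cont] L'_cont) (use S1 in auto)
      show "\<exists>k::int. L' (w + 1) - L' w = of_int k" if "w \<in> S" for w
      proof -
        have "circle_exp (L' (w + 1)) = circle_exp (L' w)"
          using that S1 circle_exp_add_int[of w 1] by (simp add: L')
        then show ?thesis unfolding circle_exp_eq_iff by (metis add_diff_cancel_left')
      qed
    qed (use S convex_connected S_real[of 0] that in auto)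
    also have "L' (0 + 1) - L' 0 = 1" using c[of 1] c[of 0] F(2)[of 0] by (simp add: algebra_simps)
    finally show ?thesis by (simp add: algebra_simps)
  qed
  have "\<Phi> (w + 1) = \<Phi> w + 1" for w by (simp add: \<Phi>_def S1 per)
  moreover have "\<Phi> holomorphic_on S"
    using holomorphic_on_diff[OF L'(1) holomorphic_on_const[of c]] by (rule holomorphic_transform) (simp add: \<Phi>_def)
  moreover have "circle_exp (\<Phi> w) = g (circle_exp w)" if "w \<in> S" for w
    using L'(2)[OF that] that circle_exp_add_int[of "L' w" "- m"] by (simp add: \<Phi>_def m)
  moreover have "\<Phi> (of_real x) = of_real (F x)" for x using c[of x] S_real by (simp add: \<Phi>_def algebra_simps)
  ultimately show ?thesis using that[of \<eta> \<Phi>] \<eta>(1) by (simp add: S_def)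
qed

text \<open>A strictly increasing function may have critical points; here the differentiable inverse
  \<open>H\<close> excludes them by the chain rule, and monotonicity excludes a negative
  derivative.\<close>

lemma increasing_circle_lift_deriv_pos:
  assumes diffeo: "analytic_circle_diffeo g" and lift: "increasing_circle_lift g F"
    and F': "(F has_real_derivative d) (at x)"
  shows "0 < d"
proof -
  have F: "strict_mono F" "\<And>x. g (cis (2 * pi * x)) = cis (2 * pi * F x)"
    using lift by (auto simp: increasing_circle_lift_def)
  have inj: "inj_on g unit_circle" using diffeo by (auto simp: analytic_circle_diffeo_def bij_betw_def)
  obtain H where H: "H analytic_on unit_circle" "\<And>\<zeta>. \<zeta> \<in> unit_circle \<Longrightarrow> H \<zeta> = inv_into unit_circle g \<zeta>"
    using diffeo by (auto simp: analytic_circle_diffeo_def)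
  have "H (circle_exp (of_real (F t))) = circle_exp (of_real t)" for t
  proof -
    have "circle_exp (of_real (F t)) = g (circle_exp (of_real t))" by (simp add: circle_exp_of_real F)
    moreover have "circle_exp (of_real (F t)) \<in> unit_circle" "circle_exp (of_real t) \<in> unit_circle"
      by (simp_all add: circle_exp_of_real)
    ultimately show ?thesis using H(2) inj by (simp add: inv_into_f_f)
  qed
  note HF = this
  define y where "y = circle_exp (of_real (F x))"
  have "H field_differentiable at y"
    using H(1) by (rule analytic_on_imp_differentiable_at) (simp add: y_def circle_exp_of_real)
  then have dH: "(H has_field_derivative deriv H y) (at y)" by (simp add: field_differentiable_derivI)
  have "((\<lambda>w. H (circle_exp w)) has_field_derivative deriv H y * (2 * of_real pi * \<i> * y)) (at (of_real (F x)))"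
    using DERIV_chain2[OF dH[unfolded y_def] circle_exp_deriv] by (simp add: y_def)
  from has_vector_derivative_real_field[OF this]
  have "((\<lambda>t. H (circle_exp (of_real t))) has_vector_derivative deriv H y * (2 * of_real pi * \<i> * y)) (at (F x))" .
  moreover have "(F has_vector_derivative d) (at x)"
    using F' by (simp add: has_real_derivative_iff_has_vector_derivative)
  ultimately have "((\<lambda>t. H (circle_exp (of_real (F t)))) has_vector_derivative
      d *\<^sub>R (deriv H y * (2 * of_real pi * \<i> * y))) (at x)"
    using vector_diff_chain_at[of F d x] by (fastforce simp: o_def)
  then have "((\<lambda>t. circle_exp (of_real t)) has_vector_derivative
      d *\<^sub>R (deriv H y * (2 * of_real pi * \<i> * y))) (at x)"
    by (simp only: HF)
  moreover have "((\<lambda>t. circle_exp (of_real t)) has_vector_derivative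
      2 * of_real pi * \<i> * circle_exp (of_real x)) (at x)"
    by (intro has_vector_derivative_real_field circle_exp_deriv)
  ultimately have "d *\<^sub>R (deriv H y * (2 * of_real pi * \<i> * y)) = 2 * of_real pi * \<i> * circle_exp (of_real x)"
    by (rule vector_derivative_unique_at)
  moreover have "2 * of_real pi * \<i> * circle_exp (of_real x) \<noteq> 0" by (simp add: circle_exp_of_real)
  ultimately have "d \<noteq> 0" by (metis scaleR_zero_left)
  moreover have "0 \<le> d"
  proof (rule ccontr)
    assume "\<not> 0 \<le> d"
    then obtain e where e: "0 < e" "\<And>h. 0 < h \<Longrightarrow> h < e \<Longrightarrow> F (x + h) < F x"
      using DERIV_neg_dec_right[OF F'] by auto
    then have "F (x + e / 2) < F x" by simp
    moreover have "F x < F (x + e / 2)" using F(1) e(1) by (simp add: strict_mono_less)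
    ultimately show False by simp
  qed
  ultimately show ?thesis by simp
qed

text \<open>The difference of \<Phi> and the identity is 1-periodic, hence bounded on a closed strip
  by compactness; Cauchy's estimate for its second derivative and Taylor's formula then give all the
  required inequalities.\<close>

lemma analytic_lift_exists:
  assumes an: "g analytic_on unit_circle" and diffeo: "analytic_circle_diffeo g"
    and lift: "increasing_circle_lift g F"
    and rot: "\<And>x. (\<lambda>n. ((F ^^ n) x - x) / real n) \<longlonglongrightarrow> \<rho>" and "\<rho> \<notin> \<rat>"
  obtains D B \<Phi> \<eta> where "analytic_lift F D \<rho> B \<Phi> \<eta>" "\<Phi> holomorphic_on {w. \<bar>Im w\<bar> < \<eta>}"
    "\<And>w. \<bar>Im w\<bar> < \<eta> \<Longrightarrow> circle_exp (\<Phi> w) = g (circle_exp w)"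
proof -
  obtain \<Phi> \<eta> where \<Phi>: "0 < \<eta>" "\<Phi> holomorphic_on {w. \<bar>Im w\<bar> < \<eta>}"
    "\<And>w. \<bar>Im w\<bar> < \<eta> \<Longrightarrow> circle_exp (\<Phi> w) = g (circle_exp w)"
    "\<And>w. \<Phi> (w + 1) = \<Phi> w + 1" "\<And>x. \<Phi> (of_real x) = of_real (F x)"
    by (rule holomorphic_circle_lift[OF an lift], rule that)
  have F: "strict_mono F" "\<And>x. F (x + 1) = F x + 1" using lift by (auto simp: increasing_circle_lift_def)
  define S where "S = {w. \<bar>Im w\<bar> < \<eta>}"
  have "S = {w. Im w < \<eta>} \<inter> {w. - \<eta> < Im w}" by (auto simp: S_def)
  then have S: "open S" by (auto intro!: open_Int open_halfspace_Im_lt open_halfspace_Im_gt)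
  define f where "f = (\<lambda>w. \<Phi> w - w)"
  have f: "f holomorphic_on S" unfolding f_def S_def by (intro holomorphic_intros \<Phi>)
  have f_int: "f (w + of_int k) = f w" for w k
    using step1_add_int[of \<Phi>, OF \<Phi>(4)] by (simp add: f_def)
  define r where "r = \<eta> / 4"
  have r: "0 < r" using \<Phi>(1) by (simp add: r_def)
  define Q where "Q = cbox (Complex 0 (- (2 * r))) (Complex 1 (2 * r))"
  have "Q \<subseteq> S" using r \<Phi>(1) by (auto simp: Q_def S_def in_cbox_complex_iff r_def)
  then have "continuous_on Q f" using f holomorphic_on_imp_continuous_on continuous_on_subset by blast
  then have "bounded (f ` Q)" unfolding Q_def by (intro compact_imp_bounded compact_continuous_image) auto
  then obtain M where M: "\<And>w. w \<in> Q \<Longrightarrow> cmod (f w) < M" unfolding bounded_pos_less by blast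
  have f_bound: "cmod (f w) < M" if "\<bar>Im w\<bar> \<le> 2 * r" for w
  proof -
    have "w + of_int (- \<lfloor>Re w\<rfloor>) \<in> Q"
      using that unfolding Q_def in_cbox_complex_iff by (simp add: of_int_floor_le) linarith
    from M[OF this] show ?thesis by (simp only: f_int)
  qed
  have "0 < M" using f_bound[of 0] r norm_ge_zero by (smt (verit) zero_complex.sel(2))
  define C where "C = {w. \<bar>Im w\<bar> \<le> r}"
  have "C = {w. Im w \<le> r} \<inter> {w. - r \<le> Im w}" by (auto simp: C_def)
  then have C: "convex C"
    by (auto intro!: convex_Int convex_halfspace_Im_le convex_halfspace_Im_ge)
  have CS: "w \<in> S" if "w \<in> C" for w using that r \<Phi>(1) by (auto simp: C_def S_def r_def)
  have C_real: "of_real x \<in> C" for x using r by (simp add: C_def)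
  define M2 where "M2 = 2 * M / r\<^sup>2"
  have M2: "0 < M2" using \<open>0 < M\<close> r by (simp add: M2_def)
  have f2: "cmod ((deriv ^^ 2) f w) \<le> M2" if "w \<in> C" for w
  proof -
    have b: "\<bar>Im v\<bar> \<le> 2 * r" if "v \<in> cball w r" for v
      using that \<open>w \<in> C\<close> abs_Im_le_cmod[of "w - v"] by (auto simp: C_def dist_norm)
    have "cball w r \<subseteq> S" using b \<Phi>(1) by (fastforce simp: S_def r_def)
    then have "f holomorphic_on cball w r" using f holomorphic_on_subset by blast
    then have "cmod ((deriv ^^ 2) f w) \<le> fact 2 * M / r ^ 2"
      using b f_bound r
      by (intro Cauchy_higher_deriv_bound[where y = 0])
        (auto intro: holomorphic_on_subset holomorphic_on_imp_continuous_on)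
    then show ?thesis by (simp add: M2_def)
  qed
  have der: "((deriv ^^ i) f has_field_derivative (deriv ^^ Suc i) f w) (at w)" if "w \<in> C" for i w
    using holomorphic_derivI[OF holomorphic_higher_deriv[OF f S] S CS[OF that]] by simp
  define d where "d = (\<lambda>x. deriv f (of_real x))"
  have taylor: "cmod (f w - (f (of_real x) + d x * (w - of_real x))) \<le> M2 * (cmod (w - of_real x))\<^sup>2"
    if "w \<in> C" for w x
  proof -
    have "cmod ((deriv ^^ 0) f w - (\<Sum>i\<le>1. (deriv ^^ i) f (of_real x) * (w - of_real x) ^ i / fact i)) \<le>
      M2 * cmod (w - of_real x) ^ Suc 1 / fact 1"
    proof (rule complex_Taylor[OF C _ _ C_real that])
      show "((deriv ^^ i) f has_field_derivative (deriv ^^ Suc i) f v) (at v within C)" if "v \<in> C" for i v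
        by (rule has_field_derivative_at_within[OF der[OF that]])
      show "cmod ((deriv ^^ Suc 1) f v) \<le> M2" if "v \<in> C" for v
        using f2[OF that] by (simp add: numeral_2_eq_2)
    qed
    then show ?thesis by (simp add: d_def numeral_2_eq_2)
  qed
  have "((\<lambda>t. f (of_real t)) has_vector_derivative d x) (at x)" for x
    unfolding d_def using der[OF C_real, of 0] by (intro has_vector_derivative_real_field) simp
  then have dF: "((\<lambda>t. complex_of_real (F t - t)) has_vector_derivative d x) (at x)" for x
    by (simp add: f_def \<Phi>(5))
  have "((\<lambda>t. Im (complex_of_real (F t - t))) has_vector_derivative Im (d x)) (at x)" for x
    by (rule bounded_linear.has_vector_derivative[OF bounded_linear_Im dF])
  then have Im_d: "Im (d x) = 0" for x
    using vector_derivative_unique_at[of "\<lambda>_. 0" "Im (d x)" x 0] by simp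
  have "((\<lambda>t. Re (complex_of_real (F t - t))) has_vector_derivative Re (d x)) (at x)" for x
    by (rule bounded_linear.has_vector_derivative[OF bounded_linear_Re dF])
  then have "((\<lambda>t. F t - t) has_real_derivative Re (d x)) (at x)" for x
    by (simp add: has_real_derivative_iff_has_vector_derivative)
  from DERIV_add[OF this DERIV_ident] have F': "(F has_real_derivative Re (d x) + 1) (at x)" for x by simp
  define D where "D = (\<lambda>x. Re (d x) + 1)"
  have F'': "(F has_real_derivative D x) (at x)" for x using F' by (simp add: D_def)
  have D_eq: "d x = of_real (D x) - 1" for x using Im_d[of x] by (simp add: D_def complex_eq_iff)
  have D_pos: "0 < D x" for x
    using increasing_circle_lift_deriv_pos[OF diffeo lift F'] by (simp add: D_def)
  have *: "cmod (d x - d y) \<le> M2 * cmod (of_real x - of_real y)" for x y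
    unfolding d_def
  proof (rule field_differentiable_bound[OF C _ _ C_real C_real])
    show "(deriv f has_field_derivative (deriv ^^ 2) f w) (at w within C)" if "w \<in> C" for w
      using der[OF that, of 1] by (simp add: numeral_2_eq_2 has_field_derivative_at_within)
  qed (rule f2)
  have D_lip: "\<bar>D x - D y\<bar> \<le> M2 * \<bar>x - y\<bar>" for x y
  proof -
    have "d x - d y = of_real (D x - D y)" by (simp add: D_eq)
    with * [of x y] show ?thesis by (simp only: norm_of_real flip: of_real_diff)
  qed
  have "continuous_on UNIV D"
    by (rule lipschitz_on_continuous_on[of M2], rule lipschitz_onI)
      (use D_lip M2 in \<open>auto simp: dist_real_def\<close>)
  then have "continuous_on {0..1} D" using continuous_on_subset by blast
  then have "\<exists>x0\<in>{0..1}. \<forall>y\<in>{0..1}. D x0 \<le> D y" by (intro continuous_attains_inf) auto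
  then obtain x0 where x0: "\<forall>y\<in>{0..1}. D x0 \<le> D y" by blast
  define \<kappa> where "\<kappa> = D x0"
  have \<kappa>: "0 < \<kappa>" by (simp add: \<kappa>_def D_pos)
  have D_int: "D (x + of_int k) = D x" for x k
  proof -
    have "((\<lambda>z. F (z + of_int k)) has_real_derivative D (x + of_int k)) (at x)"
      by (rule DERIV_chain2[OF F'', THEN DERIV_cong]) (auto intro!: derivative_eq_intros)
    moreover have "((\<lambda>z. F z + of_int k) has_real_derivative D x) (at x)"
      using DERIV_add[OF F'' DERIV_const] by simp
    ultimately show ?thesis unfolding step1_add_int[of F, OF F(2)] using DERIV_unique by metis
  qed
  have D_ge: "\<kappa> \<le> D x" for x
  proof -
    have "\<kappa> \<le> D (x + of_int (- \<lfloor>x\<rfloor>))" unfolding \<kappa>_def by (rule x0[rule_format]) (simp, linarith)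
    then show ?thesis by (simp only: D_int)
  qed
  \<comment> \<open>Division by the minimum \<kappa> of \<open>D\<close> turns the additive Taylor
    error into one relative to \<open>D x\<close>, with the same constant for distances, heights and
    \<open>ln D\<close>.\<close>
  define B where "B = M2 / \<kappa>"
  have B: "0 < B" using M2 \<kappa> by (simp add: B_def)
  have M2_le: "M2 \<le> D x * B" for x
    using D_ge[of x] \<kappa> M2 by (simp add: B_def field_simps)
  define \<eta>' where "\<eta>' = min r (1 / (2 * B))"
  have \<eta>': "0 < \<eta>'" "\<eta>' \<le> r" "B * \<eta>' \<le> 1 / 2"
    using r B by (auto simp: \<eta>'_def min_def field_simps)
  have \<Phi>_taylor: "cmod (\<Phi> w - (of_real (F x) + of_real (D x) * (w - of_real x))) \<le>
      D x * B * (cmod (w - of_real x))\<^sup>2" if "w \<in> C" for w x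
  proof -
    have eq: "\<Phi> w - (of_real (F x) + of_real (D x) * (w - of_real x)) =
      f w - (f (of_real x) + d x * (w - of_real x))"
      by (simp add: f_def \<Phi>(5) D_eq algebra_simps)
    have "cmod (\<Phi> w - (of_real (F x) + of_real (D x) * (w - of_real x))) \<le> M2 * (cmod (w - of_real x))\<^sup>2"
      unfolding eq by (rule taylor[OF that])
    also have "\<dots> \<le> D x * B * (cmod (w - of_real x))\<^sup>2" by (intro mult_right_mono M2_le) auto
    finally show ?thesis .
  qed
  have "analytic_lift F D \<rho> B \<Phi> \<eta>'"
  proof unfold_locales
    show "(F has_real_derivative D x) (at x)" for x by (rule F'')
    have "ln (D x) - ln (D y) \<le> B * \<bar>x - y\<bar>" for x y
    proof -
      have "ln (D x) - ln (D y) = ln (D x / D y)" using D_pos[of x] D_pos[of y] by (simp add: ln_div)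
      also have "\<dots> \<le> D x / D y - 1" using D_pos by (intro ln_le_minus_one) simp
      also have "\<dots> = (D x - D y) / D y" using D_pos[of y] by (simp add: diff_divide_distrib)
      also have "\<dots> \<le> (D y * B * \<bar>x - y\<bar>) / D y"
        using D_lip[of x y] M2_le[of y] D_pos[of y]
        by (intro divide_right_mono) (smt (verit) mult_right_mono abs_ge_zero, simp)
      finally show ?thesis using D_pos[of y] by simp
    qed
    note ln_le = this
    show "\<bar>ln (D x) - ln (D y)\<bar> \<le> B * \<bar>x - y\<bar>" for x y
      using ln_le[of x y] ln_le[of y x] by (simp add: abs_le_iff abs_minus_commute)
    show "cmod (\<Phi> w - of_real (F x)) \<le> D x * cmod (w - of_real x) * (1 + B * cmod (w - of_real x))"
      if "cmod (w - of_real x) \<le> \<eta>'" for w x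
    proof -
      have "w \<in> C" using that \<eta>' abs_Im_le_cmod[of "w - of_real x"] by (simp add: C_def)
      from \<Phi>_taylor[OF this] have "cmod (\<Phi> w - of_real (F x) - of_real (D x) * (w - of_real x)) \<le>
        D x * B * (cmod (w - of_real x))\<^sup>2" by (simp add: diff_diff_eq)
      then have "cmod (\<Phi> w - of_real (F x)) \<le> cmod (of_real (D x) * (w - of_real x)) +
        D x * B * (cmod (w - of_real x))\<^sup>2"
        using norm_triangle_sub[of "\<Phi> w - of_real (F x)" "of_real (D x) * (w - of_real x)"] by linarith
      moreover have "cmod (of_real (D x) * (w - of_real x)) = D x * cmod (w - of_real x)"
        using D_pos[of x] by (simp only: norm_mult norm_of_real abs_of_pos)
      ultimately show ?thesis by (simp add: power2_eq_square algebra_simps)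
    qed
    show "D x * y * (1 - B * y) \<le> - Im (\<Phi> (Complex x (- y)))" if "0 < y" "y \<le> \<eta>'" for x y
    proof -
      define w where "w = Complex x (- y)"
      have "w \<in> C" using that \<eta>' by (simp add: C_def w_def)
      have wx: "w - of_real x = Complex 0 (- y)" by (simp add: w_def complex_eq_iff)
      have "\<bar>Im (\<Phi> w - (of_real (F x) + of_real (D x) * (w - of_real x)))\<bar> \<le> D x * B * (cmod (w - of_real x))\<^sup>2"
        using \<Phi>_taylor[OF \<open>w \<in> C\<close>] abs_Im_le_cmod order_trans by blast
      then have "\<bar>Im (\<Phi> w) + D x * y\<bar> \<le> D x * B * y\<^sup>2"
        unfolding wx using that by (simp add: complex_norm)
      then show ?thesis by (simp add: w_def power2_eq_square algebra_simps)
    qed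
  qed (use F \<Phi> rot assms(5) D_pos B \<eta>' in auto)
  moreover have "\<eta>' < \<eta>" using \<eta>' \<Phi>(1) by (simp add: r_def)
  then have "{w. \<bar>Im w\<bar> < \<eta>'} \<subseteq> {w. \<bar>Im w\<bar> < \<eta>}" by auto
  then have "\<Phi> holomorphic_on {w. \<bar>Im w\<bar> < \<eta>'}" by (rule holomorphic_on_subset[OF \<Phi>(2)])
  moreover have "circle_exp (\<Phi> w) = g (circle_exp w)" if "\<bar>Im w\<bar> < \<eta>'" for w
    using that \<open>\<eta>' < \<eta>\<close> by (intro \<Phi>(3)) simp
  ultimately show ?thesis by (rule that)
qed

section \<open>Averages of holomorphic functions\<close>

text \<open>The assumption \<open>conj\<close> is the relation between \<open>f\<close> and the
  circle map in the lifted coordinate, demanded only at small positive heights, where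
  \<open>h\<close> is defined.\<close>

locale exterior_lift = analytic_lift +
  fixes h f :: "complex \<Rightarrow> complex" and K U :: "complex set" and \<tau> :: real
  assumes compact_K: "compact K" and zero_K: "0 \<in> K" and open_U: "open U" and K_U: "K \<subseteq> U"
    and f_hol: "f holomorphic_on U" and f_K: "f ` K \<subseteq> K" and f_0: "f 0 = 0"
    and h_map: "exterior_riemann_map K h"
    and \<Phi>_hol: "\<Phi> holomorphic_on {w. \<bar>Im w\<bar> < \<eta>}"
    and \<tau>_pos: "0 < \<tau>"
    and conj: "\<And>w. 0 < - Im w \<Longrightarrow> - Im w < \<tau> \<Longrightarrow>
      h (circle_exp w) \<in> U \<and> f (h (circle_exp w)) = h (circle_exp (\<Phi> w))"
begin

section \<open>The complement of \<open>K\<close> as a quotient of the lower half-plane by integer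
  translations\<close>

definition E :: "complex \<Rightarrow> complex" where
  "E w = h (circle_exp w)"

lemma h_hol: "h holomorphic_on disk_exterior" and h_bij: "bij_betw h disk_exterior (- K)"
  using h_map by (auto simp: exterior_riemann_map_def)

lemma circle_exp_exterior: "circle_exp w \<in> disk_exterior \<longleftrightarrow> 0 < - Im w"
  by (simp add: cmod_circle_exp mult_less_0_iff)

lemma E_notin: "0 < - Im w \<Longrightarrow> E w \<in> - K"
  using h_bij circle_exp_exterior[of w] by (auto simp: E_def bij_betw_def)

lemma E_hol: "E holomorphic_on {w. 0 < - Im w}"
  unfolding E_def
  by (rule holomorphic_on_compose_gen[of circle_exp _ h disk_exterior, unfolded o_def])
    (auto intro!: holomorphic_intros h_hol simp: cmod_circle_exp mult_less_0_iff)

lemma E_add_int: "E (w + of_int k) = E w"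
  by (simp add: E_def)

lemma circle_exp_surj: "\<zeta> \<noteq> 0 \<Longrightarrow> \<exists>w. \<zeta> = circle_exp w"
  by (rule exI[of _ "Ln \<zeta> / (2 * of_real pi * \<i>)"]) (simp add: circle_exp_def)

lemma E_surj: "z \<in> - K \<Longrightarrow> \<exists>w. 0 < - Im w \<and> z = E w"
proof -
  assume "z \<in> - K"
  then obtain \<zeta> where \<zeta>: "\<zeta> \<in> disk_exterior" "z = h \<zeta>" using h_bij by (auto simp: bij_betw_def)
  then have "\<zeta> \<noteq> 0" by auto
  then obtain w where w: "\<zeta> = circle_exp w" using circle_exp_surj by blast
  then show ?thesis using \<zeta> circle_exp_exterior[of w] by (intro exI[of _ w]) (auto simp: E_def)
qed

lemma E_eq_iff:
  assumes "0 < - Im w" "0 < - Im w'"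
  shows "E w = E w' \<longleftrightarrow> (\<exists>k::int. w = w' + of_int k)"
proof -
  have "E w = E w' \<longleftrightarrow> circle_exp w = circle_exp w'"
    unfolding E_def using h_bij assms circle_exp_exterior
    by (intro inj_on_eq_iff[of h disk_exterior]) (auto simp: bij_betw_def)
  then show ?thesis by (simp add: circle_exp_eq_iff)
qed

lemma h_at_infinity: "\<exists>R. 1 < R \<and> (\<forall>\<zeta>. R < cmod \<zeta> \<longrightarrow> b < cmod (h \<zeta>))"
proof -
  have "chart_at_infinity h analytic_on {0}" using h_map by (simp add: exterior_riemann_map_def)
  then have "isCont (chart_at_infinity h) 0" by (rule analytic_at_imp_isCont)
  then obtain d where d: "0 < d" "\<And>w. cmod w < d \<Longrightarrow> cmod (chart_at_infinity h w) < 1 / (\<bar>b\<bar> + 1)"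
    unfolding continuous_at_eps_delta
    by (auto simp: dist_norm chart_at_infinity_def[of h 0] dest!: spec[of _ "1 / (\<bar>b\<bar> + 1)"])
  show ?thesis
  proof (intro exI conjI allI impI)
    show "1 < max 2 (1 / d)" by simp
    fix \<zeta> :: complex assume \<zeta>: "max 2 (1 / d) < cmod \<zeta>"
    then have "\<zeta> \<noteq> 0" by auto
    have "1 < d * cmod \<zeta>" using \<zeta> d(1) by (simp add: divide_less_eq mult.commute)
    then have "cmod (1 / \<zeta>) < d" using \<open>\<zeta> \<noteq> 0\<close> by (simp add: norm_divide divide_less_eq)
    then have "cmod (1 / h \<zeta>) < 1 / (\<bar>b\<bar> + 1)"
      using d(2)[of "1 / \<zeta>"] \<open>\<zeta> \<noteq> 0\<close> by (simp add: chart_at_infinity_def)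
    moreover have "h \<zeta> \<in> - K" using h_bij \<zeta> by (auto simp: bij_betw_def)
    then have "h \<zeta> \<noteq> 0" using zero_K by auto
    ultimately have "\<bar>b\<bar> + 1 < cmod (h \<zeta>)" by (simp add: norm_divide field_simps)
    then show "b < cmod (h \<zeta>)" by linarith
  qed
qed

text \<open>Heights bounded below keep the points away from the circle, and \<open>h \<infinity> = \<infinity>\<close> keeps them bounded
  when their images are.\<close>

lemma closed_E_image:
  assumes "continuous_on UNIV (m :: real \<Rightarrow> real)" "\<And>x. m (x + 1) = m x" "\<And>x. 0 < m x"
  shows "closed (E ` {w. m (Re w) \<le> - Im w})"
proof -
  have m_int: "m (x + of_int k) = m x" for x k
    using step1_add_int[of "\<lambda>x. m x + x" x k] assms(2) by simp
  have "\<exists>w. m (Re w) \<le> - Im w \<and> z = E w"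
    if x: "\<And>n. x n \<in> E ` {w. m (Re w) \<le> - Im w}" and lim: "x \<longlonglongrightarrow> z" for x :: "nat \<Rightarrow> complex" and z
  proof -
    have "\<exists>w. m (Re w) \<le> - Im w \<and> x n = E w \<and> 0 \<le> Re w \<and> Re w \<le> 1" for n
    proof -
      obtain w where w: "m (Re w) \<le> - Im w" "x n = E w" using x[of n] by auto
      define w' where "w' = w + of_int (- \<lfloor>Re w\<rfloor>)"
      have "m (Re w') \<le> - Im w'" using w(1) m_int[of "Re w" "- \<lfloor>Re w\<rfloor>"] by (simp add: w'_def)
      moreover have "x n = E w'" unfolding w'_def E_add_int by (rule w(2))
      moreover have "0 \<le> Re w'" "Re w' \<le> 1" unfolding w'_def by (simp, simp, linarith)
      ultimately show ?thesis by blast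
    qed
    then obtain w where w: "\<And>n. m (Re (w n)) \<le> - Im (w n)" "\<And>n. x n = E (w n)"
      "\<And>n. 0 \<le> Re (w n)" "\<And>n. Re (w n) \<le> 1" by metis
    obtain b where b: "\<And>n. cmod (x n) \<le> b"
      using convergent_imp_bounded[OF lim] by (auto simp: bounded_iff)
    obtain R where R: "1 < R" "\<And>\<zeta>. R < cmod \<zeta> \<Longrightarrow> b < cmod (h \<zeta>)" using h_at_infinity by blast
    have "cmod (circle_exp (w n)) \<le> R" for n
      using R(2)[of "circle_exp (w n)"] b[of n] w(2)[of n] unfolding E_def by fastforce
    then have "exp (- (2 * pi * Im (w n))) \<le> exp (ln R)" for n using R by (simp add: cmod_circle_exp)
    then have hb: "- Im (w n) \<le> ln R / (2 * pi)" for n by (simp add: field_simps)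
    have hpos: "0 < - Im (w n)" for n using w(1)[of n] assms(3)[of "Re (w n)"] by linarith
    have "w n \<in> cbox (Complex 0 (- (ln R / (2 * pi)))) (Complex 1 0)" for n
      using w(3,4)[of n] hb[of n] hpos[of n] by (simp add: in_cbox_complex_iff)
    then obtain v r where v: "strict_mono (r :: nat \<Rightarrow> nat)" "(w \<circ> r) \<longlonglongrightarrow> v"
      using compact_cbox[of "Complex 0 (- (ln R / (2 * pi)))" "Complex 1 0"]
      unfolding compact_def by blast
    have le: "m (Re v) \<le> - Im v"
    proof (rule LIMSEQ_le)
      have "isCont m (Re v)" using assms(1) by (simp add: continuous_on_eq_continuous_at)
      then show "(\<lambda>n. m (Re ((w \<circ> r) n))) \<longlonglongrightarrow> m (Re v)"
        by (rule isCont_tendsto_compose) (intro tendsto_intros v)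
      show "(\<lambda>n. - Im ((w \<circ> r) n)) \<longlonglongrightarrow> - Im v" by (intro tendsto_intros v)
    qed (use w(1) in auto)
    then have "0 < - Im v" using assms(3)[of "Re v"] by linarith
    moreover have "open {w. 0 < - Im w}" by (simp add: open_halfspace_Im_lt)
    ultimately have "isCont E v"
      using E_hol holomorphic_on_imp_continuous_on continuous_on_eq_continuous_at by blast
    from isCont_tendsto_compose[OF this v(2)] have "(x \<circ> r) \<longlonglongrightarrow> E v" by (simp add: o_def w(2))
    moreover have "(x \<circ> r) \<longlonglongrightarrow> z" by (rule LIMSEQ_subseq_LIMSEQ[OF lim v(1)])
    ultimately have "z = E v" by (rule LIMSEQ_unique[symmetric])
    then show ?thesis using le by blast
  qed
  then show ?thesis unfolding closed_sequential_limits by fastforce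
qed

text \<open>For periodic \<open>m\<close> this is the neighbourhood of \<open>K\<close> enclosed by
  the image of the graph of height \<open>m\<close>, the domain to which the maximum principle is
  applied.\<close>

definition collar :: "(real \<Rightarrow> real) \<Rightarrow> complex set" where
  "collar m = K \<union> E ` {w. 0 < - Im w \<and> - Im w < m (Re w)}"

context
  fixes m :: "real \<Rightarrow> real"
  assumes m: "continuous_on UNIV m" "\<And>x. m (x + 1) = m x" "\<And>x. 0 < m x"
begin

text \<open>As \<open>E\<close> is injective up to integer translations and \<open>m\<close> is
  periodic, points below and above the graph have disjoint images, which together exhaust the
  complement of \<open>K\<close>.\<close>

lemma collar_eq: "collar m = - (E ` {w. m (Re w) \<le> - Im w})"
proof -
  have m_int: "m (x + of_int k) = m x" for x k
    using step1_add_int[of "\<lambda>x. m x + x" x k] m(2) by simp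
  have pos: "0 < - Im w" if "m (Re w) \<le> - Im w" for w using that m(3)[of "Re w"] by linarith
  have "E w \<noteq> E w'" if "0 < - Im w" "- Im w < m (Re w)" "m (Re w') \<le> - Im w'" for w w'
  proof -
    note * = that
    show ?thesis
    proof
    assume "E w = E w'"
      then obtain k :: int where "w = w' + of_int k" using E_eq_iff *(1) pos[OF *(3)] by blast
      then show False using * m_int by simp
    qed
  qed
  moreover have "z \<in> E ` {w. 0 < - Im w \<and> - Im w < m (Re w)}"
    if "z \<notin> K" "z \<notin> E ` {w. m (Re w) \<le> - Im w}" for z
  proof -
    have "z \<in> - K" using that(1) by simp
    then obtain w where w: "0 < - Im w" "z = E w" using E_surj by blast
    then have "- Im w < m (Re w)" using that(2) by force
    then show ?thesis using w by blast
  qed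
  ultimately show ?thesis unfolding collar_def using E_notin pos by fastforce
qed

lemma open_collar: "open (collar m)"
  unfolding collar_eq using closed_E_image[OF m] by auto

text \<open>By the open mapping theorem the points strictly above the graph have an open image; it
  is disjoint from the collar, hence also from its closure.\<close>

lemma frontier_collar: "frontier (collar m) \<subseteq> E ` {w. - Im w = m (Re w)}"
proof -
  let ?A = "{w. m (Re w) < - Im w}"
  have "open ?A"
    by (intro open_Collect_less continuous_intros continuous_on_compose2[OF m(1)]) auto
  moreover have "\<not> E constant_on {w. 0 < - Im w}"
  proof
    assume "E constant_on {w. 0 < - Im w}"
    then have "E (- \<i>) = E (- 2 * \<i>)" by (auto simp: constant_on_def)
    then obtain k :: int where "- \<i> = - 2 * \<i> + of_int k" using E_eq_iff by auto
    then show False by (simp add: complex_eq_iff)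
  qed
  moreover have "?A \<subseteq> {w. 0 < - Im w}" using m(3) less_trans by blast
  moreover have "open {w. 0 < - Im w}" "connected {w. 0 < - Im w}"
    by (simp_all add: open_halfspace_Im_lt convex_connected convex_halfspace_Im_lt)
  ultimately have "open (E ` ?A)" by (intro open_mapping_thm[OF E_hol]) auto
  moreover have "E ` ?A \<inter> collar m = {}" unfolding collar_eq by force
  ultimately have "E ` ?A \<inter> closure (collar m) = {}" using open_Int_closure_eq_empty by blast
  moreover have "frontier (collar m) \<subseteq> closure (collar m) \<inter> E ` {w. m (Re w) \<le> - Im w}"
    using open_collar by (auto simp: frontier_def interior_open collar_eq)
  ultimately show ?thesis by force
qed

end

text \<open>Near \<open>0\<close> the chart is injective with open image, its derivative being
  nonzero; so all points near infinity are values of \<open>h\<close> at large arguments.\<close>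

lemma h_covers_infinity: "\<exists>b. \<forall>z. b < cmod z \<longrightarrow> (\<exists>\<zeta>. R < cmod \<zeta> \<and> h \<zeta> = z)"
proof -
  let ?c = "chart_at_infinity h"
  have an: "?c analytic_on {0}" and nz: "deriv ?c 0 \<noteq> 0" using h_map by (auto simp: exterior_riemann_map_def)
  obtain T where T: "open T" "0 \<in> T" "?c holomorphic_on T" using an analytic_on_holomorphic by auto
  obtain r where r: "0 < r" "ball 0 r \<subseteq> T" "inj_on ?c (ball 0 r)"
    using has_complex_derivative_locally_injective[OF T(3,2,1) nz] by blast
  define d where "d = min r (1 / (\<bar>R\<bar> + 1))"
  have d: "0 < d" "d \<le> r" using r by (auto simp: d_def)
  have "open (?c ` ball 0 d)"
  proof (rule open_mapping_thm3)
    have "ball 0 d \<subseteq> ball (0::complex) r" using d by auto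
    then show "?c holomorphic_on ball 0 d" "inj_on ?c (ball 0 d)"
      using r holomorphic_on_subset[OF T(3)] inj_on_subset by blast+
  qed simp
  moreover have "0 \<in> ?c ` ball 0 d" using d by (force simp: chart_at_infinity_def)
  ultimately obtain e where e: "0 < e" "ball 0 e \<subseteq> ?c ` ball 0 d" using open_contains_ball by blast
  show ?thesis
  proof (rule exI[of _ "1 / e"], intro allI impI)
    fix z :: complex assume z: "1 / e < cmod z"
    then have "0 < cmod z" using e(1) by (meson less_trans zero_less_divide_1_iff)
    have "1 < e * cmod z" using z e(1) by (simp add: divide_less_eq mult.commute)
    then have "1 / z \<in> ball 0 e" using \<open>0 < cmod z\<close> by (simp add: norm_divide divide_less_eq)
    then obtain w where w: "w \<in> ball 0 d" "1 / z = ?c w" using e(2) by auto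
    have "w \<noteq> 0" using w(2) \<open>0 < cmod z\<close> by (auto simp: chart_at_infinity_def)
    then have "h (1 / w) = z" using w(2) by (simp add: chart_at_infinity_def)
    moreover have "R < cmod (1 / w)"
    proof -
      have "cmod w < 1 / (\<bar>R\<bar> + 1)" using w(1) by (simp add: d_def)
      then have "cmod w * (\<bar>R\<bar> + 1) < 1" by (simp add: pos_less_divide_eq)
      then have "\<bar>R\<bar> + 1 < 1 / cmod w" using \<open>w \<noteq> 0\<close> by (simp add: pos_less_divide_eq mult.commute)
      then show ?thesis by (simp add: norm_divide)
    qed
    ultimately show "\<exists>\<zeta>. R < cmod \<zeta> \<and> h \<zeta> = z" by blast
  qed
qed

text \<open>Values near infinity are already taken by \<open>h\<close> at large arguments, and by
  injectivity they are not taken again at bounded height.\<close>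

lemma bounded_E_strip: "bounded (E ` {w. 0 < - Im w \<and> - Im w < c})"
proof -
  define R where "R = max 1 (exp (2 * pi * c))"
  obtain b where b: "\<And>z. b < cmod z \<Longrightarrow> \<exists>\<zeta>. R < cmod \<zeta> \<and> h \<zeta> = z" using h_covers_infinity by blast
  have "cmod (E w) \<le> b" if w: "0 < - Im w" "- Im w < c" for w
  proof (rule ccontr)
    assume "\<not> cmod (E w) \<le> b"
    then obtain \<zeta> where \<zeta>: "R < cmod \<zeta>" "h \<zeta> = E w" using b[of "E w"] by auto
    then have "\<zeta> \<in> disk_exterior" by (simp add: R_def)
    then have "\<zeta> = circle_exp w"
      using \<zeta>(2) h_bij w(1) circle_exp_exterior[of w] unfolding E_def bij_betw_def inj_on_def by blast
    moreover have "2 * pi * (- Im w) \<le> 2 * pi * c" using w(2) by (intro mult_left_mono) auto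
    then have "cmod (circle_exp w) \<le> R" by (simp add: cmod_circle_exp R_def le_max_iff_disj)
    ultimately show False using \<zeta>(1) by simp
  qed
  then show ?thesis unfolding bounded_iff by blast
qed

section \<open>Thin strips shrinking to \<open>K\<close>\<close>

definition strip :: "nat \<Rightarrow> complex set" where
  "strip n = E ` {w. 0 < - Im w \<and> - Im w < 1 / real (Suc n)}"

lemma strip_mono: "k \<le> n \<Longrightarrow> strip n \<subseteq> strip k"
proof -
  assume "k \<le> n"
  then have "1 / real (Suc n) \<le> 1 / real (Suc k)" by (intro divide_left_mono) auto
  then show ?thesis unfolding strip_def by (intro image_mono) auto
qed

text \<open>A point outside \<open>K\<close> has a positive height, and the collar of half that
  height, which contains all late strips, does not have it in its closure.\<close>

lemma strip_limit:
  assumes x: "\<And>n. x n \<in> strip n" and lim: "x \<longlonglongrightarrow> z"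
  shows "z \<in> K"
proof (rule ccontr)
  assume "z \<notin> K"
  then obtain v where v: "0 < - Im v" "z = E v" using E_surj by auto
  define c where "c = - Im v / 2"
  have c: "0 < c" using v by (simp add: c_def)
  obtain n where n: "1 / real (Suc n) < c" using nat_approx_posE[OF c] by blast
  have "closure (collar (\<lambda>_. c)) = collar (\<lambda>_. c) \<union> frontier (collar (\<lambda>_. c))"
    by (simp add: closure_Un_frontier)
  also have "\<dots> \<subseteq> - E ` {w. 2 * c \<le> - Im w}"
  proof -
    have "collar (\<lambda>_. c) = - (E ` {w. c \<le> - Im w})" using c by (intro collar_eq) auto
    moreover have "{w. 2 * c \<le> - Im w} \<subseteq> {w. c \<le> - Im w}" using c by auto
    ultimately have "collar (\<lambda>_. c) \<subseteq> - E ` {w. 2 * c \<le> - Im w}" by blast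
    moreover have "frontier (collar (\<lambda>_. c)) \<subseteq> E ` {w. - Im w = c}" using c by (intro frontier_collar) auto
    moreover have "E w \<noteq> E w'" if "- Im w = c" "2 * c \<le> - Im w'" for w w'
    proof
      assume *: "E w = E w'"
      have "0 < - Im w" "0 < - Im w'" using that c by linarith+
      from E_eq_iff[OF this] * obtain k :: int where "w = w' + of_int k" by blast
      then show False using that c by simp
    qed
    ultimately show ?thesis by fastforce
  qed
  finally have "z \<notin> closure (collar (\<lambda>_. c))" using v by (auto simp: c_def)
  moreover have "x k \<in> collar (\<lambda>_. c)" if "n \<le> k" for k
    using x[of k] strip_mono[OF that] n unfolding strip_def collar_def by fastforce
  then have "z \<in> closure (collar (\<lambda>_. c))"
    using closure_sequential[of z] LIMSEQ_ignore_initial_segment[OF lim, of n]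
    by (metis le_add2)
  ultimately show False by simp
qed

lemma strip_subset:
  assumes "open V" "K \<subseteq> V"
  shows "\<exists>n. strip n \<subseteq> V"
proof (rule ccontr)
  assume "\<not> ?thesis"
  then have "\<forall>n. \<exists>x. x \<in> strip n - V" by blast
  from choice[OF this] obtain x where x: "\<And>n. x n \<in> strip n" "\<And>n. x n \<in> - V" by blast
  have "bounded (strip 0)" unfolding strip_def by (rule bounded_E_strip)
  then have "bounded (range x)"
    by (rule bounded_subset) (use x(1) strip_mono[of 0] in blast)
  then obtain z r where z: "strict_mono (r :: nat \<Rightarrow> nat)" "(x \<circ> r) \<longlonglongrightarrow> z"
    using bounded_imp_convergent_subsequence by blast
  have "(x \<circ> r) n \<in> strip n" for n using x(1) strip_mono[OF seq_suble[OF z(1), of n]] by auto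
  from strip_limit[OF this z(2)] have "z \<in> K" .
  moreover have "z \<in> - V"
    by (rule closed_sequentially[OF _ _ z(2)]) (use assms(1) x(2) in auto)
  ultimately show False using assms(2) by blast
qed

lemma iter_E:
  assumes "\<And>i. i < j \<Longrightarrow> 0 < - Im ((\<Phi> ^^ i) w) \<and> - Im ((\<Phi> ^^ i) w) < \<tau>"
  shows "(f ^^ j) (E w) = E ((\<Phi> ^^ j) w)"
  using assms
proof (induction j)
  case (Suc j)
  then have "(f ^^ j) (E w) = E ((\<Phi> ^^ j) w)" by simp
  then show ?case using conj[of "(\<Phi> ^^ j) w"] Suc.prems[of j] by (simp add: E_def)
qed simp

text \<open>Two strips have different roles: in that of index \<open>n1\<close> the derivative of
  \<open>P\<close> is bounded by \<open>L\<close>, in that of index \<open>n2\<close> holomorphic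
  disks are almost constant. Orbits from the region stay in both for \<open>N\<close> steps, so
  \<open>P\<close> along them hardly varies over a box.\<close>

theorem averages_close:
  assumes V: "open V" "K \<subseteq> V" "P holomorphic_on V" and "0 < \<epsilon>"
  shows "\<exists>N\<ge>1. \<forall>z\<in>K. cmod ((\<Sum>j<N. P ((f ^^ j) z)) / of_nat N - P 0) \<le> \<epsilon>"
proof -
  have dP: "continuous_on V (deriv P)"
    using holomorphic_deriv[OF V(3,1)] holomorphic_on_imp_continuous_on by blast
  have "bounded (deriv P ` K)"
    using compact_continuous_image[OF continuous_on_subset[OF dP V(2)] compact_K] compact_imp_bounded by blast
  then obtain L where L: "0 < L" "\<And>z. z \<in> K \<Longrightarrow> cmod (deriv P z) < L"
    unfolding bounded_pos_less by blast
  define V1 where "V1 = V \<inter> deriv P -` ball 0 L"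
  have V1: "open V1" "K \<subseteq> V1" "V1 \<subseteq> V" "\<And>z. z \<in> V1 \<Longrightarrow> cmod (deriv P z) \<le> L"
    using continuous_open_preimage[OF dP V(1) open_ball] L V(2) by (auto simp: V1_def)
  define a where "a = exp (- (25 * B)) / 8"
  have a: "0 < a" by (simp add: a_def)
  \<comment> \<open>A box has diameter at most twice the gap and admits disks of radius
    \<open>a\<close> times the gap, so the oscillation is at most
    \<open>L * \<epsilon>1 * 2 / a\<close>, which is \<epsilon> / 4.\<close>
  define \<epsilon>1 where "\<epsilon>1 = \<epsilon> * a / (8 * L)"
  have \<epsilon>1: "0 < \<epsilon>1" using \<open>0 < \<epsilon>\<close> a L by (simp add: \<epsilon>1_def)
  obtain n1 where n1: "strip n1 \<subseteq> V1 \<inter> U" using strip_subset[of "V1 \<inter> U"] V1 open_U K_U by auto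
  have "\<exists>n. \<forall>\<psi> w r. 0 < r \<longrightarrow> \<psi> holomorphic_on ball w r \<longrightarrow> \<psi> ` ball w r \<subseteq> strip n \<longrightarrow>
    cmod (deriv \<psi> w) * r \<le> \<epsilon>1"
  proof (rule small_derivative[OF _ strip_mono _ strip_limit \<epsilon>1])
    show "bounded (strip 0)" unfolding strip_def by (rule bounded_E_strip)
    show "strip n \<inter> K = {}" for n using E_notin by (auto simp: strip_def)
  qed auto
  then obtain n2 where n2: "\<And>\<psi> w r. 0 < r \<Longrightarrow> \<psi> holomorphic_on ball w r \<Longrightarrow> \<psi> ` ball w r \<subseteq> strip n2 \<Longrightarrow>
    cmod (deriv \<psi> w) * r \<le> \<epsilon>1" by blast
  \<comment> \<open>Gaps below \<open>s\<close> put all orbit heights at once in the domain of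
    \<Phi>, in the range of the conjugacy and in both strips.\<close>
  define s where "s = Min {\<eta>, \<tau>, 1 / real (Suc n1), 1 / real (Suc n2)}"
  have s: "0 < s" "s \<le> \<eta>" "s \<le> \<tau>" "s \<le> 1 / real (Suc n1)" "s \<le> 1 / real (Suc n2)"
    using \<eta>_pos \<tau>_pos by (auto simp: s_def simp del: of_nat_Suc)
  have sE: "E w \<in> strip n1 \<inter> strip n2" if "0 < - Im w" "- Im w < s" for w
    using that s(4,5) unfolding strip_def by (auto simp del: of_nat_Suc)
  obtain q p q' p' where good: "good q p q' p'" and gap_s: "\<And>x. gap q p x < s" using denjoy[OF s(1)] by blast
  have small: "gap q p x \<le> \<eta>" for x using gap_s[of x] s(2) by linarith
  have gap0: "0 < gap q p x" for x by (rule gap_pos[OF good])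
  define N where "N = q + q'"
  have N: "1 \<le> N" using good_facts(1)[OF good] by (simp add: N_def)
  have reg: "0 < - Im ((\<Phi> ^^ j) w)" "- Im ((\<Phi> ^^ j) w) < s" if "w \<in> region q p" "j \<le> N" for w j
    using region_orbit[OF good small that(1), of j] that(2) gap_s[of "(F ^^ j) (Re w)"] by (auto simp: N_def)
  have reg_E: "(f ^^ j) (E w) = E ((\<Phi> ^^ j) w)" if "w \<in> region q p" "j \<le> N" for w j
  proof (rule iter_E)
    show "0 < - Im ((\<Phi> ^^ i) w) \<and> - Im ((\<Phi> ^^ i) w) < \<tau>" if "i < j" for i
      using reg[OF \<open>w \<in> region q p\<close>, of i] that \<open>j \<le> N\<close> s(3) by simp
  qed
  have \<Phi>_iter_hol: "(\<Phi> ^^ j) holomorphic_on A" if A: "A \<subseteq> region q p" and "j \<le> N" for A j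
    using that(2)
  proof (induction j)
    case (Suc j)
    have "(\<Phi> \<circ> (\<Phi> ^^ j)) holomorphic_on A"
    proof (rule holomorphic_on_compose_gen[OF _ \<Phi>_hol])
      show "(\<Phi> ^^ j) ` A \<subseteq> {w. \<bar>Im w\<bar> < \<eta>}"
        using reg[of _ j] A Suc.prems s(2) by fastforce
    qed (use Suc in auto)
    then show ?case by (simp add: o_def)
  qed (simp add: id_def holomorphic_on_ident)
  define \<Psi> where "\<Psi> = (\<lambda>w. P (E w))"
  have osc: "cmod (\<Psi> ((\<Phi> ^^ j) w) - \<Psi> ((\<Phi> ^^ j) w')) \<le> \<epsilon> / 4"
    if w: "w \<in> orbit_box q p u" "w' \<in> orbit_box q p u" and j: "j < N" for u w w' j
  proof -
    define r where "r = a * gap q p u"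
    have r: "0 < r" using a gap0 by (simp add: r_def)
    have sub: "ball v r \<subseteq> region q p" if "v \<in> orbit_box q p u" for v
      using orbit_box_ball[OF good small that] by (simp add: r_def a_def)
    define \<psi> where "\<psi> = (\<lambda>v. E ((\<Phi> ^^ j) v))"
    have \<psi>_hol: "\<psi> holomorphic_on ball v r" if v: "v \<in> orbit_box q p u" for v
    proof -
      have "(E \<circ> (\<Phi> ^^ j)) holomorphic_on ball v r"
        by (rule holomorphic_on_compose_gen[OF \<Phi>_iter_hol[OF sub[OF v]] E_hol])
          (use j reg(1)[of _ j] sub[OF v] in auto)
      then show ?thesis by (simp add: \<psi>_def o_def)
    qed
    have \<psi>_im: "\<psi> y \<in> strip n1 \<inter> strip n2" if "v \<in> orbit_box q p u" "y \<in> ball v r" for v y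
      using sE reg[of y j] sub[OF that(1)] that(2) j unfolding \<psi>_def by auto
    have P\<psi>: "cmod (deriv (\<lambda>y. P (\<psi> y)) v) * r \<le> L * \<epsilon>1" "(\<lambda>y. P (\<psi> y)) holomorphic_on ball v r"
      if v: "v \<in> orbit_box q p u" for v
    proof -
      have "(P \<circ> \<psi>) holomorphic_on ball v r"
      proof (rule holomorphic_on_compose_gen[OF \<psi>_hol[OF v] V(3)])
        show "\<psi> ` ball v r \<subseteq> V" using \<psi>_im[OF v] n1 V1(3) by blast
      qed
      then show "(\<lambda>y. P (\<psi> y)) holomorphic_on ball v r" by (simp add: o_def)
      have vb: "v \<in> ball v r" using r by simp
      have \<psi>v: "\<psi> v \<in> V1" using \<psi>_im[OF v vb] n1 by auto
      have "(\<psi> has_field_derivative deriv \<psi> v) (at v)"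
        by (rule holomorphic_derivI[OF \<psi>_hol[OF v] open_ball vb])
      moreover have "(P has_field_derivative deriv P (\<psi> v)) (at (\<psi> v))"
        using \<psi>v V1(3) by (intro holomorphic_derivI[OF V(3,1)]) auto
      ultimately have "((\<lambda>y. P (\<psi> y)) has_field_derivative deriv P (\<psi> v) * deriv \<psi> v) (at v)"
        using DERIV_chain2 by blast
      then have "deriv (\<lambda>y. P (\<psi> y)) v = deriv P (\<psi> v) * deriv \<psi> v" by (rule DERIV_imp_deriv)
      then have "cmod (deriv (\<lambda>y. P (\<psi> y)) v) * r = cmod (deriv P (\<psi> v)) * (cmod (deriv \<psi> v) * r)"
        by (simp add: norm_mult)
      also have "\<dots> \<le> L * \<epsilon>1"
      proof (rule mult_mono)
        have "\<psi> ` ball v r \<subseteq> strip n2" using \<psi>_im[OF v] by blast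
        then show "cmod (deriv \<psi> v) * r \<le> \<epsilon>1" by (rule n2[OF r \<psi>_hol[OF v]])
      qed (use V1(4)[OF \<psi>v] L(1) r in auto)
      finally show "cmod (deriv (\<lambda>y. P (\<psi> y)) v) * r \<le> L * \<epsilon>1" .
    qed
    have "cmod (w - w') \<le> \<bar>Re (w - w')\<bar> + \<bar>Im (w - w')\<bar>" by (rule cmod_le)
    also have "\<dots> \<le> 2 * gap q p u"
    proof -
      have e: "exp (- (7 * B)) / 4 * gap q p u \<le> 1 / 4 * gap q p u"
        using gap0[of u] B_pos by (intro mult_right_mono) auto
      have "0 < exp (- (25 * B)) / 8 * gap q p u" using gap0[of u] by simp
      then have "\<bar>Re (w - w')\<bar> \<le> gap q p u + 2 * (1 / 4 * gap q p u)" "\<bar>Im (w - w')\<bar> \<le> 1 / 4 * gap q p u"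
        using w e unfolding orbit_box_def[OF good small] mem_Collect_eq abs_le_iff minus_complex.sel
        by (intro conjI, linarith, linarith)+
      then show ?thesis using gap0[of u] by linarith
    qed
    finally have dist: "cmod (w - w') \<le> 2 * gap q p u" .
    have "cmod (P (\<psi> w) - P (\<psi> w')) \<le> L * \<epsilon>1 / r * cmod (w - w')"
      by (rule cmod_diff_le_of_balls[OF orbit_box_convex[OF good small] r P\<psi>(2,1) w])
    also have "\<dots> \<le> L * \<epsilon>1 / r * (2 * gap q p u)"
      using dist L(1) \<epsilon>1 r by (intro mult_left_mono) auto
    also have "\<dots> = \<epsilon> / 4" using a L(1) gap0[of u] by (simp add: \<epsilon>1_def r_def field_simps)
    finally show ?thesis by (simp add: \<psi>_def \<Psi>_def)
  qed
  define A where "A = (\<lambda>z. (\<Sum>j<N. P ((f ^^ j) z)) / of_nat N)"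
  define c where "c = A (E (curve q p 0))"
  have curve_reg: "curve q p x \<in> region q p" for x
    using orbit_box_ball[OF good small curve_in_box[OF good small, of x x]] gap0[of x] by auto
  have A_curve: "A (E (curve q p x)) = (\<Sum>j<N. \<Psi> ((\<Phi> ^^ j) (curve q p x))) / of_nat N" for x
    using reg_E[OF curve_reg] unfolding A_def \<Psi>_def by simp
  have A_c: "cmod (A (E (curve q p x)) - c) \<le> \<epsilon> / 2" for x
  proof -
    have "cmod ((\<Sum>j<N. \<Psi> ((\<Phi> ^^ j) (curve q p x))) - (\<Sum>j<N. \<Psi> ((\<Phi> ^^ j) (curve q p 0)))) \<le> 2 * (\<epsilon> / 4) * real N"
      unfolding N_def using osc by (intro orbit_sums_close[OF good small]) (auto simp: \<Psi>_def E_add_int N_def)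
    moreover have "A (E (curve q p x)) - c =
        ((\<Sum>j<N. \<Psi> ((\<Phi> ^^ j) (curve q p x))) - (\<Sum>j<N. \<Psi> ((\<Phi> ^^ j) (curve q p 0)))) / of_nat N"
      by (simp add: c_def A_curve diff_divide_distrib)
    ultimately show ?thesis using N by (simp add: norm_divide divide_le_eq)
  qed
  \<comment> \<open>\<open>m\<close> is the height of the curve and \<open>m'\<close> that of the
    region. The larger collar contains the closure of the smaller one, so the averages are
    holomorphic beyond the frontier where they are estimated.\<close>
  define m m' where "m = (\<lambda>x. exp (- (14 * B)) / 8 * gap q p x)" and "m' = (\<lambda>x. exp (- (4 * B)) * gap q p x)"
  have "continuous_on UNIV (gap q p)"
    unfolding gap_def by (intro continuous_intros continuous_at_imp_continuous_on ballI isCont_iter)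
  moreover have "gap q p (x + 1) = gap q p x" for x using gap_add_int[OF good, of x 1] by simp
  ultimately have m: "continuous_on UNIV m" "\<And>x. m (x + 1) = m x" "\<And>x. 0 < m x"
    and m': "continuous_on UNIV m'" "\<And>x. m' (x + 1) = m' x" "\<And>x. 0 < m' x"
    unfolding m_def m'_def using gap0 by (auto intro!: continuous_intros)
  have mm': "m x < m' x" for x
  proof -
    have "exp (- (14 * B)) / 8 < exp (- (14 * B))" by simp
    also have "\<dots> \<le> exp (- (4 * B))" using B_pos by simp
    finally show ?thesis unfolding m_def m'_def using gap0[of x] by simp
  qed
  have W'_reg: "w \<in> region q p" if "0 < - Im w" "- Im w < m' (Re w)" for w
    using that by (simp add: region_def[OF good small] m'_def)
  have f_iter: "(f ^^ j) holomorphic_on collar m' \<and> (f ^^ j) ` collar m' \<subseteq> K \<union> strip n1" if "j \<le> N" for j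
    using that
  proof (induction j)
    case 0
    have "collar m' \<subseteq> K \<union> strip n1"
      using reg[OF W'_reg, of _ 0] sE unfolding collar_def by fastforce
    then show ?case by (simp add: id_def holomorphic_on_ident)
  next
    case (Suc j)
    have "(f \<circ> (f ^^ j)) holomorphic_on collar m'"
    proof (rule holomorphic_on_compose_gen[OF _ f_hol])
      show "(f ^^ j) holomorphic_on collar m'" "(f ^^ j) ` collar m' \<subseteq> U"
        using Suc n1 K_U by (simp, meson Suc_leD Un_least order_trans le_infE)
    qed
    moreover have "(f ^^ Suc j) z \<in> K" if "z \<in> K" for z
    proof -
      have "(f ^^ j) z \<in> K" using that f_K by (induction j) auto
      then show ?thesis using f_K by auto
    qed
    moreover have "(f ^^ Suc j) (E w) \<in> strip n1" if "0 < - Im w" "- Im w < m' (Re w)" for w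
      using reg_E[OF W'_reg[OF that] Suc.prems] reg[OF W'_reg[OF that] Suc.prems] sE by auto
    ultimately show ?case unfolding collar_def by (auto simp: o_def)
  qed
  have A_hol: "A holomorphic_on collar m'"
  proof -
    have "(P \<circ> (f ^^ j)) holomorphic_on collar m'" if "j < N" for j
    proof (rule holomorphic_on_compose_gen[OF _ V(3)])
      show "(f ^^ j) holomorphic_on collar m'" "(f ^^ j) ` collar m' \<subseteq> V"
        using f_iter[of j] that n1 V1(3) V(2) by (simp, meson Un_least less_imp_le order_trans le_infE)
    qed
    then show ?thesis unfolding A_def using N by (intro holomorphic_intros) (auto simp: o_def)
  qed
  have fr: "frontier (collar m) \<subseteq> E ` range (curve q p)"
  proof -
    have "w = curve q p (Re w)" if "- Im w = m (Re w)" for w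
      using that by (simp add: curve_def[OF good small] m_def complex_eq_iff)
    then show ?thesis using frontier_collar[OF m] by blast
  qed
  have cl: "closure (collar m) \<subseteq> collar m'"
  proof -
    have "- Im w < m' (Re w)" if "- Im w < m (Re w)" for w using that mm'[of "Re w"] by simp
    then have "collar m \<subseteq> collar m'" unfolding collar_def by blast
    moreover have "E (curve q p x) \<in> collar m'" for x
    proof -
      have "0 < - Im (curve q p x)" "- Im (curve q p x) < m' (Re (curve q p x))"
        using mm'[of x] m(3)[of x] by (simp_all add: curve_def[OF good small] m_def)
      then show ?thesis unfolding collar_def by blast
    qed
    ultimately show ?thesis unfolding closure_Un_frontier using fr by blast
  qed
  have bnd: "bounded (collar m)"
  proof -
    have "- Im w < s" if "0 < - Im w" "- Im w < m (Re w)" for w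
      using reg(2)[OF W'_reg, of w 0] that mm'[of "Re w"] by simp
    then have "collar m \<subseteq> K \<union> E ` {w. 0 < - Im w \<and> - Im w < s}" unfolding collar_def by blast
    moreover have "bounded (K \<union> E ` {w. 0 < - Im w \<and> - Im w < s})"
      using bounded_E_strip compact_imp_bounded[OF compact_K] by simp
    ultimately show ?thesis by (rule bounded_subset[rotated])
  qed
  have max: "cmod (A z - c) \<le> \<epsilon> / 2" if "z \<in> collar m" for z
  proof (rule maximum_modulus_frontier[of "\<lambda>z. A z - c" "collar m", OF _ _ bnd _ that])
    have "A holomorphic_on closure (collar m)" by (rule holomorphic_on_subset[OF A_hol cl])
    then show "(\<lambda>z. A z - c) holomorphic_on interior (collar m)" "continuous_on (closure (collar m)) (\<lambda>z. A z - c)"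
      using interior_subset[of "collar m"] closure_subset[of "collar m"]
      by (auto intro!: holomorphic_intros continuous_intros holomorphic_on_imp_continuous_on
          intro: holomorphic_on_subset)
    show "cmod (A z - c) \<le> \<epsilon> / 2" if "z \<in> frontier (collar m)" for z
      using fr that A_c by auto
  qed
  have K_collar: "z \<in> collar m" if "z \<in> K" for z using that by (simp add: collar_def)
  \<comment> \<open>Comparing both \<open>z\<close> and the fixed point with the unknown constant
    \<open>c\<close> eliminates it, at cost \<epsilon> / 2 each.\<close>
  have "(f ^^ j) 0 = 0" for j by (induction j) (simp_all add: f_0)
  then have A0: "A 0 = P 0" using N by (simp add: A_def)
  have "cmod (A z - P 0) \<le> \<epsilon>" if "z \<in> K" for z
    using norm_triangle_ineq4[of "A z - c" "A 0 - c"] max[OF K_collar[OF that]] max[OF K_collar[OF zero_K]]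
    by (simp add: A0)
  then show ?thesis using N unfolding A_def by blast
qed

end

section \<open>Averages of continuous functions\<close>

text \<open>Each complete block of length \<open>N\<close> contributes at most
  \<open>N * \<epsilon>\<close> to the deviation, and the one incomplete block a bounded amount,
  which becomes negligible after division by \<open>n\<close>.\<close>

lemma averages_eventually_close:
  fixes Q :: "complex \<Rightarrow> complex"
  assumes f_K: "f ` K \<subseteq> K" and bound: "\<And>z. z \<in> K \<Longrightarrow> cmod (Q z) \<le> M" and "1 \<le> N" "0 < \<epsilon>"
    and close: "\<And>z. z \<in> K \<Longrightarrow> cmod ((\<Sum>j<N. Q ((f ^^ j) z)) / of_nat N - c) \<le> \<epsilon>"
  shows "\<forall>\<^sub>F n in sequentially. \<forall>z\<in>K. cmod ((\<Sum>j<n. Q ((f ^^ j) z)) / of_nat n - c) \<le> 2 * \<epsilon>"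
proof -
  define S where "S = (\<lambda>n z. \<Sum>j<n. Q ((f ^^ j) z) - c)"
  define M' where "M' = \<bar>M\<bar> + cmod c"
  have iter_K: "(f ^^ j) z \<in> K" if "z \<in> K" for j z using that f_K by (induction j) auto
  have S_N: "cmod (S N z) \<le> real N * \<epsilon>" if "z \<in> K" for z
  proof -
    have "S N z = of_nat N * ((\<Sum>j<N. Q ((f ^^ j) z)) / of_nat N - c)"
      using \<open>1 \<le> N\<close> by (simp add: S_def sum_subtractf field_simps)
    then have "cmod (S N z) = real N * cmod ((\<Sum>j<N. Q ((f ^^ j) z)) / of_nat N - c)"
      by (simp add: norm_mult)
    then show ?thesis using close[OF that] by (simp add: mult_left_mono)
  qed
  have S_bound: "cmod (S n z) \<le> real n * M'" if "z \<in> K" for n z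
  proof -
    have "cmod (Q ((f ^^ j) z) - c) \<le> M'" for j
      using norm_triangle_ineq4[of "Q ((f ^^ j) z)" c] bound[OF iter_K[OF that, of j]] unfolding M'_def by linarith
    then have "cmod (S n z) \<le> (\<Sum>j<n. M')" unfolding S_def by (intro sum_norm_le)
    then show ?thesis by simp
  qed
  have main: "cmod (S n z) \<le> real n * \<epsilon> + real N * M'" if "z \<in> K" for n z
    using that
  proof (induction n arbitrary: z rule: less_induct)
    case (less n)
    show ?case
    proof (cases "n < N")
      case True
      have "real n * M' \<le> real N * M'" using True by (intro mult_right_mono) (auto simp: M'_def)
      moreover have "0 \<le> real n * \<epsilon>" using \<open>0 < \<epsilon>\<close> by simp
      ultimately show ?thesis using S_bound[OF less.prems, of n] by linarith
    next
      case False
      define k where "k = n - N"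
      have n: "n = k + N" using False by (simp add: k_def)
      have "S n z = S N z + S k ((f ^^ N) z)"
        using sum_shift[of "\<lambda>j. Q ((f ^^ j) z) - c" N k] by (simp add: S_def n funpow_add)
      then have "cmod (S n z) \<le> cmod (S N z) + cmod (S k ((f ^^ N) z))" by (simp add: norm_triangle_ineq)
      also have "\<dots> \<le> real N * \<epsilon> + (real k * \<epsilon> + real N * M')"
        using \<open>1 \<le> N\<close> n by (intro add_mono S_N less iter_K) auto
      finally show ?thesis by (simp add: n algebra_simps)
    qed
  qed
  show ?thesis
  proof (rule eventually_sequentiallyI)
    fix n assume n: "nat \<lceil>real N * M' / \<epsilon>\<rceil> + 1 \<le> n"
    then have n0: "0 < real n" by simp
    have "real N * M' / \<epsilon> \<le> real n" using n by linarith
    then have le: "real N * M' \<le> real n * \<epsilon>" using \<open>0 < \<epsilon>\<close> by (simp add: divide_le_eq)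
    show "\<forall>z\<in>K. cmod ((\<Sum>j<n. Q ((f ^^ j) z)) / of_nat n - c) \<le> 2 * \<epsilon>"
    proof
      fix z assume z: "z \<in> K"
      have "(\<Sum>j<n. Q ((f ^^ j) z)) / of_nat n - c = S n z / of_nat n"
        using n0 by (simp add: S_def sum_subtractf field_simps)
      then show "cmod ((\<Sum>j<n. Q ((f ^^ j) z)) / of_nat n - c) \<le> 2 * \<epsilon>"
        using main[OF z, of n] le n0 by (simp add: norm_divide divide_le_eq algebra_simps)
    qed
  qed
qed

text \<open>A function whose real part peaks at \<open>0\<close> controls how often orbits leave a neighbourhood of \<open>0\<close>.\<close>

lemma averages_converge:
  fixes \<phi> :: "complex \<Rightarrow> complex"
  assumes K: "compact K" "connected (- K)" "0 \<in> K" "0 \<in> closure (- K)" and f_K: "f ` K \<subseteq> K"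
    and hol: "\<And>P V \<epsilon>. open V \<Longrightarrow> K \<subseteq> V \<Longrightarrow> P holomorphic_on V \<Longrightarrow> 0 < \<epsilon> \<Longrightarrow>
      \<exists>N\<ge>1. \<forall>z\<in>K. cmod ((\<Sum>j<N. P ((f ^^ j) z)) / of_nat N - P 0) \<le> \<epsilon>"
    and \<phi>: "continuous_on K \<phi>" and "0 < \<epsilon>"
  shows "\<forall>\<^sub>F n in sequentially. \<forall>z\<in>K. cmod ((\<Sum>j<n. \<phi> ((f ^^ j) z)) / of_nat n - \<phi> 0) \<le> 2 * \<epsilon>"
proof -
  obtain \<delta> where \<delta>: "0 < \<delta>" "\<And>z. z \<in> K \<Longrightarrow> cmod z < \<delta> \<Longrightarrow> cmod (\<phi> z - \<phi> 0) < \<epsilon>"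
    using \<phi>[unfolded continuous_on_iff, rule_format, OF K(3) \<open>0 < \<epsilon>\<close>] by (auto simp: dist_norm)
  have "bounded (\<phi> ` K)" using compact_continuous_image[OF \<phi> K(1)] compact_imp_bounded by blast
  then obtain M where M: "0 < M" "\<And>z. z \<in> K \<Longrightarrow> cmod (\<phi> z) \<le> M" unfolding bounded_pos by blast
  define C where "C = 2 * M"
  have C: "0 < C" using M by (simp add: C_def)
  have \<phi>C: "cmod (\<phi> z - \<phi> 0) \<le> C" if "z \<in> K" for z
    using norm_triangle_ineq4[of "\<phi> z" "\<phi> 0"] M(2)[OF that] M(2)[OF K(3)] by (simp add: C_def)
  \<comment> \<open>One \<open>e\<close> comes from the bound \<open>1 + e\<close>, one from
    \<open>G 0 - 1\<close> and two from the averages of \<open>G\<close>; together they cost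
    \<open>C * (4 * e)\<close>, which is \<epsilon>.\<close>
  define e where "e = \<epsilon> / (4 * C)"
  have e: "0 < e" using C \<open>0 < \<epsilon>\<close> by (simp add: e_def)
  obtain G V where G: "open V" "K \<subseteq> V" "G holomorphic_on V" "\<And>z. z \<in> K \<Longrightarrow> cmod (G z) \<le> 1 + e"
    "cmod (G 0 - 1) \<le> e" "\<And>z. z \<in> K \<Longrightarrow> \<delta> \<le> cmod z \<Longrightarrow> cmod (G z) \<le> e"
    using peak_function[OF K \<delta>(1) e] by blast
  obtain N where N: "1 \<le> N" "\<And>z. z \<in> K \<Longrightarrow> cmod ((\<Sum>j<N. G ((f ^^ j) z)) / of_nat N - G 0) \<le> e"
    using hol[OF G(1-3) e] by blast
  have iter_K: "(f ^^ j) z \<in> K" if "z \<in> K" for j z using that f_K by (induction j) auto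
  \<comment> \<open>Near \<open>0\<close> continuity of \<phi> suffices; elsewhere \<open>G\<close>
    is small, and \<open>C\<close> times a number at least 1 covers any deviation. The bound is
    affine in \<open>Re (G z)\<close>, so its averages are controlled by those of
    \<open>G\<close>.\<close>
  have pointwise: "cmod (\<phi> z - \<phi> 0) \<le> \<epsilon> + C * (1 + e - Re (G z))" if z: "z \<in> K" for z
  proof (cases "cmod z < \<delta>")
    case True
    have "0 \<le> C * (1 + e - Re (G z))"
      using C G(4)[OF z] complex_Re_le_cmod[of "G z"] by (intro mult_nonneg_nonneg) auto
    then show ?thesis using \<delta>(2)[OF z True] by linarith
  next
    case False
    then have "1 \<le> 1 + e - Re (G z)" using G(6)[OF z] complex_Re_le_cmod[of "G z"] by linarith
    then have "C * 1 \<le> C * (1 + e - Re (G z))" using C by (intro mult_left_mono) auto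
    then show ?thesis using \<phi>C[OF z] \<open>0 < \<epsilon>\<close> by linarith
  qed
  have "\<forall>\<^sub>F n in sequentially. \<forall>z\<in>K. cmod ((\<Sum>j<n. G ((f ^^ j) z)) / of_nat n - G 0) \<le> 2 * e"
    by (rule averages_eventually_close[OF f_K G(4) N(1) e N(2)])
  then show ?thesis
    using eventually_gt_at_top[of 0]
  proof eventually_elim
    case (elim n)
    show ?case
    proof
      fix z assume z: "z \<in> K"
      define g where "g = (\<Sum>j<n. G ((f ^^ j) z)) / of_nat n"
      have n: "0 < real n" using elim by simp
      have "(\<Sum>j<n. \<phi> ((f ^^ j) z)) / of_nat n - \<phi> 0 = (\<Sum>j<n. \<phi> ((f ^^ j) z) - \<phi> 0) / of_nat n"
        using n by (simp add: sum_subtractf field_simps)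
      then have "cmod ((\<Sum>j<n. \<phi> ((f ^^ j) z)) / of_nat n - \<phi> 0) =
          cmod (\<Sum>j<n. \<phi> ((f ^^ j) z) - \<phi> 0) / real n" by (simp add: norm_divide)
      also have "\<dots> \<le> (\<Sum>j<n. \<epsilon> + C * (1 + e - Re (G ((f ^^ j) z)))) / real n"
        by (intro divide_right_mono sum_norm_le pointwise iter_K z) auto
      also have "\<dots> = \<epsilon> + C * (1 + e - Re g)"
        using n by (simp add: g_def sum.distrib sum_distrib_left[symmetric] sum_subtractf field_simps)
      also have "\<dots> \<le> \<epsilon> + C * (4 * e)"
      proof -
        have gG: "cmod (g - G 0) \<le> 2 * e" using elim(1) z by (simp add: g_def)
        have "1 - Re g = - Re (G 0 - 1) - Re (g - G 0)" by simp
        also have "\<dots> \<le> e + 2 * e"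
          using abs_Re_le_cmod[of "G 0 - 1"] abs_Re_le_cmod[of "g - G 0"] G(5) gG by linarith
        finally show ?thesis using C by simp
      qed
      also have "\<dots> = 2 * \<epsilon>" using C by (simp add: e_def)
      finally show "cmod ((\<Sum>j<n. \<phi> ((f ^^ j) z)) / of_nat n - \<phi> 0) \<le> 2 * \<epsilon>" .
    qed
  qed
qed

lemma correspondence_imp_exterior_lift:
  assumes K: "compact K" "0 \<in> K" and U: "open U" "K \<subseteq> U" "f holomorphic_on U"
    and f: "f ` K \<subseteq> K" "f 0 = 0" and corr: "external_circle_correspondence U f K \<theta>"
  shows "\<exists>F D \<rho> B \<Phi> \<eta> h \<tau>. exterior_lift F D \<rho> B \<Phi> \<eta> h f K U \<tau>"
proof -
  obtain h g \<epsilon> \<rho> where h: "exterior_riemann_map K h" and "0 < \<epsilon>"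
    and hfg: "\<And>\<zeta>. 1 < cmod \<zeta> \<Longrightarrow> cmod \<zeta> < 1 + \<epsilon> \<Longrightarrow>
      h \<zeta> \<in> U \<and> f (h \<zeta>) \<in> - K \<and> g \<zeta> = inv_into disk_exterior h (f (h \<zeta>))"
    and g: "g analytic_on unit_circle" "analytic_circle_diffeo g"
    and \<rho>: "has_rotation_number g \<rho>" "\<rho> \<notin> \<rat>"
    using corr unfolding external_circle_correspondence_def by blast
  obtain F where F: "increasing_circle_lift g F" "\<And>x. (\<lambda>n. ((F ^^ n) x - x) / real n) \<longlonglongrightarrow> \<rho>"
    using \<rho>(1) unfolding has_rotation_number_def by blast
  obtain D B \<Phi> \<eta> where \<Phi>: "analytic_lift F D \<rho> B \<Phi> \<eta>" "\<Phi> holomorphic_on {w. \<bar>Im w\<bar> < \<eta>}"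
    "\<And>w. \<bar>Im w\<bar> < \<eta> \<Longrightarrow> circle_exp (\<Phi> w) = g (circle_exp w)"
    by (rule analytic_lift_exists[OF g F \<rho>(2)], rule that)
  interpret analytic_lift F D \<rho> B \<Phi> \<eta> by (rule \<Phi>(1))
  \<comment> \<open>\<open>ln (1 + \<epsilon>) / (2 * pi)\<close> is the height at which
    \<open>circle_exp\<close> reaches modulus \<open>1 + \<epsilon>\<close>; below \<eta> the map
    \<Phi> lifts \<open>g\<close>.\<close>
  define \<tau> where "\<tau> = min \<eta> (ln (1 + \<epsilon>) / (2 * pi))"
  have "exterior_lift F D \<rho> B \<Phi> \<eta> h f K U \<tau>"
  proof unfold_locales
    show "0 < \<tau>" using \<eta>_pos \<open>0 < \<epsilon>\<close> by (simp add: \<tau>_def)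
    show "h (circle_exp w) \<in> U \<and> f (h (circle_exp w)) = h (circle_exp (\<Phi> w))"
      if w: "0 < - Im w" "- Im w < \<tau>" for w
    proof -
      have "2 * pi * (- Im w) < ln (1 + \<epsilon>)"
        using w(2) by (simp add: \<tau>_def pos_less_divide_eq mult.commute)
      then have "exp (2 * pi * (- Im w)) < exp (ln (1 + \<epsilon>))" by (simp only: exp_less_cancel_iff)
      then have lt: "cmod (circle_exp w) < 1 + \<epsilon>" using \<open>0 < \<epsilon>\<close> by (simp add: cmod_circle_exp)
      have gt: "1 < cmod (circle_exp w)" using w(1) by (simp add: cmod_circle_exp mult_less_0_iff)
      note * = hfg[OF gt lt]
      have "bij_betw h disk_exterior (- K)" using h by (simp add: exterior_riemann_map_def)
      then have "h (g (circle_exp w)) = f (h (circle_exp w))"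
        using * by (simp add: bij_betw_def f_inv_into_f)
      moreover have "circle_exp (\<Phi> w) = g (circle_exp w)" using w by (intro \<Phi>(3)) (simp add: \<tau>_def)
      ultimately show ?thesis using * by simp
    qed
  qed (use K U f h \<Phi>(2) in auto)
  then show ?thesis by blast
qed

theorem corollary1p3:
  fixes \<theta> :: real and K U :: "complex set" and f \<phi> :: "complex \<Rightarrow> complex"
  assumes "\<theta> \<notin> \<rat>"
    and "compact K" and "connected K" and "0 \<in> K" and "K \<noteq> {0}" and "connected (- K)"
    and "open U" and "K \<subseteq> U" and "f holomorphic_on U" and "inj_on f U"
    and "f 0 = 0" and "deriv f 0 = cis (2 * pi * \<theta>)"
    and "f ` K = K" and "inv_into U f ` K = K"
    and "external_circle_correspondence U f K \<theta>"
    and "\<not> holomorphically_linearizable f \<theta>"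
    and "continuous_on K \<phi>"
  shows "(\<lambda>N. SUP z\<in>K. cmod ((\<Sum>j<N. \<phi> ((f ^^ j) z)) / of_nat N - \<phi> 0)) \<longlonglongrightarrow> 0"
proof (rule LIMSEQ_I)
  fix r :: real assume "0 < r"
  have fK: "f ` K \<subseteq> K" using assms(13) by simp
  obtain F D \<rho> B \<Phi> \<eta> h \<tau> where "exterior_lift F D \<rho> B \<Phi> \<eta> h f K U \<tau>"
    using correspondence_imp_exterior_lift[OF assms(2,4,7-9) fK assms(11,15)] by blast
  then interpret exterior_lift F D \<rho> B \<Phi> \<eta> h f K U \<tau> .
  have "0 \<notin> interior K"
    using linearizable_if_interior[OF assms(2) _ assms(7-9,11,12) fK] assms(16) by blast
  then have cl: "0 \<in> closure (- K)" by (simp add: closure_complement)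
  have "0 < r / 4" using \<open>0 < r\<close> by simp
  have "\<forall>\<^sub>F n in sequentially. \<forall>z\<in>K.
      cmod ((\<Sum>j<n. \<phi> ((f ^^ j) z)) / of_nat n - \<phi> 0) \<le> 2 * (r / 4)"
    by (rule averages_converge[OF assms(2,6,4) cl fK averages_close assms(17) \<open>0 < r / 4\<close>])
  then obtain n0 where n0: "\<And>n z. n0 \<le> n \<Longrightarrow> z \<in> K \<Longrightarrow>
    cmod ((\<Sum>j<n. \<phi> ((f ^^ j) z)) / of_nat n - \<phi> 0) \<le> r / 2"
    unfolding eventually_sequentially by auto
  have "norm ((SUP z\<in>K. cmod ((\<Sum>j<n. \<phi> ((f ^^ j) z)) / of_nat n - \<phi> 0)) - 0) < r" if "n0 \<le> n" for n
  proof -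
    let ?s = "\<lambda>z. cmod ((\<Sum>j<n. \<phi> ((f ^^ j) z)) / of_nat n - \<phi> 0)"
    have "(SUP z\<in>K. ?s z) \<le> r / 2" using n0[OF that] assms(4) by (intro cSUP_least) auto
    moreover have "?s 0 \<le> (SUP z\<in>K. ?s z)"
      by (rule cSUP_upper[OF assms(4) bdd_aboveI2[OF n0[OF that]]])
    then have "0 \<le> (SUP z\<in>K. ?s z)" using norm_ge_zero order_trans by blast
    ultimately show ?thesis using \<open>0 < r\<close> by simp
  qed
  then show "\<exists>n0. \<forall>n\<ge>n0. norm ((SUP z\<in>K. cmod ((\<Sum>j<n. \<phi> ((f ^^ j) z)) / of_nat n - \<phi> 0)) - 0) < r"
    by blast
qed

end
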